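(* Let $d\ge 1$ and let $\ell$ be a length function on $\mathbb{Z}^d$ which is either the word-length function for some finite generating subset of $\mathbb{Z}^d$, or the restriction to $\mathbb{Z}^d$ of some norm on $\mathbb{R}^d$. Let $c$ be a $2$-cocycle on $\mathbb{Z}^d$ with values in the circle group $\mathbb{T}$, and let $\pi$ be the regular representation of $C^*(\mathbb{Z}^d,c)$ on $\ell^2(\mathbb{Z}^d)$. Then the seminorm $L_\ell$ defined on $C_c(\mathbb{Z}^d)$ by $L_\ell(f)=\|[M_\ell,\pi_f]\|$ is a Lip-norm on $C^*(\mathbb{Z}^d,c)$.
   Context: Let $G$ be a countable discrete group (here $G=\mathbb{Z}^d$). A $2$-cocycle on $G$ is a function $c:G\times G\to\mathbb{T}$ with $c(x,y)c(xy,z)=c(y,z)c(x,yz)$, normalized so that $c(x,y)=1$ if $x=e$ or $y=e$. $C_c(G)$ is the space of finitely supported complex functions on $G$, with twisted convolution $(f*g)(x)=\sum_y f(y)g(y^{-1}x)c(y,y^{-1}x)$ and involution $f^*(x)=\overline{f(x^{-1})}\,\overline{c(x,x^{-1})}$. The left regular representation $\pi$ on the Hilbert space $\ell^2(G)$ is given by $\pi_f=\sum_y f(y)\pi_y$, $(\pi_y\xi)(x)=\xi(y^{-1}x)c(y,y^{-1}x)$. The reduced algebra $C^*_r(G,c)$ is the completion of $C_c(G)$ for the norm $\|\pi_f\|$; for $G=\mathbb{Z}^d$ (amenable) it coincides with the full twisted group algebra $C^*(G,c)$. A length function on $G$ is a function $\ell:G\to[0,\infty)$ with $\ell(xy)\le\ell(x)+\ell(y)$,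 $\ell(x^{-1})=\ell(x)$, and $\ell(x)=0$ exactly if $x=e$. The word-length function of a finite generating set $S$ assigns to $x$ the least number of factors needed to write $x$ as a product of elements of $S\cup S^{-1}$. $M_\ell$ is the (usually unbounded) operator on $\ell^2(G)$ of pointwise multiplication by $\ell$; for $f\in C_c(G)$ the commutator $[M_\ell,\pi_f]$ is (extends to) a bounded operator. Given a seminorm $L$ on a dense unital $*$-subalgebra $A$ of a unital $C^*$-algebra $\bar A$ with $L(1)=0$, define on the state space $S(\bar A)$ the metric $\rho_L(\mu,\nu)=\sup\{|\mu(a)-\nu(a)|: a\in A,\ L(a)\le 1\}$ (possibly with value $+\infty$). $L$ is called a Lip-norm if the topology on $S(\bar A)$ from $\rho_L$ coincides with the weak-$*$ topology. *)

theory Defs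
  imports "HOL-Analysis.Analysis" "HOL-Library.Nonpos_Ints"
begin

section \<open>The Hilbert space \<open>\<ell>\<^sup>2\<close>\<close>

typedef 'a ell2 = "{f :: 'a \<Rightarrow> complex. (\<lambda>x. (cmod (f x))\<^sup>2) summable_on UNIV}"
  by (rule exI[of _ "\<lambda>_. 0"]) simp

setup_lifting type_definition_ell2

lemma ell2_summable_add:
  fixes f g :: "'a \<Rightarrow> complex"
  assumes "(\<lambda>x. (cmod (f x))\<^sup>2) summable_on UNIV" "(\<lambda>x. (cmod (g x))\<^sup>2) summable_on UNIV"
  shows "(\<lambda>x. (cmod (f x + g x))\<^sup>2) summable_on UNIV"
proof (rule summable_on_comparison_test)
  show "(\<lambda>x. 2 * (cmod (f x))\<^sup>2 + 2 * (cmod (g x))\<^sup>2) summable_on UNIV"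
    by (intro summable_on_add summable_on_cmult_right assms)
  fix x
  have "(cmod (f x + g x))\<^sup>2 \<le> (cmod (f x) + cmod (g x))\<^sup>2"
    by (intro power_mono norm_triangle_ineq) auto
  also have "\<dots> \<le> 2 * (cmod (f x))\<^sup>2 + 2 * (cmod (g x))\<^sup>2"
    using sum_squares_bound[of "cmod (f x)" "cmod (g x)"] by (simp add: power2_sum)
  finally show "(cmod (f x + g x))\<^sup>2 \<le> 2 * (cmod (f x))\<^sup>2 + 2 * (cmod (g x))\<^sup>2" .
qed auto

lemma ell2_summable_mult:
  fixes f :: "'a \<Rightarrow> complex"
  assumes "(\<lambda>x. (cmod (f x))\<^sup>2) summable_on UNIV"
  shows "(\<lambda>x. (cmod (z * f x))\<^sup>2) summable_on UNIV"
  using summable_on_cmult_right[OF assms, of "(cmod z)\<^sup>2"] by (simp add: norm_mult power_mult_distrib)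

lemma ell2_summable_prod:
  fixes f g :: "'a \<Rightarrow> complex"
  assumes "(\<lambda>x. (cmod (f x))\<^sup>2) summable_on UNIV" "(\<lambda>x. (cmod (g x))\<^sup>2) summable_on UNIV"
  shows "(\<lambda>x. f x * cnj (g x)) summable_on UNIV"
proof (rule abs_summable_summable, rule summable_on_comparison_test)
  show "(\<lambda>x. (cmod (f x))\<^sup>2 + (cmod (g x))\<^sup>2) summable_on UNIV"
    by (intro summable_on_add assms)
  fix x
  have "2 * (cmod (f x) * cmod (g x)) \<le> (cmod (f x))\<^sup>2 + (cmod (g x))\<^sup>2"
    using sum_squares_bound[of "cmod (f x)" "cmod (g x)"] by simp
  moreover have "0 \<le> cmod (f x) * cmod (g x)" by simp
  ultimately show "norm (f x * cnj (g x)) \<le> (cmod (f x))\<^sup>2 + (cmod (g x))\<^sup>2"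
    unfolding norm_mult complex_mod_cnj by linarith
qed auto

text \<open>Complex scalar multiplication and the complex inner product, linear in the first argument.\<close>

lift_definition scaleC :: "complex \<Rightarrow> 'a ell2 \<Rightarrow> 'a ell2" is "\<lambda>z f x. z * f x"
  by (rule ell2_summable_mult)

lift_definition cinner :: "'a ell2 \<Rightarrow> 'a ell2 \<Rightarrow> complex" is
  "\<lambda>f g. \<Sum>\<^sub>\<infinity>x. f x * cnj (g x)" .

instantiation ell2 :: (type) real_inner
begin

lift_definition zero_ell2 :: "'a ell2" is "\<lambda>_. 0" by simp
lift_definition plus_ell2 :: "'a ell2 \<Rightarrow> 'a ell2 \<Rightarrow> 'a ell2" is "\<lambda>f g x. f x + g x"
  by (rule ell2_summable_add)
lift_definition uminus_ell2 :: "'a ell2 \<Rightarrow> 'a ell2" is "\<lambda>f x. - f x" by simp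
definition minus_ell2 :: "'a ell2 \<Rightarrow> 'a ell2 \<Rightarrow> 'a ell2" where "minus_ell2 f g = f + - g"
definition scaleR_ell2 :: "real \<Rightarrow> 'a ell2 \<Rightarrow> 'a ell2" where "scaleR_ell2 r = scaleC (of_real r)"
definition inner_ell2 :: "'a ell2 \<Rightarrow> 'a ell2 \<Rightarrow> real" where "inner_ell2 f g = Re (cinner f g)"
definition norm_ell2 :: "'a ell2 \<Rightarrow> real" where "norm_ell2 f = sqrt (inner f f)"
definition sgn_ell2 :: "'a ell2 \<Rightarrow> 'a ell2" where "sgn_ell2 f = scaleC (of_real (inverse (norm f))) f"
definition dist_ell2 :: "'a ell2 \<Rightarrow> 'a ell2 \<Rightarrow> real" where "dist_ell2 f g = norm (f - g)"
definition uniformity_ell2 :: "('a ell2 \<times> 'a ell2) filter"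
  where "uniformity_ell2 = (INF e\<in>{0<..}. principal {(x, y). dist x y < e})"
definition open_ell2 :: "'a ell2 set \<Rightarrow> bool"
  where "open_ell2 U \<longleftrightarrow> (\<forall>x\<in>U. \<forall>\<^sub>F (x', y) in uniformity. x' = x \<longrightarrow> y \<in> U)"

lemma cinner_add_left: "cinner (f + g) h = cinner f h + cinner g (h :: 'a ell2)"
  by transfer (simp add: distrib_right infsum_add ell2_summable_prod)

lemma cinner_scaleC_left: "cinner (scaleC z f) h = z * cinner f (h :: 'a ell2)"
  by transfer (simp add: mult.assoc infsum_cmult_right ell2_summable_prod)

lemma cinner_commute: "cinner f g = cnj (cinner g (f :: 'a ell2))"
  by transfer (simp flip: infsum_cnj add: mult.commute)

lemma inner_ell2_self: "inner f f = (\<Sum>\<^sub>\<infinity>x. (cmod (Rep_ell2 f x))\<^sup>2)"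
proof -
  have "inner f f = Re (\<Sum>\<^sub>\<infinity>x. Rep_ell2 f x * cnj (Rep_ell2 f x))"
    by (simp add: inner_ell2_def cinner.rep_eq)
  also have "\<dots> = (\<Sum>\<^sub>\<infinity>x. Re (Rep_ell2 f x * cnj (Rep_ell2 f x)))"
    using Rep_ell2[of f] by (intro infsum_Re[symmetric] ell2_summable_prod) auto
  finally show ?thesis by (simp add: complex_norm_square[symmetric] flip: of_real_power)
qed

instance
proof
  fix f g h :: "'a ell2" and r s :: real
  show "f + g + h = f + (g + h)" by transfer (simp add: add.assoc)
  show "f + g = g + f" by transfer (simp add: add.commute)
  show "0 + f = f" by transfer simp
  show "- f + f = 0" by transfer simp
  show "f - g = f + - g" by (rule minus_ell2_def)
  show "r *\<^sub>R (f + g) = r *\<^sub>R f + r *\<^sub>R g"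
    unfolding scaleR_ell2_def by transfer (simp add: algebra_simps)
  show "(r + s) *\<^sub>R f = r *\<^sub>R f + s *\<^sub>R f"
    unfolding scaleR_ell2_def by transfer (simp add: algebra_simps)
  show "r *\<^sub>R s *\<^sub>R f = (r * s) *\<^sub>R f"
    unfolding scaleR_ell2_def by transfer (simp add: algebra_simps)
  show "1 *\<^sub>R f = f"
    unfolding scaleR_ell2_def by transfer simp
  show "sgn f = scaleR (inverse (norm f)) f" by (simp only: sgn_ell2_def scaleR_ell2_def)
  show "dist f g = norm (f - g)" by (rule dist_ell2_def)
  show "uniformity = (INF e\<in>{0<..}. principal {(x, y :: 'a ell2). dist x y < e})"
    by (rule uniformity_ell2_def)
  show "open U \<longleftrightarrow> (\<forall>x\<in>U. \<forall>\<^sub>F (x', y) in uniformity. x' = x \<longrightarrow> y \<in> U)" for U :: "'a ell2 set"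
    by (rule open_ell2_def)
  show "inner f g = inner g f"
    unfolding inner_ell2_def by (subst cinner_commute) simp
  show "inner (f + g) h = inner f h + inner g h"
    by (simp add: inner_ell2_def cinner_add_left)
  show "inner (r *\<^sub>R f) g = r * inner f g"
    by (simp add: inner_ell2_def scaleR_ell2_def cinner_scaleC_left)
  show "0 \<le> inner f f"
    unfolding inner_ell2_self by (rule infsum_nonneg) simp
  show "inner f f = 0 \<longleftrightarrow> f = 0"
  proof
    assume *: "inner f f = 0"
    have "(cmod (Rep_ell2 f x))\<^sup>2 = 0" for x
      by (rule nonneg_infsum_le_0D[where A = UNIV])
         (use Rep_ell2[of f] * in \<open>auto simp: inner_ell2_self\<close>)
    then show "f = 0"
      by (simp add: Rep_ell2_inject[symmetric] zero_ell2.rep_eq fun_eq_iff)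
  qed (simp add: inner_ell2_self zero_ell2.rep_eq)
  show "norm f = sqrt (inner f f)" by (rule norm_ell2_def)
qed

end

lemma norm_scaleC: "norm (scaleC z f) = cmod z * norm (f :: 'a ell2)"
proof -
  have "inner (scaleC z f) (scaleC z f) = (cmod z)\<^sup>2 * inner f f"
    using Rep_ell2[of f]
    by (simp add: inner_ell2_self scaleC.rep_eq norm_mult power_mult_distrib infsum_cmult_right)
  then show ?thesis by (simp add: norm_eq_sqrt_inner real_sqrt_mult)
qed

text \<open>
  Operators on \<open>\<ell>\<^sup>2\<close> are the library's bounded (a priori only real-linear) maps with the operator
  norm.  Whatever has an adjoint with respect to \<^term>\<open>cinner\<close> is automatically complex linear,
  and on complex linear operators the norm is the usual one.
\<close>

type_synonym 'a op = "'a ell2 \<Rightarrow>\<^sub>L 'a ell2"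

lemma bounded_linear_scaleC: "bounded_linear (scaleC z :: 'a ell2 \<Rightarrow> 'a ell2)"
proof (rule bounded_linear_intro[where K = "cmod z"])
  fix f g :: "'a ell2" and r :: real
  show "scaleC z (f + g) = scaleC z f + scaleC z g" by transfer (simp add: algebra_simps)
  show "scaleC z (r *\<^sub>R f) = r *\<^sub>R scaleC z f"
    unfolding scaleR_ell2_def by transfer (simp add: algebra_simps)
  show "norm (scaleC z f) \<le> norm f * cmod z" by (simp add: norm_scaleC)
qed

definition scaleC_op :: "complex \<Rightarrow> 'a op \<Rightarrow> 'a op" where
  "scaleC_op z T = Blinfun (scaleC z) o\<^sub>L T"

lemma scaleC_op_apply [simp]: "scaleC_op z T \<xi> = scaleC z (T \<xi>)"
  by (simp add: scaleC_op_def bounded_linear_Blinfun_apply bounded_linear_scaleC)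

definition is_adjoint :: "'a op \<Rightarrow> 'a op \<Rightarrow> bool" where
  "is_adjoint S T \<longleftrightarrow> (\<forall>\<xi> \<eta>. cinner (S \<xi>) \<eta> = cinner \<xi> (T \<eta>))"


section \<open>States and Lip-norms\<close>

definition unital_star_algebra :: "'a op set \<Rightarrow> bool" where
  "unital_star_algebra A \<longleftrightarrow>
     id_blinfun \<in> A \<and>
     (\<forall>S\<in>A. \<forall>T\<in>A. S + T \<in> A) \<and>
     (\<forall>z. \<forall>T\<in>A. scaleC_op z T \<in> A) \<and>
     (\<forall>S\<in>A. \<forall>T\<in>A. S o\<^sub>L T \<in> A) \<and>
     (\<forall>T\<in>A. \<exists>S\<in>A. is_adjoint S T)"

definition unital_cstar_algebra :: "'a op set \<Rightarrow> bool" where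
  "unital_cstar_algebra B \<longleftrightarrow> unital_star_algebra B \<and> closed B"

text \<open>
  Functionals on \<open>B\<close> are represented extensionally (value \<^term>\<open>undefined\<close> off \<open>B\<close>), so that a
  state is determined by its values on \<open>B\<close>.  In the positivity clause \<open>S\<close> is \<open>T\<^sup>*\<close>.
\<close>

definition states :: "'a op set \<Rightarrow> ('a op \<Rightarrow> complex) set" where
  "states B = {\<mu> \<in> extensional B.
     (\<forall>S\<in>B. \<forall>T\<in>B. \<mu> (S + T) = \<mu> S + \<mu> T) \<and>
     (\<forall>z. \<forall>T\<in>B. \<mu> (scaleC_op z T) = z * \<mu> T) \<and>
     (\<forall>S\<in>B. \<forall>T\<in>B. is_adjoint S T \<longrightarrow> \<mu> (S o\<^sub>L T) \<in> \<real>\<^sub>\<ge>\<^sub>0) \<and>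
     \<mu> id_blinfun = 1}"

definition weak_star_topology :: "'a op set \<Rightarrow> ('a op \<Rightarrow> complex) topology" where
  "weak_star_topology B = subtopology (product_topology (\<lambda>_. euclidean) B) (states B)"

definition rho :: "'a op set \<Rightarrow> ('a op \<Rightarrow> real) \<Rightarrow> ('a op \<Rightarrow> complex) \<Rightarrow> ('a op \<Rightarrow> complex) \<Rightarrow> ennreal"
  where "rho A L \<mu> \<nu> = (SUP a\<in>{a \<in> A. L a \<le> 1}. ennreal (cmod (\<mu> a - \<nu> a)))"

definition rho_topology :: "'a op set \<Rightarrow> 'a op set \<Rightarrow> ('a op \<Rightarrow> real) \<Rightarrow> ('a op \<Rightarrow> complex) topology"
  where "rho_topology B A L = topology (\<lambda>U. U \<subseteq> states B \<and>
     (\<forall>\<mu>\<in>U. \<exists>\<epsilon>>0. \<forall>\<nu>\<in>states B. rho A L \<mu> \<nu> < \<epsilon> \<longrightarrow> \<nu> \<in> U))"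

lemma openin_rho_topology:
  "openin (rho_topology B A L) U \<longleftrightarrow> U \<subseteq> states B \<and>
     (\<forall>\<mu>\<in>U. \<exists>\<epsilon>>0. \<forall>\<nu>\<in>states B. rho A L \<mu> \<nu> < \<epsilon> \<longrightarrow> \<nu> \<in> U)"
proof -
  let ?P = "\<lambda>U. U \<subseteq> states B \<and>
     (\<forall>\<mu>\<in>U. \<exists>\<epsilon>>0. \<forall>\<nu>\<in>states B. rho A L \<mu> \<nu> < \<epsilon> \<longrightarrow> \<nu> \<in> U)"
  have Int: "?P (U \<inter> V)" if U: "?P U" and V: "?P V" for U V
  proof (intro conjI ballI)
    fix \<mu> assume "\<mu> \<in> U \<inter> V"
    with U V obtain d e where "d > 0" "e > 0"
      "\<forall>\<nu>\<in>states B. rho A L \<mu> \<nu> < d \<longrightarrow> \<nu> \<in> U" "\<forall>\<nu>\<in>states B. rho A L \<mu> \<nu> < e \<longrightarrow> \<nu> \<in> V"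
      by blast
    then show "\<exists>\<epsilon>>0. \<forall>\<nu>\<in>states B. rho A L \<mu> \<nu> < \<epsilon> \<longrightarrow> \<nu> \<in> U \<inter> V"
      by (intro exI[of _ "min d e"]) auto
  qed (use U in blast)
  have Un: "?P (\<Union>\<K>)" if K: "\<forall>K\<in>\<K>. ?P K" for \<K>
  proof (intro conjI ballI)
    fix \<mu> assume "\<mu> \<in> \<Union>\<K>"
    then obtain K where "K \<in> \<K>" "\<mu> \<in> K" by blast
    with K obtain \<epsilon> where "\<epsilon> > 0" "\<forall>\<nu>\<in>states B. rho A L \<mu> \<nu> < \<epsilon> \<longrightarrow> \<nu> \<in> K" by blast
    with \<open>K \<in> \<K>\<close> show "\<exists>\<epsilon>>0. \<forall>\<nu>\<in>states B. rho A L \<mu> \<nu> < \<epsilon> \<longrightarrow> \<nu> \<in> \<Union>\<K>" by blast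
  qed (use K in blast)
  have "istopology ?P"
    unfolding istopology_def by (rule conjI; intro allI impI; fact Int Un)
  then show ?thesis by (simp add: rho_topology_def topology_inverse')
qed

definition seminorm_on :: "'a op set \<Rightarrow> ('a op \<Rightarrow> real) \<Rightarrow> bool" where
  "seminorm_on A L \<longleftrightarrow>
     (\<forall>a\<in>A. 0 \<le> L a) \<and>
     (\<forall>a\<in>A. \<forall>b\<in>A. L (a + b) \<le> L a + L b) \<and>
     (\<forall>z. \<forall>a\<in>A. L (scaleC_op z a) = cmod z * L a)"

definition lip_norm :: "'a op set \<Rightarrow> 'a op set \<Rightarrow> ('a op \<Rightarrow> real) \<Rightarrow> bool" where
  "lip_norm B A L \<longleftrightarrow>
     unital_cstar_algebra B \<and>
     unital_star_algebra A \<and> A \<subseteq> B \<and> B \<subseteq> closure A \<and>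
     seminorm_on A L \<and> L id_blinfun = 0 \<and>
     rho_topology B A L = weak_star_topology B"


section \<open>Twisted group algebras\<close>

text \<open>Groups are written additively; \<open>y\<inverse>x\<close> becomes \<open>- y + x\<close>.\<close>

definition cocycle :: "('g::group_add \<Rightarrow> 'g \<Rightarrow> complex) \<Rightarrow> bool" where
  "cocycle c \<longleftrightarrow>
     (\<forall>x y. cmod (c x y) = 1) \<and>
     (\<forall>x y z. c x y * c (x + y) z = c y z * c x (y + z)) \<and>
     (\<forall>x. c 0 x = 1 \<and> c x 0 = 1)"

text \<open>
  \<^term>\<open>Abs_ell2\<close> and \<^term>\<open>Blinfun\<close> are meaningful here when \<open>c\<close> is a cocycle,
  see \<open>Rep_pi_op\<close> below.
\<close>

definition pi_op :: "('g::group_add \<Rightarrow> 'g \<Rightarrow> complex) \<Rightarrow> 'g \<Rightarrow> 'g op" where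
  "pi_op c y = Blinfun (\<lambda>\<xi>. Abs_ell2 (\<lambda>x. Rep_ell2 \<xi> (- y + x) * c y (- y + x)))"

definition regular_rep :: "('g::group_add \<Rightarrow> 'g \<Rightarrow> complex) \<Rightarrow> ('g \<Rightarrow> complex) \<Rightarrow> 'g op" where
  "regular_rep c f = (\<Sum>y | f y \<noteq> 0. scaleC_op (f y) (pi_op c y))"

definition Cc :: "('g \<Rightarrow> complex) set" where
  "Cc = {f. finite {x. f x \<noteq> 0}}"

text \<open>
  \<open>C\<^sub>c(G)\<close> with its twisted convolution and involution is identified with its image under the
  regular representation, which is faithful (\<open>inj_on_regular_rep\<close>); the completion for
  the norm \<open>\<parallel>\<pi>\<^sub>f\<parallel>\<close> is then the closure of this image in the operator norm.
\<close>

definition twisted_algebra :: "('g::group_add \<Rightarrow> 'g \<Rightarrow> complex) \<Rightarrow> 'g op set" where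
  "twisted_algebra c = regular_rep c ` Cc"

definition twisted_cstar :: "('g::group_add \<Rightarrow> 'g \<Rightarrow> complex) \<Rightarrow> 'g op set" where
  "twisted_cstar c = closure (twisted_algebra c)"

lemma bij_translate: "bij (\<lambda>x. - y + x :: 'g::group_add)"
  by (rule bij_betw_byWitness[where f' = "\<lambda>x. y + x"]) (auto simp flip: add.assoc)

lemma translate_eq_0: "- y + x = 0 \<longleftrightarrow> y = (x :: 'g::group_add)"
  by (metis add.right_neutral add_minus_cancel left_minus)

lemma shift_ell2:
  fixes c :: "'g::group_add \<Rightarrow> 'g \<Rightarrow> complex"
  assumes "cocycle c"
  shows "(\<lambda>x. (cmod (Rep_ell2 \<xi> (- y + x) * c y (- y + x)))\<^sup>2) summable_on UNIV"
  using summable_on_reindex_bij_betw[OF bij_translate[of y], of "\<lambda>x. (cmod (Rep_ell2 \<xi> x))\<^sup>2"]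
    Rep_ell2[of \<xi>] assms by (simp add: norm_mult cocycle_def)

lemma Rep_pi_op:
  fixes c :: "'g::group_add \<Rightarrow> 'g \<Rightarrow> complex"
  assumes c: "cocycle c"
  shows "Rep_ell2 (pi_op c y \<xi>) x = Rep_ell2 \<xi> (- y + x) * c y (- y + x)"
proof -
  define T where "T \<xi> = Abs_ell2 (\<lambda>x. Rep_ell2 \<xi> (- y + x) * c y (- y + x))" for \<xi>
  have R: "Rep_ell2 (T \<xi>) = (\<lambda>x. Rep_ell2 \<xi> (- y + x) * c y (- y + x))" for \<xi>
    unfolding T_def by (rule Abs_ell2_inverse) (use shift_ell2[OF c] in auto)
  have "bounded_linear T"
  proof (rule bounded_linear_intro[where K = 1])
    fix \<xi> \<eta> :: "'g ell2" and r :: real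
    show "T (\<xi> + \<eta>) = T \<xi> + T \<eta>"
      by (simp only: Rep_ell2_inject[symmetric] R plus_ell2.rep_eq) (simp add: algebra_simps)
    show "T (r *\<^sub>R \<xi>) = r *\<^sub>R T \<xi>"
      by (simp only: Rep_ell2_inject[symmetric] R scaleR_ell2_def scaleC.rep_eq) (simp add: algebra_simps)
    have "inner (T \<xi>) (T \<xi>) = inner \<xi> \<xi>"
      using infsum_reindex_bij_betw[OF bij_translate[of y], of "\<lambda>x. (cmod (Rep_ell2 \<xi> x))\<^sup>2"] c
      by (simp add: inner_ell2_self R norm_mult cocycle_def)
    then show "norm (T \<xi>) \<le> norm \<xi> * 1" by (simp add: norm_eq_sqrt_inner)
  qed
  then show ?thesis by (simp add: pi_op_def bounded_linear_Blinfun_apply R flip: T_def)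
qed

lemma Rep_ell2_sum: "Rep_ell2 (sum f A) x = (\<Sum>a\<in>A. Rep_ell2 (f a) x)"
  by (induction A rule: infinite_finite_induct) (auto simp: zero_ell2.rep_eq plus_ell2.rep_eq)

lemma Rep_regular_rep:
  fixes c :: "'g::group_add \<Rightarrow> 'g \<Rightarrow> complex"
  assumes "cocycle c"
  shows "Rep_ell2 (regular_rep c f \<xi>) x
    = (\<Sum>y | f y \<noteq> 0. f y * (Rep_ell2 \<xi> (- y + x) * c y (- y + x)))"
  by (simp add: regular_rep_def blinfun.sum_left Rep_ell2_sum scaleC.rep_eq
      Rep_pi_op[OF assms])

lemma inj_on_regular_rep:
  fixes c :: "'g::group_add \<Rightarrow> 'g \<Rightarrow> complex"
  assumes c: "cocycle c"
  shows "inj_on (regular_rep c) Cc"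
proof -
  define \<delta> :: "'g ell2" where "\<delta> = Abs_ell2 (\<lambda>x. if x = 0 then 1 else 0)"
  have "(\<lambda>x::'g. (cmod (if x = 0 then 1 else 0))\<^sup>2) summable_on UNIV"
    by (rule finite_nonzero_values_imp_summable_on) (auto intro: finite_subset[of _ "{0}"])
  then have \<delta>: "Rep_ell2 \<delta> = (\<lambda>x. if x = 0 then 1 else 0)"
    unfolding \<delta>_def by (intro Abs_ell2_inverse) simp
  have "Rep_ell2 (regular_rep c f \<delta>) x = f x" if "f \<in> Cc" for f x
  proof -
    have "Rep_ell2 (regular_rep c f \<delta>) x = (\<Sum>y | f y \<noteq> 0. if y = x then f x else 0)"
      unfolding Rep_regular_rep[OF c] \<delta>
      by (rule sum.cong) (use c in \<open>auto simp: cocycle_def translate_eq_0\<close>)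
    then show ?thesis using that by (simp add: Cc_def)
  qed
  then show ?thesis by (metis inj_onI ext)
qed


section \<open>Length functions and the seminorm\<close>

definition length_function :: "('g::group_add \<Rightarrow> real) \<Rightarrow> bool" where
  "length_function len \<longleftrightarrow>
     (\<forall>x. 0 \<le> len x) \<and> (\<forall>x y. len (x + y) \<le> len x + len y) \<and> (\<forall>x. len (- x) = len x) \<and>
     (\<forall>x. len x = 0 \<longleftrightarrow> x = 0)"

definition word_for :: "'g::group_add set \<Rightarrow> 'g list \<Rightarrow> 'g \<Rightarrow> bool" where
  "word_for S w x \<longleftrightarrow> set w \<subseteq> S \<union> uminus ` S \<and> sum_list w = x"

definition generating :: "'g::group_add set \<Rightarrow> bool" where
  "generating S \<longleftrightarrow> (\<forall>x. \<exists>w. word_for S w x)"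

definition word_length :: "'g::group_add set \<Rightarrow> 'g \<Rightarrow> real" where
  "word_length S x = real (LEAST n. \<exists>w. word_for S w x \<and> length w = n)"

definition is_norm :: "('v::real_vector \<Rightarrow> real) \<Rightarrow> bool" where
  "is_norm N \<longleftrightarrow>
     (\<forall>v. 0 \<le> N v) \<and> (\<forall>v. N v = 0 \<longleftrightarrow> v = 0) \<and>
     (\<forall>r v. N (r *\<^sub>R v) = \<bar>r\<bar> * N v) \<and> (\<forall>v w. N (v + w) \<le> N v + N w)"

definition of_int_vec :: "int ^ 'd \<Rightarrow> real ^ 'd" where
  "of_int_vec x = (\<chi> i. of_int (x $ i))"

definition mult_dom :: "('g \<Rightarrow> real) \<Rightarrow> 'g ell2 set" where
  "mult_dom len = {\<xi>. (\<lambda>x. (cmod (of_real (len x) * Rep_ell2 \<xi> x))\<^sup>2) summable_on UNIV}"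

text \<open>The unbounded operator \<open>M\<^sub>\<ell>\<close>; to be used on its natural domain \<^term>\<open>mult_dom len\<close> only.\<close>

definition mult_op :: "('g \<Rightarrow> real) \<Rightarrow> 'g ell2 \<Rightarrow> 'g ell2" where
  "mult_op len \<xi> = Abs_ell2 (\<lambda>x. of_real (len x) * Rep_ell2 \<xi> x)"

text \<open>
  \<open>\<parallel>[M\<^sub>\<ell>, T]\<parallel>\<close>, the norm of the densely defined commutator and hence of its bounded extension.
  The set under the supremum is bounded for \<open>T = \<pi>\<^sub>f\<close> by \<open>bdd_above_commutator\<close>.
\<close>

definition commutator_norm :: "('g \<Rightarrow> real) \<Rightarrow> 'g op \<Rightarrow> real" where
  "commutator_norm len T =
     (SUP \<xi>\<in>{\<xi>. \<xi> \<in> mult_dom len \<and> T \<xi> \<in> mult_dom len \<and> norm \<xi> \<le> 1}.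
        norm (mult_op len (T \<xi>) - T (mult_op len \<xi>)))"

lemma Rep_mult_op:
  assumes "\<xi> \<in> mult_dom len"
  shows "Rep_ell2 (mult_op len \<xi>) x = of_real (len x) * Rep_ell2 \<xi> x"
  using assms by (simp add: mult_op_def mult_dom_def Abs_ell2_inverse)

lemma norm_ell2_le:
  fixes f g :: "'a ell2"
  assumes "\<And>x. cmod (Rep_ell2 f x) \<le> cmod (Rep_ell2 g x)"
  shows "norm f \<le> norm g"
proof -
  have "inner f f \<le> inner g g"
    unfolding inner_ell2_self
    by (rule infsum_mono) (use Rep_ell2[of f] Rep_ell2[of g] assms in \<open>auto intro!: power_mono\<close>)
  then show ?thesis by (simp add: norm_eq_sqrt_inner)
qed

lemma norm_pi_op:
  assumes c: "cocycle c"
  shows "norm (pi_op c y \<xi>) = norm \<xi>"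
  using infsum_reindex_bij_betw[OF bij_translate[of y], of "\<lambda>x. (cmod (Rep_ell2 \<xi> x))\<^sup>2"] c
  by (simp add: norm_ell2_def inner_ell2_self Rep_pi_op norm_mult cocycle_def)

lemma length_function_diff:
  assumes "length_function len"
  shows "\<bar>len x - len (- y + x)\<bar> \<le> len (y :: 'g::group_add)"
proof -
  have "len (y + (- y + x)) \<le> len y + len (- y + x)" "len (- y + x) \<le> len (- y) + len x" "len (- y) = len y"
    using assms unfolding length_function_def by blast+
  moreover have "y + (- y + x) = x" by (simp flip: add.assoc)
  ultimately show ?thesis by simp
qed

lemma bdd_above_commutator:
  fixes c :: "'g::group_add \<Rightarrow> 'g \<Rightarrow> complex"
  assumes c: "cocycle c" and len: "length_function len"
  shows "bdd_above ((\<lambda>\<xi>. norm (mult_op len (regular_rep c f \<xi>) - regular_rep c f (mult_op len \<xi>))) `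
    {\<xi>. \<xi> \<in> mult_dom len \<and> regular_rep c f \<xi> \<in> mult_dom len \<and> norm \<xi> \<le> 1})"
proof (rule bdd_aboveI2)
  fix \<xi> :: "'g ell2"
  let ?T = "regular_rep c f"
  define \<zeta> where "\<zeta> y = Abs_ell2 (\<lambda>x. of_real (len x - len (- y + x)) * Rep_ell2 (pi_op c y \<xi>) x)" for y
  assume \<xi>: "\<xi> \<in> {\<xi>. \<xi> \<in> mult_dom len \<and> ?T \<xi> \<in> mult_dom len \<and> norm \<xi> \<le> 1}"
  have le: "cmod (of_real (len x - len (- y + x)) * Rep_ell2 (pi_op c y \<xi>) x)
      \<le> cmod (Rep_ell2 (scaleC (of_real (len y)) (pi_op c y \<xi>)) x)" for x y
    using length_function_diff[OF len, of x y]
    by (simp add: scaleC.rep_eq norm_mult mult_right_mono flip: of_real_diff)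
  have \<zeta>: "Rep_ell2 (\<zeta> y) x = of_real (len x - len (- y + x)) * Rep_ell2 (pi_op c y \<xi>) x" for x y
  proof -
    have "(\<lambda>x. (cmod (of_real (len x - len (- y + x)) * Rep_ell2 (pi_op c y \<xi>) x))\<^sup>2) summable_on UNIV"
      by (rule summable_on_comparison_test
           [where f = "\<lambda>x. (cmod (Rep_ell2 (scaleC (of_real (len y)) (pi_op c y \<xi>)) x))\<^sup>2"])
         (use Rep_ell2[of "scaleC (of_real (len y)) (pi_op c y \<xi>)"] le
           in \<open>auto intro!: power_mono\<close>)
    then show ?thesis unfolding \<zeta>_def by (simp add: Abs_ell2_inverse)
  qed
  have n\<zeta>: "norm (\<zeta> y) \<le> \<bar>len y\<bar>" for y
  proof -
    have "norm (\<zeta> y) \<le> norm (scaleC (of_real (len y)) (pi_op c y \<xi>))"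
      by (rule norm_ell2_le) (use le in \<open>simp add: \<zeta>\<close>)
    also have "\<dots> \<le> \<bar>len y\<bar> * 1"
      unfolding norm_scaleC norm_pi_op[OF c] norm_of_real using \<xi> by (intro mult_left_mono) auto
    finally show ?thesis by simp
  qed
  have "mult_op len (?T \<xi>) - ?T (mult_op len \<xi>) = (\<Sum>y | f y \<noteq> 0. scaleC (f y) (\<zeta> y))"
    unfolding Rep_ell2_inject[symmetric]
  proof
    fix x
    have "Rep_ell2 (mult_op len (?T \<xi>) - ?T (mult_op len \<xi>)) x =
        Rep_ell2 (mult_op len (?T \<xi>)) x - Rep_ell2 (?T (mult_op len \<xi>)) x"
      by (simp only: minus_ell2_def plus_ell2.rep_eq uminus_ell2.rep_eq) simp
    also have "\<dots> = (\<Sum>y | f y \<noteq> 0. f y * Rep_ell2 (\<zeta> y) x)"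
      using \<xi> unfolding Rep_regular_rep[OF c] \<zeta> Rep_pi_op[OF c]
      by (simp add: Rep_mult_op Rep_regular_rep[OF c] sum_distrib_left flip: sum_subtractf)
         (rule sum.cong; simp add: algebra_simps)
    finally show "Rep_ell2 (mult_op len (?T \<xi>) - ?T (mult_op len \<xi>)) x =
        Rep_ell2 (\<Sum>y | f y \<noteq> 0. scaleC (f y) (\<zeta> y)) x"
      by (simp add: Rep_ell2_sum scaleC.rep_eq)
  qed
  then show "norm (mult_op len (?T \<xi>) - ?T (mult_op len \<xi>)) \<le> (\<Sum>y | f y \<noteq> 0. cmod (f y) * \<bar>len y\<bar>)"
    by (simp only:) (rule sum_norm_le, simp only: norm_scaleC, rule mult_left_mono[OF n\<zeta>], simp)
qed

end

theory Submission
  imports Defs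
begin

text \<open>
  Write \<open>L(f)\<close> for the norm of \<open>[M\<^sub>\<ell>, \<pi>\<^sub>f]\<close>. The plan is to bound ordinary derivations by \<open>L\<close> and then to
  use the classical fact that an element all of whose coordinate derivations are bounded by a constant
  is, uniformly, close to its truncation to a large box.

  The commutator is \<open>\<Sum>\<^sub>y f(y) \<phi>\<^sub>y \<pi>\<^sub>y\<close>, where \<open>\<phi>\<^sub>y(x) = \<ell>(x) - \<ell>(x - y)\<close> acts by multiplication.
  Translations on the right, twisted by the cocycle, are unitary and commute with every \<open>\<pi>\<^sub>y\<close>;
  conjugating by them replaces \<open>\<phi>\<^sub>y(x)\<close> by \<open>\<phi>\<^sub>y(x + p)\<close> without changing the norm. Hence averaging the
  functions \<open>\<phi>\<^sub>y\<close> over any finite set of translates \<open>p\<close> does not increase the norm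
  (\<open>commutator_pairing\<close>). Along sets that become more and more invariant such averages lose their
  dependence on \<open>x\<close>, and because \<open>\<phi>\<^sub>y\<^sub>+\<^sub>z(x) = \<phi>\<^sub>y(x) + \<phi>\<^sub>z(x - y)\<close> their limits are additive in \<open>y\<close>. So
  they have the form \<open>y \<mapsto> s \<bullet> y\<close> with a vector \<open>s\<close>, a mean slope of \<open>\<ell>\<close>, and the derivation
  \<open>f \<mapsto> (y \<mapsto> (s \<bullet> y) f(y))\<close> is bounded by \<open>L\<close> (\<open>norm_derivation_le_commutator\<close>).

  There are enough slopes. Averaging over a cube swept along a much longer segment in direction \<open>u\<close>
  makes the sum of \<open>\<phi>\<^sub>u\<close> telescope to about \<open>\<ell>(m u) / m\<close>, and both kinds of length functions dominate a
  positive multiple \<open>\<kappa>\<close> of the Euclidean norm. So for every lattice vector \<open>u\<close> there is a mean slope with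
  \<open>s \<bullet> u \<ge> \<kappa> \<parallel>u\<parallel>\<close> (\<open>exists_mean_slope\<close>). A real vector orthogonal to all controlled slopes would contradict
  this at the lattice points close to its large multiples; hence all coordinate derivations are
  controlled by \<open>L\<close> (\<open>derivation_bounded\<close>).

  For the second half, grade the algebra by one coordinate \<open>y \<mapsto> y\<^sub>i\<close>. Orthogonality of the graded pieces
  shows that multiplying the piece of degree \<open>k\<close> by \<open>g(k)\<close> has norm at most the \<open>\<ell>\<^sup>2\<close>-norm of \<open>g\<close>
  (\<open>norm_multiplier_le\<close>). With \<open>g(k) = 1/k\<close> for \<open>\<bar>k\<bar> > n\<close> this bounds the tail of \<open>f\<close> beyond degree \<open>n\<close> by a
  small multiple of the \<open>i\<close>-th derivation, and induction over the coordinates gives approximation by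
  truncations to boxes (\<open>truncate_box_approx\<close>).

  Finally, on a box the coefficients away from \<open>0\<close> are bounded and the coefficient at \<open>0\<close> is invisible to a
  difference of states, so two states that are close on finitely many \<open>\<pi>\<^sub>y\<close> are close in \<open>\<rho>\<^sub>L\<close>
  (\<open>states_uniformly_close\<close>). The converse comparison of the topologies only needs that states are
  contractive (\<open>states_contractive\<close>) and that the algebra is dense (\<open>rho_topology_evaluation_continuous\<close>).
\<close>

section \<open>Completeness of \<open>\<ell>\<^sup>2\<close> and finitely supported vectors\<close>

lemma summable_cmod_Rep_ell2: "(\<lambda>x. (cmod (Rep_ell2 f x))\<^sup>2) summable_on UNIV"
  using Rep_ell2[of f] by simp

lemma power2_norm_ell2: "(norm f)\<^sup>2 = (\<Sum>\<^sub>\<infinity>x. (cmod (Rep_ell2 f x))\<^sup>2)"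
  by (metis inner_ell2_self power2_norm_eq_inner)

lemma ell2_eqI: "(\<And>x. Rep_ell2 f x = Rep_ell2 g x) \<Longrightarrow> f = g"
  by (metis Rep_ell2_inject ext)

lemma Rep_ell2_minus: "Rep_ell2 (f - g) x = Rep_ell2 f x - Rep_ell2 g x"
  by (simp only: minus_ell2_def plus_ell2.rep_eq uminus_ell2.rep_eq) simp

lemma sum_cmod_Rep_ell2_le: "finite E \<Longrightarrow> (\<Sum>x\<in>E. (cmod (Rep_ell2 f x))\<^sup>2) \<le> (norm f)\<^sup>2"
  unfolding power2_norm_ell2 by (rule finite_sum_le_infsum[OF summable_cmod_Rep_ell2]) auto

lemma cmod_Rep_ell2_le: "cmod (Rep_ell2 f x) \<le> norm f"
  using sum_cmod_Rep_ell2_le[of "{x}" f] by (simp add: power2_le_iff_abs_le)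

text \<open>
  Completeness makes the bounded operators a Banach space. It is used twice: adjoints have to pass to
  limits, and square roots of operators are obtained from a fixed point theorem.
\<close>

instance ell2 :: (type) banach
proof
  fix X :: "nat \<Rightarrow> 'a ell2"
  assume C: "Cauchy X"
  have "Cauchy (\<lambda>n. Rep_ell2 (X n) x)" for x
  proof (rule CauchyI)
    fix e :: real assume "e > 0"
    with C obtain M where M: "\<And>m n. m \<ge> M \<Longrightarrow> n \<ge> M \<Longrightarrow> norm (X m - X n) < e"
      by (meson CauchyD)
    show "\<exists>M. \<forall>m\<ge>M. \<forall>n\<ge>M. norm (Rep_ell2 (X m) x - Rep_ell2 (X n) x) < e"
      using M cmod_Rep_ell2_le[of "X _ - X _" x] by (metis Rep_ell2_minus le_less_trans)
  qed
  then have "\<exists>l. (\<lambda>n. Rep_ell2 (X n) x) \<longlonglongrightarrow> l" for x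
    by (meson Cauchy_convergent convergent_def)
  then obtain g where g: "\<And>x. (\<lambda>n. Rep_ell2 (X n) x) \<longlonglongrightarrow> g x" by metis
  have fin: "\<exists>M. \<forall>m\<ge>M. \<forall>E. finite E \<longrightarrow> (\<Sum>x\<in>E. (cmod (Rep_ell2 (X m) x - g x))\<^sup>2) \<le> e\<^sup>2"
    if "e > 0" for e
  proof -
    from C that obtain M where M: "\<And>m n. m \<ge> M \<Longrightarrow> n \<ge> M \<Longrightarrow> norm (X m - X n) < e"
      by (meson CauchyD)
    have "(\<Sum>x\<in>E. (cmod (Rep_ell2 (X m) x - g x))\<^sup>2) \<le> e\<^sup>2" if "m \<ge> M" "finite E" for m E
    proof (rule Lim_bounded)
      show "(\<lambda>n. \<Sum>x\<in>E. (cmod (Rep_ell2 (X m) x - Rep_ell2 (X n) x))\<^sup>2)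
          \<longlonglongrightarrow> (\<Sum>x\<in>E. (cmod (Rep_ell2 (X m) x - g x))\<^sup>2)"
        by (intro tendsto_intros g)
      show "\<forall>n\<ge>M. (\<Sum>x\<in>E. (cmod (Rep_ell2 (X m) x - Rep_ell2 (X n) x))\<^sup>2) \<le> e\<^sup>2"
      proof (intro allI impI)
        fix n assume "n \<ge> M"
        have "(\<Sum>x\<in>E. (cmod (Rep_ell2 (X m) x - Rep_ell2 (X n) x))\<^sup>2) \<le> (norm (X m - X n))\<^sup>2"
          using sum_cmod_Rep_ell2_le[OF \<open>finite E\<close>, of "X m - X n"] by (simp add: Rep_ell2_minus)
        also have "\<dots> \<le> e\<^sup>2"
          using M[OF \<open>m \<ge> M\<close> \<open>n \<ge> M\<close>] by (intro power_mono) auto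
        finally show "(\<Sum>x\<in>E. (cmod (Rep_ell2 (X m) x - Rep_ell2 (X n) x))\<^sup>2) \<le> e\<^sup>2" .
      qed
    qed
    then show ?thesis by blast
  qed
  \<comment> \<open>a bound on all finite partial sums gives summability, so the pointwise limit lies in \<open>\<ell>\<^sup>2\<close>\<close>
  have summ: "(\<lambda>x. (cmod (Rep_ell2 (X m) x - g x))\<^sup>2) summable_on UNIV"
    if "\<forall>E. finite E \<longrightarrow> (\<Sum>x\<in>E. (cmod (Rep_ell2 (X m) x - g x))\<^sup>2) \<le> b" for m b
    by (rule nonneg_bdd_above_summable_on) (use that in \<open>auto intro!: bdd_aboveI2\<close>)
  from fin[of 1] obtain M where
    "\<forall>E. finite E \<longrightarrow> (\<Sum>x\<in>E. (cmod (Rep_ell2 (X M) x - g x))\<^sup>2) \<le> 1\<^sup>2" by auto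
  \<comment> \<open>the limit differs from a term of the sequence by a square-summable function\<close>
  from summ[OF this] have "(\<lambda>x. (cmod (- 1 * (Rep_ell2 (X M) x - g x)))\<^sup>2) summable_on UNIV"
    by (rule ell2_summable_mult)
  from ell2_summable_add[OF summable_cmod_Rep_ell2[of "X M"] this]
  have "(\<lambda>x. (cmod (g x))\<^sup>2) summable_on UNIV" by simp
  then have G: "Rep_ell2 (Abs_ell2 g) = g" by (intro Abs_ell2_inverse) simp
  have "X \<longlonglongrightarrow> Abs_ell2 g"
  proof (rule LIMSEQ_I)
    fix e :: real assume "e > 0"
    with fin[of "e / 2"] obtain M where M: "\<And>m E. m \<ge> M \<Longrightarrow> finite E \<Longrightarrow>
        (\<Sum>x\<in>E. (cmod (Rep_ell2 (X m) x - g x))\<^sup>2) \<le> (e / 2)\<^sup>2"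
      by (auto simp del: power_divide)
    have "norm (X m - Abs_ell2 g) < e" if "m \<ge> M" for m
    proof -
      have "(norm (X m - Abs_ell2 g))\<^sup>2 \<le> (e / 2)\<^sup>2"
        unfolding power2_norm_ell2
        by (rule infsum_le_finite_sums[OF summable_cmod_Rep_ell2])
           (use M that in \<open>auto simp: Rep_ell2_minus G\<close>)
      then have "norm (X m - Abs_ell2 g) \<le> e / 2"
        using \<open>e > 0\<close> by (meson half_gt_zero less_imp_le power2_le_imp_le)
      then show ?thesis using \<open>e > 0\<close> by simp
    qed
    then show "\<exists>M. \<forall>m\<ge>M. norm (X m - Abs_ell2 g) < e" by blast
  qed
  then show "convergent X" by (auto simp: convergent_def)
qed

definition finsupp :: "'a ell2 set" where
  "finsupp = {\<xi>. finite {x. Rep_ell2 \<xi> x \<noteq> 0}}"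

lift_definition restrict_ell2 :: "'a set \<Rightarrow> 'a ell2 \<Rightarrow> 'a ell2" is "\<lambda>E f x. if x \<in> E then f x else 0"
  by (rule summable_on_comparison_test) auto

lemma restrict_ell2_finsupp: "finite E \<Longrightarrow> restrict_ell2 E \<xi> \<in> finsupp"
  unfolding finsupp_def by (auto simp: restrict_ell2.rep_eq intro: finite_subset[of _ E])

lemma closure_finsupp: "closure finsupp = (UNIV :: 'a ell2 set)"
proof -
  have "\<exists>\<eta>\<in>finsupp. dist \<eta> \<xi> < e" if "e > 0" for \<xi> :: "'a ell2" and e
  proof -
    let ?g = "\<lambda>x. (cmod (Rep_ell2 \<xi> x))\<^sup>2"
    have "(?g has_sum infsum ?g UNIV) UNIV"
      using summable_cmod_Rep_ell2 by (rule has_sum_infsum)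
    then have "\<forall>\<^sub>F E in finite_subsets_at_top UNIV. dist (sum ?g E) (infsum ?g UNIV) < e\<^sup>2"
      using that by (intro tendstoD) (auto simp: has_sum_def)
    then obtain E where E: "finite E" "dist (sum ?g E) (infsum ?g UNIV) < e\<^sup>2"
      unfolding eventually_finite_subsets_at_top by blast
    have "(norm (restrict_ell2 E \<xi> - \<xi>))\<^sup>2 = infsum ?g (UNIV - E)"
      unfolding power2_norm_ell2
      by (rule infsum_cong_neutral) (auto simp: Rep_ell2_minus restrict_ell2.rep_eq)
    also have "\<dots> = infsum ?g UNIV - infsum ?g E"
      by (rule infsum_Diff) (use summable_cmod_Rep_ell2 E in auto)
    also have "\<dots> < e\<^sup>2" using E by (simp add: dist_real_def)
    finally show ?thesis
      using E restrict_ell2_finsupp that by (metis dist_norm less_imp_le power_less_imp_less_base)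
  qed
  then show ?thesis by (auto simp: closure_approachable)
qed

text \<open>
  Finitely supported vectors are dense, so they suffice to estimate an operator norm. On them all sums
  are finite and the unbounded operator \<open>M\<^sub>\<ell>\<close> is defined.
\<close>

lemma norm_op_le_finsupp:
  fixes T :: "'a op"
  assumes "\<And>\<eta>. \<eta> \<in> finsupp \<Longrightarrow> norm (T \<eta>) \<le> C * norm \<eta>" and "C \<ge> 0"
  shows "norm T \<le> C"
proof (rule norm_blinfun_bound[OF \<open>C \<ge> 0\<close>])
  fix \<xi> :: "'a ell2"
  have "closed {\<xi>. norm (T \<xi>) \<le> C * norm \<xi>}"
    by (intro closed_Collect_le continuous_intros)
  then have "closure finsupp \<subseteq> {\<xi>. norm (T \<xi>) \<le> C * norm \<xi>}"
    using assms by (intro closure_minimal) auto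
  then show "norm (T \<xi>) \<le> C * norm \<xi>" by (auto simp: closure_finsupp)
qed

lemma inner_ell2_finite:
  assumes "finite E" "\<And>x. x \<notin> E \<Longrightarrow> Rep_ell2 g x = 0"
  shows "inner f g = (\<Sum>x\<in>E. Re (Rep_ell2 f x * cnj (Rep_ell2 g x)))"
proof -
  have "cinner f g = (\<Sum>\<^sub>\<infinity>x\<in>E. Rep_ell2 f x * cnj (Rep_ell2 g x))"
    unfolding cinner.rep_eq by (rule infsum_cong_neutral) (use assms in auto)
  then show ?thesis using assms by (simp add: inner_ell2_def)
qed

lemma inner_ell2_disjoint:
  assumes "\<And>x. Rep_ell2 f x = 0 \<or> Rep_ell2 g x = 0"
  shows "inner f g = 0"
proof -
  have "cinner f g = 0"
    unfolding cinner.rep_eq by (rule infsum_0) (use assms in force)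
  then show ?thesis by (simp add: inner_ell2_def)
qed

section \<open>Adjoints and closures of star algebras\<close>

lemma cinner_add_right: "cinner h (f + g) = cinner h f + cinner h g"
  by (metis cinner_add_left cinner_commute complex_cnj_add)

lemma cinner_scaleC_right: "cinner h (scaleC z f) = cnj z * cinner h f"
  by (metis cinner_scaleC_left cinner_commute complex_cnj_mult)

lemma cinner_self: "cinner f f = of_real ((norm f)\<^sup>2)"
proof (rule complex_eqI)
  show "Im (cinner f f) = Im (of_real ((norm f)\<^sup>2))"
    using arg_cong[OF cinner_commute[of f f], of Im] by simp
qed (simp add: power2_norm_eq_inner inner_ell2_def)

lemma is_adjoint_sym: "is_adjoint S T \<Longrightarrow> is_adjoint T S"
  unfolding is_adjoint_def by (metis cinner_commute)

lemma is_adjoint_id: "is_adjoint id_blinfun id_blinfun"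
  by (simp add: is_adjoint_def)

lemma is_adjoint_add: "is_adjoint S T \<Longrightarrow> is_adjoint S' T' \<Longrightarrow> is_adjoint (S + S') (T + T')"
  by (simp add: is_adjoint_def blinfun.add_left cinner_add_left cinner_add_right)

lemma is_adjoint_scaleC: "is_adjoint S T \<Longrightarrow> is_adjoint (scaleC_op z S) (scaleC_op (cnj z) T)"
  by (simp add: is_adjoint_def cinner_scaleC_left cinner_scaleC_right)

lemma is_adjoint_compose: "is_adjoint S T \<Longrightarrow> is_adjoint S' T' \<Longrightarrow> is_adjoint (S o\<^sub>L S') (T' o\<^sub>L T)"
  by (simp add: is_adjoint_def)

text \<open>
  The norm topology on operators uses real scalars, while algebras and states are defined with the
  complex ones; this identity translates between them.
\<close>

lemma scaleR_eq_scaleC_op: "r *\<^sub>R T = scaleC_op (of_real r) T"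
  by (rule blinfun_eqI) (simp add: blinfun.scaleR_left scaleR_ell2_def)

lemma uminus_eq_scaleC_op: "- T = scaleC_op (- 1) T"
  using scaleR_eq_scaleC_op[of "- 1" T] by simp

lemma norm_scaleC_op: "norm (scaleC_op z T) = cmod z * norm T"
proof -
  have le: "norm (scaleC_op z T) \<le> cmod z * norm T" for z and T :: "'a op"
  proof (rule norm_blinfun_bound)
    fix \<xi>
    show "norm (scaleC_op z T \<xi>) \<le> cmod z * norm T * norm \<xi>"
      by (simp add: norm_scaleC mult.assoc mult_left_mono norm_blinfun)
  qed simp
  show ?thesis
  proof (cases "z = 0")
    case False
    have "scaleC_op (inverse z) (scaleC_op z T) = T"
      by (rule blinfun_eqI, rule ell2_eqI) (use False in \<open>simp add: scaleC.rep_eq\<close>)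
    then have "norm T \<le> cmod (inverse z) * norm (scaleC_op z T)"
      using le[of "inverse z" "scaleC_op z T"] by simp
    then have "cmod z * norm T \<le> norm (scaleC_op z T)"
      using False by (simp add: norm_inverse norm_divide field_simps)
    with le[of z T] show ?thesis by simp
  qed (use le[of z T] in simp)
qed

lemma norm_adjoint_le:
  assumes "is_adjoint S T"
  shows "norm S \<le> norm T"
proof (rule norm_blinfun_bound)
  fix \<xi>
  have "(norm (S \<xi>))\<^sup>2 = inner \<xi> (T (S \<xi>))"
    using assms unfolding is_adjoint_def inner_ell2_def power2_norm_eq_inner by metis
  also have "\<dots> \<le> norm \<xi> * norm (T (S \<xi>))"
    by (rule norm_cauchy_schwarz)
  also have "\<dots> \<le> norm \<xi> * (norm T * norm (S \<xi>))"
    by (intro mult_left_mono norm_blinfun) auto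
  finally have "norm (S \<xi>) * norm (S \<xi>) \<le> (norm T * norm \<xi>) * norm (S \<xi>)"
    by (simp add: power2_eq_square mult_ac)
  then show "norm (S \<xi>) \<le> norm T * norm \<xi>"
    by (cases "norm (S \<xi>) = 0") (auto dest: mult_right_le_imp_le)
qed simp

lemma norm_adjoint: "is_adjoint S T \<Longrightarrow> norm S = norm T"
  by (meson antisym is_adjoint_sym norm_adjoint_le)

lemma is_adjoint_diff: "is_adjoint S T \<Longrightarrow> is_adjoint S' T' \<Longrightarrow> is_adjoint (S - S') (T - T')"
  using is_adjoint_add[of S T "scaleC_op (- 1) S'" "scaleC_op (- 1) T'"]
    is_adjoint_scaleC[of S' T' "- 1"]
  by (simp flip: uminus_eq_scaleC_op)

text \<open>
  Both parts of the complex inner product are real inner products, so continuity follows from that of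
  the latter.
\<close>

lemma tendsto_cinner:
  assumes "(f \<longlongrightarrow> a) F" "(g \<longlongrightarrow> b) F"
  shows "((\<lambda>x. cinner (f x) (g x)) \<longlongrightarrow> cinner a b) F"
proof -
  have eq: "cinner u v = of_real (inner u v) + \<i> * of_real (- inner (scaleC \<i> u) v)"
    for u v :: "'b ell2"
    by (rule complex_eqI) (simp_all add: inner_ell2_def cinner_scaleC_left)
  show ?thesis
    unfolding eq by (intro tendsto_intros assms bounded_linear.tendsto[OF bounded_linear_scaleC])
qed

lemma is_adjoint_limit:
  assumes "\<And>n. is_adjoint (S n) (T n)" "S \<longlonglongrightarrow> S'" "T \<longlonglongrightarrow> T'"
  shows "is_adjoint S' T'"
  unfolding is_adjoint_def
proof (intro allI)
  fix \<xi> \<eta>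
  have "(\<lambda>n. cinner (S n \<xi>) \<eta>) \<longlonglongrightarrow> cinner (S' \<xi>) \<eta>"
    by (intro tendsto_cinner tendsto_const blinfun.tendsto assms)
  moreover have "(\<lambda>n. cinner (S n \<xi>) \<eta>) \<longlonglongrightarrow> cinner \<xi> (T' \<eta>)"
    using assms(1) unfolding is_adjoint_def
    by (simp, intro tendsto_cinner tendsto_const blinfun.tendsto assms)
  ultimately show "cinner (S' \<xi>) \<eta> = cinner \<xi> (T' \<eta>)"
    by (rule LIMSEQ_unique)
qed

lemma unital_star_algebra_add: "unital_star_algebra A \<Longrightarrow> S \<in> A \<Longrightarrow> T \<in> A \<Longrightarrow> S + T \<in> A"
  and unital_star_algebra_scaleC: "unital_star_algebra A \<Longrightarrow> T \<in> A \<Longrightarrow> scaleC_op z T \<in> A"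
  and unital_star_algebra_compose: "unital_star_algebra A \<Longrightarrow> S \<in> A \<Longrightarrow> T \<in> A \<Longrightarrow> S o\<^sub>L T \<in> A"
  and unital_star_algebra_id: "unital_star_algebra A \<Longrightarrow> id_blinfun \<in> A"
  and unital_star_algebra_adjoint: "unital_star_algebra A \<Longrightarrow> T \<in> A \<Longrightarrow> \<exists>S\<in>A. is_adjoint S T"
  by (auto simp: unital_star_algebra_def)

lemma unital_star_algebra_diff: "unital_star_algebra A \<Longrightarrow> S \<in> A \<Longrightarrow> T \<in> A \<Longrightarrow> S - T \<in> A"
  using unital_star_algebra_add[of A S "scaleC_op (- 1) T"] unital_star_algebra_scaleC[of A T "- 1"]
  by (simp flip: uminus_eq_scaleC_op)

text \<open>
  The only point that is not continuity of the operations is the adjoint: passing to adjoints preserves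
  distances, so the adjoints of a convergent sequence form a Cauchy sequence.
\<close>

lemma unital_cstar_algebra_closure:
  assumes A: "unital_star_algebra A"
  shows "unital_cstar_algebra (closure A)"
proof -
  have "S + T \<in> closure A" "S o\<^sub>L T \<in> closure A"
    if ST: "S \<in> closure A" "T \<in> closure A" for S T
  proof -
    from ST obtain s t where st: "\<And>n. s n \<in> A" "s \<longlonglongrightarrow> S" "\<And>n. t n \<in> A" "t \<longlonglongrightarrow> T"
      by (metis closure_sequential)
    then have "(\<lambda>n. s n + t n) \<longlonglongrightarrow> S + T" "(\<lambda>n. s n o\<^sub>L t n) \<longlonglongrightarrow> (S o\<^sub>L T)"
      by (auto intro: tendsto_add bounded_bilinear.tendsto[OF bounded_bilinear_blinfun_compose])
    with st A show "S + T \<in> closure A" "S o\<^sub>L T \<in> closure A"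
      unfolding closure_sequential
      by (meson unital_star_algebra_add unital_star_algebra_compose)+
  qed
  moreover have "scaleC_op z T \<in> closure A" if T: "T \<in> closure A" for z T
  proof -
    from T obtain t where t: "\<And>n. t n \<in> A" "t \<longlonglongrightarrow> T"
      by (metis closure_sequential)
    then have "(\<lambda>n. scaleC_op z (t n)) \<longlonglongrightarrow> scaleC_op z T"
      unfolding scaleC_op_def
      by (intro bounded_bilinear.tendsto[OF bounded_bilinear_blinfun_compose] tendsto_const)
    with t A show ?thesis
      unfolding closure_sequential by (meson unital_star_algebra_scaleC)
  qed
  moreover have "\<exists>S\<in>closure A. is_adjoint S T" if T: "T \<in> closure A" for T
  proof -
    from T obtain t where t: "\<And>n. t n \<in> A" "t \<longlonglongrightarrow> T"
      by (metis closure_sequential)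
    have "\<forall>n. \<exists>S. S \<in> A \<and> is_adjoint S (t n)"
      using unital_star_algebra_adjoint[OF A t(1)] by blast
    then obtain s where s: "\<And>n. s n \<in> A" "\<And>n. is_adjoint (s n) (t n)"
      by metis
    have "Cauchy s"
    proof (rule CauchyI)
      fix e :: real assume "e > 0"
      with LIMSEQ_imp_Cauchy[OF t(2)] show "\<exists>M. \<forall>m\<ge>M. \<forall>n\<ge>M. norm (s m - s n) < e"
        using norm_adjoint[OF is_adjoint_diff[OF s(2) s(2)]] by (simp add: Cauchy_iff)
    qed
    then obtain S where S: "s \<longlonglongrightarrow> S" by (auto simp: Cauchy_convergent_iff convergent_def)
    with s(1) have "S \<in> closure A" by (auto simp: closure_sequential)
    with is_adjoint_limit[OF s(2) S t(2)] show ?thesis by blast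
  qed
  moreover have "id_blinfun \<in> closure A"
    using unital_star_algebra_id[OF A] closure_subset by blast
  ultimately show ?thesis
    by (simp add: unital_cstar_algebra_def unital_star_algebra_def)
qed

section \<open>States are contractive\<close>

text \<open>
  If \<open>k = (h + k\<^sup>2) / 2\<close> then \<open>(1 - k)\<^sup>2 = 1 - h\<close>. The right-hand side is a contraction, with constant \<open>\<parallel>h\<parallel>\<close>, of
  the set of self-adjoint \<open>k\<close> in the algebra with \<open>\<parallel>k\<parallel> \<le> \<parallel>h\<parallel>\<close>.
\<close>

lemma cstar_sqrt:
  fixes h :: "'a op"
  assumes B: "unital_cstar_algebra B" and h: "h \<in> B" "is_adjoint h h" "norm h < 1"
  shows "\<exists>k\<in>B. is_adjoint k k \<and> k o\<^sub>L k = id_blinfun - h"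
proof -
  define K where "K = {k \<in> B. is_adjoint k k \<and> norm k \<le> norm h}"
  define F where "F k = (1/2) *\<^sub>R (h + (k o\<^sub>L k))" for k :: "'a op"
  have *: "unital_star_algebra B" "closed B" using B by (auto simp: unital_cstar_algebra_def)
  have "closed K"
    unfolding closed_sequential_limits
  proof (intro allI impI, elim conjE)
    fix x l assume x: "\<forall>n. x n \<in> K" "x \<longlonglongrightarrow> l"
    have "l \<in> B" using x *(2) closed_sequentially unfolding K_def by blast
    moreover have "is_adjoint l l" by (rule is_adjoint_limit[of x x]) (use x in \<open>auto simp: K_def\<close>)
    moreover have "norm l \<le> norm h"
      by (rule Lim_bounded[OF tendsto_norm[OF x(2)], of 0]) (use x in \<open>auto simp: K_def\<close>)
    ultimately show "l \<in> K" by (simp add: K_def)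
  qed
  then have "complete K" by (simp add: complete_eq_closed)
  moreover have "K \<noteq> {}" using h by (auto simp: K_def)
  moreover have "F ` K \<subseteq> K"
  proof
    fix T assume "T \<in> F ` K"
    then obtain k where k: "k \<in> B" "is_adjoint k k" "norm k \<le> norm h" "T = F k" by (auto simp: K_def)
    have "norm (k o\<^sub>L k) \<le> norm k * norm k" by (rule norm_blinfun_compose)
    also have "\<dots> \<le> 1 * norm h" using k h by (intro mult_mono) auto
    finally have "norm (h + (k o\<^sub>L k)) \<le> 2 * norm h"
      using norm_triangle_ineq[of h "k o\<^sub>L k"] by simp
    then have "norm T \<le> norm h" by (simp add: k F_def)
    moreover have "T \<in> B"
      unfolding k(4) F_def scaleR_eq_scaleC_op using h k *(1)
      by (intro unital_star_algebra_scaleC unital_star_algebra_add unital_star_algebra_compose)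
    moreover have "is_adjoint T T"
      using is_adjoint_scaleC[OF is_adjoint_add[OF h(2) is_adjoint_compose[OF k(2) k(2)]], of "of_real (1/2)"]
      unfolding k(4) F_def scaleR_eq_scaleC_op by simp
    ultimately show "T \<in> K" by (simp add: K_def)
  qed
  moreover have "dist (F k) (F k') \<le> norm h * dist k k'" if "k \<in> K" "k' \<in> K" for k k'
  proof -
    have "F k - F k' = (1/2) *\<^sub>R ((k o\<^sub>L (k - k')) + ((k - k') o\<^sub>L k'))"
      by (rule blinfun_eqI) (simp add: F_def blinfun.bilinear_simps algebra_simps)
    moreover have "norm ((k o\<^sub>L (k - k')) + ((k - k') o\<^sub>L k'))
        \<le> norm k * norm (k - k') + norm (k - k') * norm k'"
      by (intro norm_triangle_mono norm_blinfun_compose)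
    moreover have "\<dots> \<le> norm h * norm (k - k') + norm (k - k') * norm h"
      using that by (intro add_mono mult_mono) (auto simp: K_def)
    ultimately show ?thesis by (simp add: dist_norm)
  qed
  ultimately have "\<exists>!k\<in>K. F k = k"
    using h(3) by (intro Banach_fix[of K "norm h" F]) auto
  then obtain k where k: "k \<in> K" "F k = k" by blast
  then have "2 *\<^sub>R ((1/2) *\<^sub>R (h + (k o\<^sub>L k))) = 2 *\<^sub>R k" by (simp add: F_def)
  then have "h + (k o\<^sub>L k) = k + k" by (simp add: scaleR_2)
  then have "k o\<^sub>L k = k + k - h" by (simp add: algebra_simps)
  then have "k (k \<xi>) = k \<xi> + k \<xi> - h \<xi>" for \<xi>
    by (metis blinfun.add_left blinfun.diff_left blinfun_apply_blinfun_compose)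
  then have "(id_blinfun - k) o\<^sub>L (id_blinfun - k) = id_blinfun - h"
    by (intro blinfun_eqI) (simp add: blinfun.bilinear_simps)
  moreover have "is_adjoint (id_blinfun - k) (id_blinfun - k)"
    using k by (intro is_adjoint_diff is_adjoint_id) (auto simp: K_def)
  moreover have "id_blinfun - k \<in> B"
    using k *(1) by (auto simp: K_def intro!: unital_star_algebra_diff unital_star_algebra_id)
  ultimately show ?thesis by blast
qed

lemma states_add: "\<mu> \<in> states B \<Longrightarrow> S \<in> B \<Longrightarrow> T \<in> B \<Longrightarrow> \<mu> (S + T) = \<mu> S + \<mu> T"
  and states_scaleC: "\<mu> \<in> states B \<Longrightarrow> T \<in> B \<Longrightarrow> \<mu> (scaleC_op z T) = z * \<mu> T"
  and states_id: "\<mu> \<in> states B \<Longrightarrow> \<mu> id_blinfun = 1"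
  and states_pos: "\<mu> \<in> states B \<Longrightarrow> S \<in> B \<Longrightarrow> T \<in> B \<Longrightarrow> is_adjoint S T \<Longrightarrow> \<mu> (S o\<^sub>L T) \<in> \<real>\<^sub>\<ge>\<^sub>0"
  by (auto simp: states_def)

lemma states_diff:
  assumes "unital_star_algebra B" "\<mu> \<in> states B" "S \<in> B" "T \<in> B"
  shows "\<mu> (S - T) = \<mu> S - \<mu> T"
  using states_add[OF assms(2,3) unital_star_algebra_scaleC[OF assms(1,4), of "- 1"]]
    states_scaleC[OF assms(2,4), of "- 1"]
  by (simp flip: uminus_eq_scaleC_op)

text \<open>
  Positivity is applied to \<open>1 - h\<close>, which is the square of a self-adjoint element of the algebra because the
  algebra is norm closed.
\<close>

lemma states_selfadjoint_unit:
  assumes B: "unital_cstar_algebra B" and \<mu>: "\<mu> \<in> states B"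
    and h: "h \<in> B" "is_adjoint h h" "norm h < 1"
  shows "\<mu> h \<in> \<real> \<and> Re (\<mu> h) \<le> 1"
proof -
  have *: "unital_star_algebra B" using B by (auto simp: unital_cstar_algebra_def)
  obtain k where k: "k \<in> B" "is_adjoint k k" "k o\<^sub>L k = id_blinfun - h"
    using cstar_sqrt[OF B h] by blast
  have "1 - \<mu> h \<in> \<real>\<^sub>\<ge>\<^sub>0"
    using states_pos[OF \<mu> k(1,1,2)] states_diff[OF * \<mu> unital_star_algebra_id[OF *] h(1)]
      states_id[OF \<mu>] k by simp
  then show ?thesis by (auto simp: complex_nonneg_Reals_iff complex_is_Real_iff)
qed

lemma states_selfadjoint:
  assumes B: "unital_cstar_algebra B" and \<mu>: "\<mu> \<in> states B"
    and h: "h \<in> B" "is_adjoint h h"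
  shows "\<mu> h \<in> \<real>" "Re (\<mu> h) \<le> norm h"
proof -
  have *: "unital_star_algebra B" using B by (auto simp: unital_cstar_algebra_def)
  have r: "\<mu> h \<in> \<real> \<and> Re (\<mu> h) \<le> r" if "norm h < r" for r
  proof -
    have "r > 0" using that norm_ge_zero[of h] by linarith
    define g where "g = scaleC_op (of_real (inverse r)) h"
    have "g \<in> B" unfolding g_def by (rule unital_star_algebra_scaleC[OF * h(1)])
    moreover have "is_adjoint g g"
      using is_adjoint_scaleC[OF h(2), of "of_real (inverse r)"] by (simp add: g_def)
    moreover have "norm g < 1"
      using that \<open>r > 0\<close> unfolding g_def norm_scaleC_op norm_of_real by (simp add: field_simps)
    ultimately have "\<mu> g \<in> \<real> \<and> Re (\<mu> g) \<le> 1"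
      by (rule states_selfadjoint_unit[OF B \<mu>])
    moreover have "\<mu> h = of_real r * \<mu> g"
      using states_scaleC[OF \<mu> h(1)] \<open>r > 0\<close> by (simp add: g_def)
    ultimately show ?thesis using \<open>r > 0\<close> by (auto simp: complex_is_Real_iff)
  qed
  show "\<mu> h \<in> \<real>" using r[of "norm h + 1"] by simp
  show "Re (\<mu> h) \<le> norm h" by (rule dense_ge) (use r in simp)
qed

text \<open>
  After rotating \<open>T\<close> so that \<open>\<mu>(T) \<ge> 0\<close>, the value is that of the self-adjoint part of \<open>T\<close>, since \<open>\<mu>\<close> is real on
  self-adjoint elements; and the self-adjoint part has norm at most \<open>\<parallel>T\<parallel>\<close>.
\<close>

lemma states_contractive:
  assumes B: "unital_cstar_algebra B" and \<mu>: "\<mu> \<in> states B" and T: "T \<in> B"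
  shows "cmod (\<mu> T) \<le> norm T"
proof -
  have *: "unital_star_algebra B" using B by (auto simp: unital_cstar_algebra_def)
  \<comment> \<open>the phase that rotates \<open>\<mu>(T)\<close> to its absolute value\<close>
  define z where "z = (if \<mu> T = 0 then 1 else cnj (sgn (\<mu> T)))"
  have z: "cmod z = 1" "z * \<mu> T = of_real (cmod (\<mu> T))"
  proof -
    show "cmod z = 1" by (simp add: z_def norm_sgn)
    have "cnj (sgn w) * w = of_real (cmod w)" for w
    proof -
      have "cnj (sgn w) * w = (w * cnj w) / of_real (cmod w)" by (simp add: sgn_eq)
      also have "\<dots> = of_real ((cmod w)\<^sup>2) / of_real (cmod w)"
        by (simp only: complex_norm_square)
      finally show ?thesis by (simp add: power2_eq_square)
    qed
    then show "z * \<mu> T = of_real (cmod (\<mu> T))" by (simp add: z_def)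
  qed
  define S where "S = scaleC_op z T"
  have S: "S \<in> B" "norm S = norm T" "\<mu> S = of_real (cmod (\<mu> T))"
    using T * z states_scaleC[OF \<mu> T] by (auto simp: S_def norm_scaleC_op unital_star_algebra_scaleC)
  obtain R where R: "R \<in> B" "is_adjoint R S" using unital_star_algebra_adjoint[OF * S(1)] by blast
  have SR: "is_adjoint S R" using R by (simp add: is_adjoint_sym)
  have 1: "is_adjoint (S + R) (S + R)"
    using is_adjoint_add[OF SR R(2)] by (simp add: add.commute)
  have 2: "is_adjoint (scaleC_op \<i> (S - R)) (scaleC_op \<i> (S - R))"
  proof -
    have "scaleC_op (- \<i>) (R - S) = scaleC_op \<i> (S - R)"
      by (rule blinfun_eqI, rule ell2_eqI)
         (simp add: scaleC.rep_eq blinfun.bilinear_simps Rep_ell2_minus algebra_simps)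
    then show ?thesis using is_adjoint_scaleC[OF is_adjoint_diff[OF SR R(2)], of \<i>] by simp
  qed
  have m: "S + R \<in> B" "scaleC_op \<i> (S - R) \<in> B"
    using S R * by (auto intro!: unital_star_algebra_add unital_star_algebra_diff unital_star_algebra_scaleC)
  have "\<i> * (\<mu> S - \<mu> R) \<in> \<real>"
    using states_selfadjoint(1)[OF B \<mu> m(2) 2] states_scaleC[OF \<mu> unital_star_algebra_diff[OF * S(1) R(1)]]
      states_diff[OF * \<mu> S(1) R(1)] by simp
  then have "Re (\<mu> R) = cmod (\<mu> T)" by (simp add: complex_is_Real_iff S)
  moreover have "Re (\<mu> S + \<mu> R) \<le> norm (S + R)"
    using states_selfadjoint(2)[OF B \<mu> m(1) 1] states_add[OF \<mu> S(1) R(1)] by simp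
  moreover have "norm (S + R) \<le> norm T + norm T"
    using norm_triangle_ineq[of S R] norm_adjoint[OF R(2)] S by simp
  ultimately show ?thesis by (simp add: S)
qed

section \<open>The twisted group algebra\<close>

lemma scaleC_op_0_left [simp]: "scaleC_op 0 T = 0"
  by (rule blinfun_eqI, rule ell2_eqI) (simp add: scaleC.rep_eq zero_ell2.rep_eq)

lemma scaleC_op_1 [simp]: "scaleC_op 1 T = T"
  by (rule blinfun_eqI, rule ell2_eqI) (simp add: scaleC.rep_eq)

lemma scaleC_op_add_left: "scaleC_op (z + w) T = scaleC_op z T + scaleC_op w T"
  by (rule blinfun_eqI, rule ell2_eqI)
     (simp add: scaleC.rep_eq blinfun.add_left plus_ell2.rep_eq algebra_simps)

lemma scaleC_op_scaleC_op [simp]: "scaleC_op z (scaleC_op w T) = scaleC_op (z * w) T"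
  by (rule blinfun_eqI, rule ell2_eqI) (simp add: scaleC.rep_eq)

lemma scaleC_op_add_right: "scaleC_op z (S + T) = scaleC_op z S + scaleC_op z T"
  by (rule blinfun_eqI, rule ell2_eqI)
     (simp add: scaleC.rep_eq blinfun.add_left plus_ell2.rep_eq algebra_simps)

lemma scaleC_op_0_right [simp]: "scaleC_op z 0 = 0"
  by (rule blinfun_eqI, rule ell2_eqI) (simp add: scaleC.rep_eq zero_ell2.rep_eq)

lemma scaleC_op_sum_right: "scaleC_op z (\<Sum>i\<in>I. T i) = (\<Sum>i\<in>I. scaleC_op z (T i))"
  by (induction I rule: infinite_finite_induct) (auto simp: scaleC_op_add_right)

lemma cinner_pi_op:
  fixes c :: "'g::group_add \<Rightarrow> 'g \<Rightarrow> complex"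
  assumes c: "cocycle c"
  shows "cinner (pi_op c y \<xi>) (pi_op c y \<eta>) = cinner \<xi> \<eta>"
proof -
  have u: "c y w * cnj (c y w) = 1" for w
    using c by (simp add: cocycle_def flip: complex_norm_square)
  have "Rep_ell2 (pi_op c y \<xi>) x * cnj (Rep_ell2 (pi_op c y \<eta>) x)
      = Rep_ell2 \<xi> (- y + x) * cnj (Rep_ell2 \<eta> (- y + x))" for x
  proof -
    have "Rep_ell2 (pi_op c y \<xi>) x * cnj (Rep_ell2 (pi_op c y \<eta>) x)
      = Rep_ell2 \<xi> (- y + x) * cnj (Rep_ell2 \<eta> (- y + x)) * (c y (- y + x) * cnj (c y (- y + x)))"
      by (simp add: Rep_pi_op[OF c] mult_ac)
    then show ?thesis by (simp only: u mult_1_right)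
  qed
  then show ?thesis
    using infsum_reindex_bij_betw[OF bij_translate[of y], of "\<lambda>x. Rep_ell2 \<xi> x * cnj (Rep_ell2 \<eta> x)"]
    by (simp add: cinner.rep_eq)
qed

lemma pi_op_0:
  assumes c: "cocycle c" shows "pi_op c 0 = id_blinfun"
  by (rule blinfun_eqI, rule ell2_eqI) (use c in \<open>simp add: Rep_pi_op[OF c] cocycle_def\<close>)

lemma pi_op_compose:
  assumes c: "cocycle c"
  shows "pi_op c y o\<^sub>L pi_op c z = scaleC_op (c y z) (pi_op c (y + z))"
proof (rule blinfun_eqI, rule ell2_eqI)
  fix \<xi> x
  have "c y z * c (y + z) w = c z w * c y (z + w)" for w
    using c unfolding cocycle_def by blast
  from this[of "- z + (- y + x)"]
  have "c y z * c (y + z) (- z + (- y + x)) = c z (- z + (- y + x)) * c y (- y + x)" by simp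
  moreover have "- (y + z) + x = - z + (- y + x)" by (simp only: minus_add add.assoc)
  moreover have "Rep_ell2 ((pi_op c y o\<^sub>L pi_op c z) \<xi>) x
      = Rep_ell2 \<xi> (- z + (- y + x)) * (c z (- z + (- y + x)) * c y (- y + x))"
    by (simp add: Rep_pi_op[OF c])
  moreover have "Rep_ell2 (scaleC_op (c y z) (pi_op c (y + z)) \<xi>) x
      = Rep_ell2 \<xi> (- (y + z) + x) * (c y z * c (y + z) (- (y + z) + x))"
    by (simp only: scaleC_op_apply scaleC.rep_eq Rep_pi_op[OF c] mult.left_commute)
  ultimately show "Rep_ell2 ((pi_op c y o\<^sub>L pi_op c z) \<xi>) x
      = Rep_ell2 (scaleC_op (c y z) (pi_op c (y + z)) \<xi>) x"
    by (simp only:)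
qed

lemma is_adjoint_pi_op:
  assumes c: "cocycle c"
  shows "is_adjoint (pi_op c y) (scaleC_op (cnj (c y (- y))) (pi_op c (- y)))"
proof -
  let ?V = "scaleC_op (cnj (c y (- y))) (pi_op c (- y))"
  have u: "cnj (c y w) * c y w = 1" for w
    using c by (simp add: cocycle_def mult.commute flip: complex_norm_square)
  have V: "pi_op c y (?V \<eta>) = \<eta>" for \<eta>
  proof -
    have "pi_op c y (?V \<eta>) = scaleC (cnj (c y (- y))) ((pi_op c y o\<^sub>L pi_op c (- y)) \<eta>)"
      by (rule ell2_eqI) (simp add: Rep_pi_op[OF c] scaleC.rep_eq)
    also have "\<dots> = scaleC (cnj (c y (- y)) * c y (- y)) \<eta>"
      unfolding pi_op_compose[OF c]
      by (rule ell2_eqI) (simp add: scaleC.rep_eq pi_op_0[OF c])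
    finally show ?thesis unfolding u by (simp add: ell2_eqI scaleC.rep_eq)
  qed
  show ?thesis
    unfolding is_adjoint_def by (metis V cinner_pi_op[OF c])
qed

text \<open>
  Sums over the exact support are awkward for sums and products of functions; any finite set that
  contains the support will do.
\<close>

lemma regular_rep_superset:
  assumes "finite F" "\<And>y. f y \<noteq> 0 \<Longrightarrow> y \<in> F"
  shows "regular_rep c f = (\<Sum>y\<in>F. scaleC_op (f y) (pi_op c y))"
  unfolding regular_rep_def by (rule sum.mono_neutral_left) (use assms in auto)

lemma Cc_finite: "f \<in> Cc \<Longrightarrow> finite {y. f y \<noteq> 0}"
  by (simp add: Cc_def)

lemma Cc_subset: "f \<in> Cc \<Longrightarrow> (\<And>y. g y \<noteq> 0 \<Longrightarrow> f y \<noteq> 0) \<Longrightarrow> g \<in> Cc"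
  unfolding Cc_def by (auto intro: finite_subset[of _ "{y. f y \<noteq> 0}"])

lemma Cc_add: "f \<in> Cc \<Longrightarrow> g \<in> Cc \<Longrightarrow> (\<lambda>y. f y + g y) \<in> Cc"
  unfolding Cc_def by (auto intro: finite_subset[of _ "{y. f y \<noteq> 0} \<union> {y. g y \<noteq> 0}"])

lemma Cc_cmult: "f \<in> Cc \<Longrightarrow> (\<lambda>y. z y * f y) \<in> Cc"
  by (erule Cc_subset) auto

lemma regular_rep_add:
  assumes "f \<in> Cc" "g \<in> Cc"
  shows "regular_rep c (\<lambda>y. f y + g y) = regular_rep c f + regular_rep c g"
proof -
  let ?F = "{y. f y \<noteq> 0} \<union> {y. g y \<noteq> 0}"
  have "finite ?F" using assms by (simp add: Cc_finite)
  then have "regular_rep c f = (\<Sum>y\<in>?F. scaleC_op (f y) (pi_op c y))"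
    "regular_rep c g = (\<Sum>y\<in>?F. scaleC_op (g y) (pi_op c y))"
    "regular_rep c (\<lambda>y. f y + g y) = (\<Sum>y\<in>?F. scaleC_op (f y + g y) (pi_op c y))"
    by (auto intro!: regular_rep_superset)
  then show ?thesis by (simp add: scaleC_op_add_left sum.distrib)
qed

lemma regular_rep_scaleC:
  assumes "f \<in> Cc"
  shows "regular_rep c (\<lambda>y. z * f y) = scaleC_op z (regular_rep c f)"
proof -
  have "regular_rep c (\<lambda>y. z * f y) = (\<Sum>y | f y \<noteq> 0. scaleC_op (z * f y) (pi_op c y))"
    using assms by (intro regular_rep_superset) (auto simp: Cc_def)
  then show ?thesis by (simp add: regular_rep_def scaleC_op_sum_right)
qed

lemma regular_rep_diff:
  assumes "f \<in> Cc" "g \<in> Cc"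
  shows "regular_rep c (\<lambda>y. f y - g y) = regular_rep c f - regular_rep c g"
  using regular_rep_add[OF assms(1) Cc_cmult[OF assms(2), of "\<lambda>_. - 1"], of c]
    regular_rep_scaleC[OF assms(2), of c "- 1"]
  by (simp flip: uminus_eq_scaleC_op)

lemma pi_op_in_twisted_algebra: "scaleC_op z (pi_op c y) \<in> twisted_algebra c"
proof -
  have "regular_rep c (\<lambda>x. if x = y then z else 0) = (\<Sum>x\<in>{y}. scaleC_op (if x = y then z else 0) (pi_op c x))"
    by (rule regular_rep_superset) (auto split: if_splits)
  then show ?thesis
    unfolding twisted_algebra_def
    by (intro image_eqI[of _ _ "\<lambda>x. if x = y then z else 0"])
       (auto simp: Cc_def intro: finite_subset[of _ "{y}"])
qed

lemma zero_in_twisted_algebra: "0 \<in> twisted_algebra c"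
  using pi_op_in_twisted_algebra[of 0 c] by simp

lemma twisted_algebra_add: "S \<in> twisted_algebra c \<Longrightarrow> T \<in> twisted_algebra c \<Longrightarrow> S + T \<in> twisted_algebra c"
  unfolding twisted_algebra_def by (auto simp: regular_rep_add[symmetric] intro!: imageI Cc_add)

lemma twisted_algebra_induct [consumes 1, case_names zero pi add]:
  assumes T: "T \<in> twisted_algebra c" and "P 0" "\<And>z y. P (scaleC_op z (pi_op c y))"
    and "\<And>S T. P S \<Longrightarrow> P T \<Longrightarrow> P (S + T)"
  shows "P T"
proof -
  obtain f where f: "f \<in> Cc" "T = regular_rep c f"
    using T by (auto simp: twisted_algebra_def)
  have "P (\<Sum>y\<in>F. scaleC_op (f y) (pi_op c y))" for F
    by (induction F rule: infinite_finite_induct) (use assms in auto)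
  then show ?thesis by (simp add: f regular_rep_def)
qed

lemma unital_star_algebra_twisted_algebra:
  fixes c :: "'g::group_add \<Rightarrow> 'g \<Rightarrow> complex"
  assumes c: "cocycle c"
  shows "unital_star_algebra (twisted_algebra c)"
proof -
  have adj: "\<exists>S\<in>twisted_algebra c. is_adjoint S T" if "T \<in> twisted_algebra c" for T
    using that
  proof (induction T rule: twisted_algebra_induct)
    case zero
    have "is_adjoint (0 :: 'g op) 0"
      using is_adjoint_scaleC[OF is_adjoint_id, of 0] by simp
    then show ?case using zero_in_twisted_algebra by blast
  next
    case (pi z y)
    have "is_adjoint (scaleC_op (cnj z * cnj (c y (- y))) (pi_op c (- y))) (scaleC_op z (pi_op c y))"
      using is_adjoint_scaleC[OF is_adjoint_sym[OF is_adjoint_pi_op[OF c, of y]], of "cnj z"] by simp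
    then show ?case using pi_op_in_twisted_algebra by blast
  next
    case (add S T)
    then show ?case by (meson is_adjoint_add twisted_algebra_add)
  qed
  have comp: "S o\<^sub>L T \<in> twisted_algebra c" if S: "S \<in> twisted_algebra c" and T: "T \<in> twisted_algebra c" for S T
    using S
  proof (induction S rule: twisted_algebra_induct)
    case zero
    have "0 o\<^sub>L T = 0" by (rule blinfun_eqI) simp
    then show ?case by (simp add: zero_in_twisted_algebra)
  next
    case (pi z y)
    from T show ?case
    proof (induction T rule: twisted_algebra_induct)
      case zero
      have "scaleC_op z (pi_op c y) o\<^sub>L 0 = 0" by (rule blinfun_eqI) (simp add: blinfun.bilinear_simps)
      then show ?case by (simp add: zero_in_twisted_algebra)
    next
      case (pi w x)
      have "scaleC_op z (pi_op c y) o\<^sub>L scaleC_op w (pi_op c x) = scaleC_op (z * w) (pi_op c y o\<^sub>L pi_op c x)"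
        by (rule blinfun_eqI, rule ell2_eqI)
           (simp add: scaleC.rep_eq Rep_pi_op[OF c])
      then show ?case by (simp add: pi_op_compose[OF c] pi_op_in_twisted_algebra)
    next
      case (add S T)
      have "scaleC_op z (pi_op c y) o\<^sub>L (S + T) = (scaleC_op z (pi_op c y) o\<^sub>L S) + (scaleC_op z (pi_op c y) o\<^sub>L T)"
        by (rule bounded_bilinear.add_right[OF bounded_bilinear_blinfun_compose])
      then show ?case using add by (simp add: twisted_algebra_add)
    qed
  next
    case (add S S')
    have "(S + S') o\<^sub>L T = (S o\<^sub>L T) + (S' o\<^sub>L T)"
      by (rule bounded_bilinear.add_left[OF bounded_bilinear_blinfun_compose])
    then show ?case using add by (simp add: twisted_algebra_add)
  qed
  have scale: "scaleC_op z T \<in> twisted_algebra c" if "T \<in> twisted_algebra c" for z T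
    using that
    by (induction T rule: twisted_algebra_induct)
       (auto simp: zero_in_twisted_algebra pi_op_in_twisted_algebra scaleC_op_add_right
          intro: twisted_algebra_add)
  have "id_blinfun \<in> twisted_algebra c"
    using pi_op_in_twisted_algebra[of 1 c 0] by (simp add: pi_op_0[OF c])
  with adj comp scale show ?thesis
    unfolding unital_star_algebra_def by (blast intro: twisted_algebra_add)
qed

text \<open>
  The operator maps the unit vector at \<open>0\<close> to its coefficient function.
\<close>

lemma cmod_coeff_le_norm_regular_rep:
  fixes c :: "'g::group_add \<Rightarrow> 'g \<Rightarrow> complex"
  assumes c: "cocycle c" and f: "f \<in> Cc"
  shows "cmod (f x) \<le> norm (regular_rep c f)"
proof -
  define \<delta> :: "'g ell2" where "\<delta> = Abs_ell2 (\<lambda>x. if x = 0 then 1 else 0)"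
  have "(\<lambda>x::'g. (cmod (if x = 0 then 1 else 0))\<^sup>2) summable_on UNIV"
    by (rule finite_nonzero_values_imp_summable_on) (auto intro: finite_subset[of _ "{0}"])
  then have \<delta>: "Rep_ell2 \<delta> = (\<lambda>x. if x = 0 then 1 else 0)"
    unfolding \<delta>_def by (intro Abs_ell2_inverse) simp
  have "(norm \<delta>)\<^sup>2 = (\<Sum>\<^sub>\<infinity>x\<in>{0::'g}. 1)"
    unfolding power2_norm_ell2 by (rule infsum_cong_neutral) (auto simp: \<delta>)
  then have n: "norm \<delta> = 1" using norm_ge_zero[of \<delta>] by (auto simp: power2_eq_1_iff)
  have "Rep_ell2 (regular_rep c f \<delta>) x = (\<Sum>y | f y \<noteq> 0. if y = x then f x else 0)"
    unfolding Rep_regular_rep[OF c] \<delta>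
    by (rule sum.cong) (use c in \<open>auto simp: cocycle_def translate_eq_0\<close>)
  then have "f x = Rep_ell2 (regular_rep c f \<delta>) x" using f by (simp add: Cc_def)
  then have "cmod (f x) \<le> norm (regular_rep c f \<delta>)" by (simp add: cmod_Rep_ell2_le)
  also have "\<dots> \<le> norm (regular_rep c f)"
    using norm_blinfun[of "regular_rep c f" \<delta>] n by simp
  finally show ?thesis .
qed

section \<open>Multipliers with respect to a grading\<close>

definition homogeneous :: "('g \<Rightarrow> int) \<Rightarrow> int \<Rightarrow> ('g \<Rightarrow> complex) \<Rightarrow> 'g \<Rightarrow> complex" where
  "homogeneous h k f = (\<lambda>y. if h y = k then f y else 0)"

lemma regular_rep_homogeneous_sum:
  assumes f: "f \<in> Cc" and K: "finite K" "\<And>y. f y \<noteq> 0 \<Longrightarrow> h y \<in> K"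
  shows "regular_rep c (\<lambda>y. g (h y) * f y) = (\<Sum>k\<in>K. scaleC_op (g k) (regular_rep c (homogeneous h k f)))"
proof -
  let ?F = "{y. f y \<noteq> 0}"
  have F: "finite ?F" using f by (rule Cc_finite)
  have 1: "regular_rep c (homogeneous h k f) = (\<Sum>y\<in>?F. scaleC_op (homogeneous h k f y) (pi_op c y))" for k
    using F by (intro regular_rep_superset) (auto simp: homogeneous_def split: if_splits)
  have "(\<Sum>k\<in>K. scaleC_op (g k) (regular_rep c (homogeneous h k f)))
      = (\<Sum>y\<in>?F. \<Sum>k\<in>K. scaleC_op (g k * homogeneous h k f y) (pi_op c y))"
    unfolding 1 scaleC_op_sum_right scaleC_op_scaleC_op by (rule sum.swap)
  also have "\<dots> = (\<Sum>y\<in>?F. scaleC_op (g (h y) * f y) (pi_op c y))"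
  proof (rule sum.cong)
    fix y assume y: "y \<in> ?F"
    have "(\<Sum>k\<in>K. scaleC_op (g k * homogeneous h k f y) (pi_op c y))
        = (\<Sum>k\<in>K. if h y = k then scaleC_op (g k * f y) (pi_op c y) else 0)"
      by (rule sum.cong) (auto simp: homogeneous_def)
    then show "(\<Sum>k\<in>K. scaleC_op (g k * homogeneous h k f y) (pi_op c y)) = scaleC_op (g (h y) * f y) (pi_op c y)"
      using K y by simp
  qed simp
  also have "\<dots> = regular_rep c (\<lambda>y. g (h y) * f y)"
    using F by (intro regular_rep_superset[symmetric]) auto
  finally show ?thesis by simp
qed

text \<open>
  The component of degree \<open>k\<close> shifts the grading of \<open>\<ell>\<^sup>2\<close> by \<open>k\<close>.
\<close>

lemma Rep_homogeneous_eq_0: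
  fixes c :: "'g::group_add \<Rightarrow> 'g \<Rightarrow> complex"
  assumes c: "cocycle c" and h: "\<And>x y. h (x + y) = h x + h y"
    and \<xi>: "\<And>x. h x \<noteq> m \<Longrightarrow> Rep_ell2 \<xi> x = 0" and x: "h x \<noteq> k + m"
  shows "Rep_ell2 (regular_rep c (homogeneous h k f) \<xi>) x = 0"
proof -
  have "h (- y + x) \<noteq> m" if "h y = k" for y
    using h[of y "- y + x"] x that by (auto simp flip: add.assoc)
  then show ?thesis
    unfolding Rep_regular_rep[OF c] using \<xi> by (intro sum.neutral) (auto simp: homogeneous_def)
qed

text \<open>
  Both the operator and the vector are split according to the grading. On a vector of degree \<open>m\<close> the
  pieces of the operator have orthogonal images, and for a fixed piece the images of vectors of
  different degree are orthogonal; so Pythagoras applies in both directions and the two summations can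
  be interchanged.
\<close>

lemma sum_norm_homogeneous_le:
  fixes c :: "'g::group_add \<Rightarrow> 'g \<Rightarrow> complex"
  assumes c: "cocycle c" and h: "\<And>x y. h (x + y) = h x + h y"
    and f: "f \<in> Cc" and \<xi>: "\<xi> \<in> finsupp" and K: "finite K" "\<And>y. f y \<noteq> 0 \<Longrightarrow> h y \<in> K"
  shows "(\<Sum>k\<in>K. (norm (regular_rep c (homogeneous h k f) \<xi>))\<^sup>2) \<le> (norm (regular_rep c f))\<^sup>2 * (norm \<xi>)\<^sup>2"
proof -
  define M where "M = h ` {x. Rep_ell2 \<xi> x \<noteq> 0}"
  define \<zeta> where "\<zeta> m = restrict_ell2 {x. h x = m} \<xi>" for m
  have M: "finite M" using \<xi> by (simp add: M_def finsupp_def)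
  have \<zeta>0: "Rep_ell2 (\<zeta> m) x = 0" if "h x \<noteq> m" for m x
    using that by (simp add: \<zeta>_def restrict_ell2.rep_eq)
  have \<xi>_sum: "\<xi> = (\<Sum>m\<in>M. \<zeta> m)"
  proof (rule ell2_eqI)
    fix x
    have "(\<Sum>m\<in>M. Rep_ell2 (\<zeta> m) x) = (\<Sum>m\<in>M. if h x = m then Rep_ell2 \<xi> x else 0)"
      by (rule sum.cong) (auto simp: \<zeta>_def restrict_ell2.rep_eq)
    also have "\<dots> = Rep_ell2 \<xi> x" using M by (auto simp: M_def)
    finally show "Rep_ell2 \<xi> x = Rep_ell2 (\<Sum>m\<in>M. \<zeta> m) x" by (simp add: Rep_ell2_sum)
  qed
  let ?T = "\<lambda>k. regular_rep c (homogeneous h k f)"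
  have supp: "Rep_ell2 (?T k (\<zeta> m)) x = 0" if "h x \<noteq> k + m" for k m x
    by (rule Rep_homogeneous_eq_0[OF c h _ that]) (use \<zeta>0 in auto)
  have T_sum: "regular_rep c f = (\<Sum>k\<in>K. ?T k)"
    using regular_rep_homogeneous_sum[OF f K, where c = c and g = "\<lambda>_. 1"] by simp
  have "(\<Sum>k\<in>K. (norm (?T k \<xi>))\<^sup>2) = (\<Sum>k\<in>K. \<Sum>m\<in>M. (norm (?T k (\<zeta> m)))\<^sup>2)"
  proof (rule sum.cong[OF refl])
    fix k
    have "?T k \<xi> = (\<Sum>m\<in>M. ?T k (\<zeta> m))"
      by (subst \<xi>_sum) (simp add: blinfun.sum_right)
    moreover have "pairwise (\<lambda>m m'. orthogonal (?T k (\<zeta> m)) (?T k (\<zeta> m'))) M"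
      unfolding pairwise_def orthogonal_def
    proof (intro ballI impI inner_ell2_disjoint)
      fix m m' :: int and x assume "m \<noteq> m'"
      then show "Rep_ell2 (?T k (\<zeta> m)) x = 0 \<or> Rep_ell2 (?T k (\<zeta> m')) x = 0"
        using supp[of x k m] supp[of x k m'] by (cases "h x = k + m") auto
    qed
    ultimately show "(norm (?T k \<xi>))\<^sup>2 = (\<Sum>m\<in>M. (norm (?T k (\<zeta> m)))\<^sup>2)"
      by (simp add: norm_sum_Pythagorean[OF M])
  qed
  also have "\<dots> = (\<Sum>m\<in>M. \<Sum>k\<in>K. (norm (?T k (\<zeta> m)))\<^sup>2)" by (rule sum.swap)
  also have "\<dots> = (\<Sum>m\<in>M. (norm (regular_rep c f (\<zeta> m)))\<^sup>2)"
  proof (rule sum.cong[OF refl])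
    fix m
    have "regular_rep c f (\<zeta> m) = (\<Sum>k\<in>K. ?T k (\<zeta> m))"
      by (simp add: T_sum blinfun.sum_left)
    moreover have "pairwise (\<lambda>k k'. orthogonal (?T k (\<zeta> m)) (?T k' (\<zeta> m))) K"
      unfolding pairwise_def orthogonal_def
    proof (intro ballI impI inner_ell2_disjoint)
      fix k k' :: int and x assume "k \<noteq> k'"
      then show "Rep_ell2 (?T k (\<zeta> m)) x = 0 \<or> Rep_ell2 (?T k' (\<zeta> m)) x = 0"
        using supp[of x k m] supp[of x k' m] by (cases "h x = k + m") auto
    qed
    ultimately show "(\<Sum>k\<in>K. (norm (?T k (\<zeta> m)))\<^sup>2) = (norm (regular_rep c f (\<zeta> m)))\<^sup>2"
      by (simp add: norm_sum_Pythagorean[OF K(1)])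
  qed
  also have "\<dots> \<le> (\<Sum>m\<in>M. (norm (regular_rep c f))\<^sup>2 * (norm (\<zeta> m))\<^sup>2)"
    unfolding power_mult_distrib[symmetric]
    by (intro sum_mono power_mono norm_blinfun) auto
  also have "\<dots> = (norm (regular_rep c f))\<^sup>2 * (\<Sum>m\<in>M. (norm (\<zeta> m))\<^sup>2)"
    by (rule sum_distrib_left[symmetric])
  also have "(\<Sum>m\<in>M. (norm (\<zeta> m))\<^sup>2) = (norm (\<Sum>m\<in>M. \<zeta> m))\<^sup>2"
  proof (rule norm_sum_Pythagorean[OF M, symmetric])
    show "pairwise (\<lambda>m m'. orthogonal (\<zeta> m) (\<zeta> m')) M"
      unfolding pairwise_def orthogonal_def
    proof (intro ballI impI inner_ell2_disjoint)
      fix m m' :: int and x assume "m \<noteq> m'"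
      then show "Rep_ell2 (\<zeta> m) x = 0 \<or> Rep_ell2 (\<zeta> m') x = 0"
        using \<zeta>0[of x m] \<zeta>0[of x m'] by (cases "h x = m") auto
    qed
  qed
  finally show ?thesis by (simp flip: \<xi>_sum)
qed

text \<open>
  By the Cauchy-Schwarz inequality from the previous estimate. The \<open>\<ell>\<^sup>2\<close>-norm of \<open>g\<close> is a crude bound for
  the norm of a multiplier, but it tends to \<open>0\<close> for the tails of \<open>1/k\<close>.
\<close>

lemma norm_multiplier_le:
  fixes c :: "'g::group_add \<Rightarrow> 'g \<Rightarrow> complex" and g :: "int \<Rightarrow> real"
  assumes c: "cocycle c" and h: "\<And>x y. h (x + y) = h x + h y"
    and f: "f \<in> Cc" and K: "finite K" "\<And>y. f y \<noteq> 0 \<Longrightarrow> h y \<in> K"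
  shows "norm (regular_rep c (\<lambda>y. of_real (g (h y)) * f y)) \<le> sqrt (\<Sum>k\<in>K. (g k)\<^sup>2) * norm (regular_rep c f)"
proof (rule norm_op_le_finsupp)
  fix \<xi> :: "'g ell2" assume \<xi>: "\<xi> \<in> finsupp"
  let ?T = "\<lambda>k. regular_rep c (homogeneous h k f)"
  have "norm (regular_rep c (\<lambda>y. of_real (g (h y)) * f y) \<xi>) = norm (\<Sum>k\<in>K. scaleC (of_real (g k)) (?T k \<xi>))"
    using regular_rep_homogeneous_sum[OF f K, where c = c and g = "\<lambda>k. of_real (g k)"] by (simp add: blinfun.sum_left)
  also have "\<dots> \<le> (\<Sum>k\<in>K. \<bar>g k\<bar> * \<bar>norm (?T k \<xi>)\<bar>)"
    by (rule sum_norm_le) (simp add: norm_scaleC)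
  also have "\<dots> \<le> L2_set g K * L2_set (\<lambda>k. norm (?T k \<xi>)) K"
    by (rule L2_set_mult_ineq)
  also have "\<dots> \<le> sqrt (\<Sum>k\<in>K. (g k)\<^sup>2) * (norm (regular_rep c f) * norm \<xi>)"
    unfolding L2_set_def
  proof (rule mult_left_mono)
    show "sqrt (\<Sum>k\<in>K. (norm (?T k \<xi>))\<^sup>2) \<le> norm (regular_rep c f) * norm \<xi>"
      using sum_norm_homogeneous_le[OF c h f \<xi> K] by (intro real_le_lsqrt) (auto simp: power_mult_distrib sum_nonneg)
  qed (simp add: sum_nonneg)
  finally show "norm (regular_rep c (\<lambda>y. of_real (g (h y)) * f y) \<xi>)
      \<le> sqrt (\<Sum>k\<in>K. (g k)\<^sup>2) * norm (regular_rep c f) * norm \<xi>" by (simp add: mult.assoc)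
qed (simp add: sum_nonneg)

definition truncate :: "('g \<Rightarrow> int) \<Rightarrow> nat \<Rightarrow> ('g \<Rightarrow> complex) \<Rightarrow> 'g \<Rightarrow> complex" where
  "truncate h n f = (\<lambda>y. if \<bar>h y\<bar> \<le> int n then f y else 0)"

lemma truncate_Cc: "f \<in> Cc \<Longrightarrow> truncate h n f \<in> Cc"
  by (erule Cc_subset) (auto simp: truncate_def split: if_splits)

lemma norm_truncate_le:
  fixes c :: "'g::group_add \<Rightarrow> 'g \<Rightarrow> complex"
  assumes c: "cocycle c" and h: "\<And>x y. h (x + y) = h x + h y" and f: "f \<in> Cc"
  shows "norm (regular_rep c (truncate h n f)) \<le> sqrt (2 * real n + 1) * norm (regular_rep c f)"
proof -
  let ?K = "h ` {y. f y \<noteq> 0}"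
  define g where "g k = (if \<bar>k\<bar> \<le> int n then 1 else 0 :: real)" for k
  have K: "finite ?K" "\<And>y. f y \<noteq> 0 \<Longrightarrow> h y \<in> ?K" using f by (simp_all add: Cc_finite)
  have "(\<Sum>k\<in>?K. (g k)\<^sup>2) = (\<Sum>k\<in>?K \<inter> {- int n..int n}. 1)"
    by (rule sum.mono_neutral_cong_right) (use K in \<open>auto simp: g_def\<close>)
  also have "\<dots> \<le> real (card {- int n..int n})"
    using card_mono[of "{- int n..int n}" "?K \<inter> {- int n..int n}"]
    by (simp only: sum_constant) auto
  finally have *: "(\<Sum>k\<in>?K. (g k)\<^sup>2) \<le> 2 * real n + 1" by simp
  have "truncate h n f = (\<lambda>y. of_real (g (h y)) * f y)"
    by (auto simp: truncate_def g_def)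
  then have "norm (regular_rep c (truncate h n f)) \<le> sqrt (\<Sum>k\<in>?K. (g k)\<^sup>2) * norm (regular_rep c f)"
    using norm_multiplier_le[OF c h f K, where g = g] by simp
  also have "\<dots> \<le> sqrt (2 * real n + 1) * norm (regular_rep c f)"
    using * by (intro mult_right_mono) auto
  finally show ?thesis .
qed

text \<open>
  The comparison \<open>1 / (m + 1)\<^sup>2 \<le> 1/m - 1/(m + 1)\<close> telescopes.
\<close>

lemma sum_inverse_squares_le:
  assumes "finite A" "n > 0" "\<And>j. j \<in> A \<Longrightarrow> j > n"
  shows "(\<Sum>j\<in>A. 1 / (real j)\<^sup>2) \<le> 1 / real n"
proof -
  have "(\<Sum>j\<in>{n<..m}. 1 / (real j)\<^sup>2) \<le> 1 / real n - 1 / real m" if "m \<ge> n" for m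
    using that
  proof (induction m rule: dec_induct)
    case (step m)
    have "1 / (real (Suc m))\<^sup>2 \<le> 1 / real m - 1 / real (Suc m)"
    proof -
      have "real m > 0" using step assms(2) by simp
      then have "1 / (real (Suc m))\<^sup>2 \<le> 1 / (real m * real (Suc m))"
        by (intro divide_left_mono) (auto simp: power2_eq_square)
      also have "\<dots> = 1 / real m - 1 / real (Suc m)"
        using \<open>real m > 0\<close> by (simp add: field_simps)
      finally show ?thesis .
    qed
    moreover have "{n<..Suc m} = insert (Suc m) {n<..m}" using step by auto
    ultimately show ?case using step by simp
  qed simp
  from this[of "max n (Max (insert n A))"]
  have "(\<Sum>j\<in>{n<..max n (Max (insert n A))}. 1 / (real j)\<^sup>2) \<le> 1 / real n"
    by (smt (verit) divide_nonneg_nonneg max.cobounded1 of_nat_0_le_iff)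
  moreover have "(\<Sum>j\<in>A. 1 / (real j)\<^sup>2) \<le> (\<Sum>j\<in>{n<..max n (Max (insert n A))}. 1 / (real j)\<^sup>2)"
    by (rule sum_mono2) (use assms in \<open>auto simp: le_max_iff_disj\<close>)
  ultimately show ?thesis by linarith
qed

lemma sum_inverse_squares_int_le:
  assumes "finite K" "n > 0" "\<And>k. k \<in> K \<Longrightarrow> \<bar>k\<bar> > int n"
  shows "(\<Sum>k\<in>K. 1 / (real_of_int k)\<^sup>2) \<le> 2 / real n"
proof -
  have half: "(\<Sum>k\<in>P. 1 / (real_of_int k)\<^sup>2) \<le> 1 / real n"
    if "P \<subseteq> K" "inj_on (\<lambda>k. nat \<bar>k\<bar>) P" for P
  proof -
    have P: "finite P" using that assms(1) finite_subset by blast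
    have "(\<Sum>k\<in>P. 1 / (real_of_int k)\<^sup>2) = (\<Sum>j\<in>(\<lambda>k. nat \<bar>k\<bar>) ` P. 1 / (real j)\<^sup>2)"
      by (subst sum.reindex[OF that(2)]) simp
    also have "\<dots> \<le> 1 / real n"
    proof (rule sum_inverse_squares_le)
      fix j assume "j \<in> (\<lambda>k. nat \<bar>k\<bar>) ` P"
      then obtain k where "k \<in> P" "j = nat \<bar>k\<bar>" by blast
      then show "j > n" using assms(3)[of k] that(1) by auto
    qed (use P assms(2) in auto)
    finally show ?thesis .
  qed
  have "(\<Sum>k\<in>K. 1 / (real_of_int k)\<^sup>2)
      = (\<Sum>k\<in>{k\<in>K. k \<ge> 0}. 1 / (real_of_int k)\<^sup>2) + (\<Sum>k\<in>{k\<in>K. \<not> k \<ge> 0}. 1 / (real_of_int k)\<^sup>2)"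
    by (subst sum.union_disjoint[symmetric]) (use assms(1) in \<open>auto intro: sum.cong\<close>)
  moreover have "inj_on (\<lambda>k. nat \<bar>k\<bar>) {k\<in>K. k \<ge> 0}" "inj_on (\<lambda>k. nat \<bar>k\<bar>) {k\<in>K. \<not> k \<ge> 0}"
    by (auto simp: inj_on_def)
  ultimately show ?thesis
    using half[of "{k\<in>K. k \<ge> 0}"] half[of "{k\<in>K. \<not> k \<ge> 0}"] by auto
qed

text \<open>
  The tail of \<open>f\<close> arises from the derivation of \<open>f\<close> by the multiplier \<open>1/k\<close>, restricted to \<open>\<bar>k\<bar> > n\<close>.
\<close>

lemma norm_truncate_tail_le:
  fixes c :: "'g::group_add \<Rightarrow> 'g \<Rightarrow> complex"
  assumes c: "cocycle c" and h: "\<And>x y. h (x + y) = h x + h y" and f: "f \<in> Cc" and n: "n > 0"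
  shows "norm (regular_rep c f - regular_rep c (truncate h n f))
    \<le> sqrt (2 / real n) * norm (regular_rep c (\<lambda>y. of_int (h y) * f y))"
proof -
  let ?D = "\<lambda>y. of_int (h y) * f y"
  let ?K = "h ` {y. ?D y \<noteq> 0}"
  define g where "g k = (if \<bar>k\<bar> \<le> int n then 0 else 1 / real_of_int k)" for k
  have D: "?D \<in> Cc" using f by (rule Cc_cmult)
  have K: "finite ?K" "\<And>y. ?D y \<noteq> 0 \<Longrightarrow> h y \<in> ?K" using Cc_finite[OF D] by (simp, blast)
  have "(\<Sum>k\<in>?K. (g k)\<^sup>2) = (\<Sum>k\<in>{k\<in>?K. \<bar>k\<bar> > int n}. 1 / (real_of_int k)\<^sup>2)"
    by (rule sum.mono_neutral_cong_right) (use K in \<open>auto simp: g_def power_divide\<close>)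
  also have "\<dots> \<le> 2 / real n"
    by (rule sum_inverse_squares_int_le) (use K n in auto)
  finally have *: "(\<Sum>k\<in>?K. (g k)\<^sup>2) \<le> 2 / real n" .
  have "f y - truncate h n f y = of_real (g (h y)) * ?D y" for y
    using n by (auto simp: truncate_def g_def)
  then have "regular_rep c f - regular_rep c (truncate h n f) = regular_rep c (\<lambda>y. of_real (g (h y)) * ?D y)"
    using regular_rep_diff[OF f truncate_Cc[OF f, of h n], of c] by simp
  then have "norm (regular_rep c f - regular_rep c (truncate h n f)) \<le> sqrt (\<Sum>k\<in>?K. (g k)\<^sup>2) * norm (regular_rep c ?D)"
    using norm_multiplier_le[OF c h D K, where g = g] by simp
  also have "\<dots> \<le> sqrt (2 / real n) * norm (regular_rep c ?D)"
    using * by (intro mult_right_mono) auto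
  finally show ?thesis .
qed

section \<open>Truncation to boxes\<close>

definition truncate_box :: "'i set \<Rightarrow> ('i \<Rightarrow> 'g \<Rightarrow> int) \<Rightarrow> ('i \<Rightarrow> nat) \<Rightarrow> ('g \<Rightarrow> complex) \<Rightarrow> 'g \<Rightarrow> complex" where
  "truncate_box I h N f = (\<lambda>y. if \<forall>i\<in>I. \<bar>h i y\<bar> \<le> int (N i) then f y else 0)"

lemma truncate_box_Cc: "f \<in> Cc \<Longrightarrow> truncate_box I h N f \<in> Cc"
  by (erule Cc_subset) (auto simp: truncate_box_def split: if_splits)

lemma truncate_box_empty [simp]: "truncate_box {} h N f = f"
  by (simp add: truncate_box_def)

lemma truncate_box_insert:
  "truncate_box (insert j I) h N f = truncate (h j) (N j) (truncate_box I h N f)"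
  by (auto simp: truncate_box_def truncate_def)

lemma truncate_box_bounded:
  fixes c :: "'g::group_add \<Rightarrow> 'g \<Rightarrow> complex"
  assumes c: "cocycle c" and I: "finite I" and h: "\<And>i x y. h i (x + y) = h i x + h i y"
  shows "\<exists>C>0. \<forall>f\<in>Cc. norm (regular_rep c (truncate_box I h N f)) \<le> C * norm (regular_rep c f)"
  using I
proof (induction I rule: finite_induct)
  case empty
  then show ?case by (intro exI[of _ 1]) auto
next
  case (insert j I)
  then obtain C where C: "C > 0" "\<And>f. f \<in> Cc \<Longrightarrow> norm (regular_rep c (truncate_box I h N f)) \<le> C * norm (regular_rep c f)"
    by blast
  let ?s = "sqrt (2 * real (N j) + 1)"
  have "norm (regular_rep c (truncate_box (insert j I) h N f)) \<le> ?s * C * norm (regular_rep c f)"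
    if f: "f \<in> Cc" for f
  proof -
    have "norm (regular_rep c (truncate_box (insert j I) h N f)) \<le> ?s * norm (regular_rep c (truncate_box I h N f))"
      unfolding truncate_box_insert by (rule norm_truncate_le[OF c h truncate_box_Cc[OF f]])
    also have "\<dots> \<le> ?s * (C * norm (regular_rep c f))"
      by (intro mult_left_mono C(2) f) simp
    finally show ?thesis by (simp add: mult.assoc)
  qed
  moreover have "?s * C > 0" using C(1) by (simp add: add_nonneg_pos)
  ultimately show ?case by blast
qed

text \<open>
  Induction over the coordinates. Truncation in the earlier coordinates commutes with the derivation in
  the new one and is bounded, although with a norm that grows with the box; the cut-off in the new
  coordinate is therefore chosen after the earlier ones.
\<close>

lemma truncate_box_approx:
  fixes c :: "'g::group_add \<Rightarrow> 'g \<Rightarrow> complex"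
  assumes c: "cocycle c" and I: "finite I" and h: "\<And>i x y. h i (x + y) = h i x + h i y"
    and "\<epsilon> > 0"
  shows "\<exists>N. \<forall>f\<in>Cc. (\<forall>i\<in>I. norm (regular_rep c (\<lambda>y. of_int (h i y) * f y)) \<le> R) \<longrightarrow>
    norm (regular_rep c f - regular_rep c (truncate_box I h N f)) \<le> \<epsilon>"
  using I \<open>\<epsilon> > 0\<close>
proof (induction I arbitrary: \<epsilon> rule: finite_induct)
  case empty
  then show ?case by auto
next
  case (insert j I)
  obtain N where N: "\<And>f. f \<in> Cc \<Longrightarrow> \<forall>i\<in>I. norm (regular_rep c (\<lambda>y. of_int (h i y) * f y)) \<le> R \<Longrightarrow>
    norm (regular_rep c f - regular_rep c (truncate_box I h N f)) \<le> \<epsilon> / 2"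
    using insert.IH[of "\<epsilon> / 2"] insert.prems by fastforce
  obtain C where C: "C > 0" "\<And>f. f \<in> Cc \<Longrightarrow> norm (regular_rep c (truncate_box I h N f)) \<le> C * norm (regular_rep c f)"
    using truncate_box_bounded[OF c insert.hyps(1), of h N] h by blast
  have "(\<lambda>n. sqrt (2 / real n) * (C * \<bar>R\<bar>)) \<longlonglongrightarrow> sqrt 0 * (C * \<bar>R\<bar>)"
    by (intro tendsto_intros lim_const_over_n)
  then have "\<forall>\<^sub>F n in sequentially. sqrt (2 / real n) * (C * \<bar>R\<bar>) < \<epsilon> / 2"
    using insert.prems by (intro order_tendstoD) auto
  then obtain n where n: "n > 0" "sqrt (2 / real n) * (C * \<bar>R\<bar>) < \<epsilon> / 2"
    using eventually_happens'[OF sequentially_bot eventually_conj[OF eventually_gt_at_top[of 0]]] by blast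
  define N' where "N' = N(j := n)"
  have "norm (regular_rep c f - regular_rep c (truncate_box (insert j I) h N' f)) \<le> \<epsilon>"
    if f: "f \<in> Cc" and R: "\<forall>i\<in>insert j I. norm (regular_rep c (\<lambda>y. of_int (h i y) * f y)) \<le> R" for f
  proof -
    let ?g = "truncate_box I h N f"
    have eq: "truncate_box (insert j I) h N' f = truncate (h j) n ?g"
    proof -
      have "N' i = N i" if "i \<in> I" for i using that insert.hyps by (auto simp: N'_def)
      then have "truncate_box I h N' f = ?g" by (simp add: truncate_box_def cong: ball_cong)
      then show ?thesis by (simp add: truncate_box_insert N'_def)
    qed
    have "(\<lambda>y. of_int (h j y) * ?g y) = truncate_box I h N (\<lambda>y. of_int (h j y) * f y)"
      by (auto simp: truncate_box_def)
    then have "norm (regular_rep c (\<lambda>y. of_int (h j y) * ?g y)) \<le> C * norm (regular_rep c (\<lambda>y. of_int (h j y) * f y))"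
      using C(2)[OF Cc_cmult[OF f, of "\<lambda>y. of_int (h j y)"]] by simp
    also have "\<dots> \<le> C * \<bar>R\<bar>"
      using R C(1) by (intro mult_left_mono) auto
    finally have 1: "norm (regular_rep c (\<lambda>y. of_int (h j y) * ?g y)) \<le> C * \<bar>R\<bar>" .
    have "norm (regular_rep c ?g - regular_rep c (truncate (h j) n ?g))
        \<le> sqrt (2 / real n) * norm (regular_rep c (\<lambda>y. of_int (h j y) * ?g y))"
      by (rule norm_truncate_tail_le[OF c h truncate_box_Cc[OF f] n(1)])
    also have "\<dots> \<le> sqrt (2 / real n) * (C * \<bar>R\<bar>)"
      using 1 by (intro mult_left_mono) auto
    finally have 2: "norm (regular_rep c ?g - regular_rep c (truncate (h j) n ?g)) \<le> \<epsilon> / 2"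
      using n by linarith
    have 3: "norm (regular_rep c f - regular_rep c ?g) \<le> \<epsilon> / 2" using N[OF f] R by auto
    show ?thesis
      unfolding eq
      using norm_triangle_ineq[of "regular_rep c f - regular_rep c ?g" "regular_rep c ?g - regular_rep c (truncate (h j) n ?g)"] 2 3
      by simp
  qed
  then show ?case by blast
qed

section \<open>Averages over boxes and tubes\<close>

text \<open>
  An entry \<open>(y, m)\<close> averages over the progression \<open>0, y, \<dots>, (m - 1) y\<close>, so a list of entries averages over a
  parallelepiped. Entries along the axes give cubes, and a further long entry sweeps the cube along a
  tube. The recursive form reduces every estimate to one progression. An entry with \<open>m = 0\<close> makes the
  average \<open>0\<close>, which keeps the bound \<open>avg_abs_le\<close> unconditional.
\<close>

fun avg :: "((int ^ 'd) \<times> nat) list \<Rightarrow> (int ^ 'd \<Rightarrow> real) \<Rightarrow> int ^ 'd \<Rightarrow> real" where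
  "avg [] h x = h x"
| "avg ((y, m) # L) h x = (\<Sum>k<m. avg L h (x + int k *s y)) / real m"

lemma avg_translate: "avg L (\<lambda>p. h (p + z)) x = avg L h (x + z)"
  by (induction L arbitrary: x) (auto simp: add_ac)

lemma avg_add: "avg L (\<lambda>p. h p + h' p) x = avg L h x + avg L h' x"
  by (induction L arbitrary: x) (auto simp: sum.distrib add_divide_distrib)

lemma avg_cmult: "avg L (\<lambda>p. a * h p) x = a * avg L h x"
  by (induction L arbitrary: x) (auto simp: sum_distrib_left)

lemma avg_diff: "avg L (\<lambda>p. h p - h' p) x = avg L h x - avg L h' x"
  using avg_add[of L h "\<lambda>p. (- 1) * h' p" x] unfolding avg_cmult by simp

lemma avg_uminus: "avg L (\<lambda>p. - h p) x = - avg L h x"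
  using avg_cmult[of L "- 1" h x] by simp

lemma avg_zero: "avg L (\<lambda>p. 0) x = 0"
  using avg_cmult[of L 0 "\<lambda>_. 0" x] by simp

lemma avg_sum: "avg L (\<lambda>p. \<Sum>i\<in>I. h i p) x = (\<Sum>i\<in>I. avg L (h i) x)"
  by (induction I rule: infinite_finite_induct) (auto simp: avg_zero avg_add)

lemma avg_abs_le:
  assumes "\<And>p. \<bar>h p\<bar> \<le> B"
  shows "\<bar>avg L h x\<bar> \<le> B"
proof (induction L arbitrary: x)
  case (Cons a L)
  obtain y m where a: "a = (y, m)" by force
  show ?case
  proof (cases "m = 0")
    case True
    then show ?thesis using assms[of 0] by (simp add: a)
  next
    case False
    have "\<bar>\<Sum>k<m. avg L h (x + int k *s y)\<bar> \<le> (\<Sum>k<m. B)"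
      by (rule order_trans[OF sum_abs sum_mono]) (rule Cons.IH)
    then show ?thesis using False by (simp add: a field_simps)
  qed
qed (use assms in simp)

lemma int_Suc_smult: "int (Suc k) *s y = int k *s y + (y :: int ^ 'd)"
  by (simp add: vec_eq_iff algebra_simps)

text \<open>
  In the progression with step \<open>y\<close> the translation by \<open>y\<close> changes only the two end terms.
\<close>

lemma avg_almost_invariant:
  assumes "\<And>p. \<bar>h p\<bar> \<le> B" and "(y, m) \<in> set L" and "m > 0"
  shows "\<bar>avg L h (x + y) - avg L h x\<bar> \<le> 2 * B / real m"
  using assms(2)
proof (induction L arbitrary: x)
  case (Cons a L)
  obtain z l where a: "a = (z, l)" by force
  show ?case
  proof (cases "(z, l) = (y, m)")
    case True
    have "avg (a # L) h (x + y) - avg (a # L) h x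
        = (\<Sum>k<m. avg L h (x + int (Suc k) *s y) - avg L h (x + int k *s y)) / real m"
      using True unfolding int_Suc_smult by (simp add: a sum_subtractf diff_divide_distrib add_ac)
    also have "\<dots> = (avg L h (x + int m *s y) - avg L h x) / real m"
      by (subst sum_lessThan_telescope) simp
    finally show ?thesis
      using avg_abs_le[where h = h and L = L and x = "x + int m *s y", OF assms(1)]
        avg_abs_le[where h = h and L = L and x = x, OF assms(1)] \<open>m > 0\<close>
      by (simp add: abs_divide divide_right_mono)
  next
    case False
    then have "(y, m) \<in> set L" using Cons.prems a by auto
    note IH = Cons.IH[OF this]
    have B: "B \<ge> 0" using assms(1)[of 0] by linarith
    show ?thesis
    proof (cases "l = 0")
      case True
      then show ?thesis using B by (simp add: a)
    next
      case False
      have "avg (a # L) h (x + y) - avg (a # L) h x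
          = (\<Sum>k<l. avg L h (x + int k *s z + y) - avg L h (x + int k *s z)) / real l"
        by (simp add: a sum_subtractf diff_divide_distrib add_ac)
      moreover have "\<bar>\<Sum>k<l. avg L h (x + int k *s z + y) - avg L h (x + int k *s z)\<bar> \<le> (\<Sum>k<l. 2 * B / real m)"
        by (rule order_trans[OF sum_abs sum_mono]) (rule IH)
      then have "\<bar>\<Sum>k<l. avg L h (x + int k *s z + y) - avg L h (x + int k *s z)\<bar> / real l \<le> 2 * B / real m"
        using False by (simp add: pos_divide_le_eq mult.commute)
      ultimately show ?thesis by (simp only: abs_divide abs_of_nat)
    qed
  qed
qed simp

text \<open>
  The average only involves values of \<open>h\<close> at points whose offset from \<open>x\<close> has length at most the sum on the
  right-hand side.
\<close>

lemma avg_near: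
  assumes "\<And>p y. \<bar>h (p + y) - h p\<bar> \<le> len y" and "\<And>k y. len (int k *s y) \<le> real k * len y"
    and "\<And>y m. (y, m) \<in> set L \<Longrightarrow> m > 0" and "\<And>y. len y \<ge> 0"
  shows "\<bar>avg L h x - h x\<bar> \<le> (\<Sum>(y, m)\<leftarrow>L. real m * len y)"
  using assms(3)
proof (induction L arbitrary: x)
  case (Cons a L)
  obtain y m where a: "a = (y, m)" by force
  have m: "m > 0" using Cons.prems a by auto
  have IH: "\<bar>avg L h x - h x\<bar> \<le> (\<Sum>(y, m)\<leftarrow>L. real m * len y)" for x
    using Cons by auto
  have "\<bar>avg L h (x + int k *s y) - h x\<bar> \<le> real m * len y + (\<Sum>(y, m)\<leftarrow>L. real m * len y)" if "k < m" for k
  proof -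
    have "real k * len y \<le> real m * len y" using that assms(4) by (intro mult_right_mono) auto
    then show ?thesis
      using IH[of "x + int k *s y"] assms(1)[of x "int k *s y"] assms(2)[of k y] by linarith
  qed
  then have "(\<Sum>k<m. \<bar>avg L h (x + int k *s y) - h x\<bar>)
      \<le> (\<Sum>k<m. real m * len y + (\<Sum>(y, m)\<leftarrow>L. real m * len y))"
    by (intro sum_mono) simp
  then have "\<bar>\<Sum>k<m. avg L h (x + int k *s y) - h x\<bar> \<le> real m * (real m * len y + (\<Sum>(y, m)\<leftarrow>L. real m * len y))"
    by (intro order_trans[OF sum_abs]) simp
  moreover have "avg (a # L) h x - h x = (\<Sum>k<m. avg L h (x + int k *s y) - h x) / real m"
    using m by (simp add: a sum_subtractf diff_divide_distrib)
  ultimately show ?case using m by (simp add: a abs_divide field_simps)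
qed simp

text \<open>
  The axis vectors generate the lattice as a group.
\<close>

lemma int_vec_induct:
  fixes x :: "int ^ 'd"
  assumes zero: "P 0" and add: "\<And>z w. P z \<Longrightarrow> P w \<Longrightarrow> P (z + w)" and neg: "\<And>z. P z \<Longrightarrow> P (- z)"
    and ax: "\<And>i. P (axis i 1)"
  shows "P x"
proof -
  have nat: "P (int n *s y)" if "P y" for n y
    by (induction n) (use that zero add in \<open>auto simp: int_Suc_smult simp del: of_nat_Suc\<close>)
  have int: "P (k *s y)" if "P y" for k y
  proof (cases k rule: int_cases2)
    case (nonneg n)
    then show ?thesis using nat[OF that] by simp
  next
    case (nonpos n)
    then have "k *s y = - (int n *s y)" by (simp add: vec_eq_iff)
    then show ?thesis using neg[OF nat[OF that]] by simp
  qed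
  have "P (\<Sum>i\<in>I. (x $ i) *s axis i 1)" for I
    by (induction I rule: infinite_finite_induct) (use zero add int ax in auto)
  from this[of UNIV] show ?thesis by (simp add: basis_expansion)
qed

section \<open>Mean slopes of a length function\<close>

definition increment :: "(int ^ 'd \<Rightarrow> real) \<Rightarrow> int ^ 'd \<Rightarrow> int ^ 'd \<Rightarrow> real" where
  "increment len y p = len p - len (p - y)"

lemma of_int_vec_add: "of_int_vec (x + y) = of_int_vec x + of_int_vec y"
  by (simp add: of_int_vec_def vec_eq_iff)

lemma of_int_vec_uminus: "of_int_vec (- x) = - of_int_vec x"
  by (simp add: of_int_vec_def vec_eq_iff)

lemma of_int_vec_smult: "of_int_vec (k *s x) = of_int k *\<^sub>R of_int_vec x"
  by (simp add: of_int_vec_def vec_eq_iff)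

lemma of_int_vec_0 [simp]: "of_int_vec 0 = 0"
  by (simp add: of_int_vec_def vec_eq_iff)

lemma of_int_vec_axis: "of_int_vec (axis i 1) = axis i 1"
  by (simp add: of_int_vec_def vec_eq_iff axis_def)

lemma increment_abs_le: "length_function len \<Longrightarrow> \<bar>increment len y p\<bar> \<le> len y"
  using length_function_diff[of len p y] by (simp add: increment_def)

lemma length_function_smult:
  assumes "length_function len"
  shows "len (int k *s y) \<le> real k * len (y :: int ^ 'd)"
proof (induction k)
  case 0
  then show ?case using assms unfolding length_function_def by (metis eq_iff mult_zero_left of_nat_0 vector_smult_lzero)
next
  case (Suc k)
  have "len (int k *s y + y) \<le> len (int k *s y) + len y"
    using assms unfolding length_function_def by blast
  with Suc show ?case unfolding int_Suc_smult by (simp add: algebra_simps)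
qed

lemma avg_increment: "avg L (increment len y) x = avg L len x - avg L len (x - y)"
  using avg_diff[of L len "\<lambda>p. len (p + - y)" x] unfolding avg_translate
  by (simp add: increment_def[abs_def])

text \<open>
  Along the tube in direction \<open>u\<close> the increments telescope to the difference of averages of \<open>\<ell>\<close> over the two
  end cubes.
\<close>

lemma avg_increment_tube:
  assumes len: "length_function len" and m: "m > 0" and L: "\<And>y l. (y, l) \<in> set L \<Longrightarrow> l > 0"
  shows "avg ((u, m) # L) (increment len u) u
    \<ge> (len (int m *s u) - 2 * (\<Sum>(y, l)\<leftarrow>L. real l * len y)) / real m"
proof -
  let ?D = "\<Sum>(y, l)\<leftarrow>L. real l * len y"
  have near: "\<bar>avg L len x - len x\<bar> \<le> ?D" for x
  proof (rule avg_near[OF _ length_function_smult[OF len] L])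
    show "\<bar>len (p + y) - len p\<bar> \<le> len y" for p y
      using length_function_diff[OF len, of "p + y" y] by simp
    show "len y \<ge> 0" for y using len by (simp add: length_function_def)
  qed
  have "avg ((u, m) # L) (increment len u) u
      = (\<Sum>k<m. avg L len (int (Suc k) *s u) - avg L len (int k *s u)) / real m"
    unfolding int_Suc_smult by (simp add: avg_increment add.commute sum_subtractf diff_divide_distrib)
  also have "\<dots> = (avg L len (int m *s u) - avg L len 0) / real m"
    by (subst sum_lessThan_telescope) simp
  also have "\<dots> \<ge> (len (int m *s u) - 2 * ?D) / real m"
  proof (rule divide_right_mono)
    have "len 0 = 0" using len by (simp add: length_function_def)
    then show "len (int m *s u) - 2 * ?D \<le> avg L len (int m *s u) - avg L len 0"
      using near[of "int m *s u"] near[of 0] by linarith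
  qed simp
  finally show ?thesis .
qed

text \<open>
  In the \<open>n\<close>-th set the cube has side \<open>n + 1\<close> and the tube has \<open>(n + 1)\<^sup>2\<close> steps: both tend to infinity, which
  makes the averages asymptotically invariant, while the cube is negligible compared to the tube, which
  makes the slope in direction \<open>u\<close> large. It is enough to arrange that the slopes along the axes converge,
  which a subsequence achieves by compactness; asymptotic invariance then gives the same limits at all
  \<open>x\<close>, and additivity in \<open>y\<close> gives convergence for all \<open>y\<close>.
\<close>

lemma exists_mean_slope:
  fixes len :: "int ^ 'd \<Rightarrow> real" and u :: "int ^ 'd"
  assumes len: "length_function len" and \<kappa>: "\<And>x. \<kappa> * norm (of_int_vec x) \<le> len x"
  obtains s :: "real ^ 'd" and A :: "nat \<Rightarrow> ((int ^ 'd) \<times> nat) list"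
  where "\<And>x y. (\<lambda>n. avg (A n) (increment len y) x) \<longlonglongrightarrow> s \<bullet> of_int_vec y"
    and "\<kappa> * norm (of_int_vec u) \<le> s \<bullet> of_int_vec u"
    and "\<And>i. \<bar>s $ i\<bar> \<le> len (axis i 1)"
proof -
  obtain ix :: "'d list" where ix: "set ix = UNIV" using finite_list[OF finite_class.finite_UNIV] by blast
  define box where "box n = map (\<lambda>i. (axis i (1 :: int) :: int ^ 'd, Suc n)) ix" for n
  define L where "L n = (u, Suc n * Suc n) # box n" for n
  define a where "a n = (\<chi> i. avg (L n) (increment len (axis i 1)) 0)" for n
  have bnd: "\<bar>a n $ i\<bar> \<le> len (axis i 1)" for n i
    by (simp add: a_def avg_abs_le increment_abs_le[OF len])
  have "norm (a n) \<le> (\<Sum>i\<in>UNIV. len (axis i 1))" for n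
    by (rule order_trans[OF norm_le_l1_cart sum_mono[OF bnd]])
  then have "bounded (range a)" by (auto simp: bounded_iff)
  then obtain s r where r: "strict_mono r" and s: "(a \<circ> r) \<longlonglongrightarrow> s"
    using bounded_imp_convergent_subsequence by blast
  define A where "A = L \<circ> r"
  have r_inf: "(\<lambda>n. C / real (Suc (r n))) \<longlonglongrightarrow> 0" for C
    using LIMSEQ_subseq_LIMSEQ[OF LIMSEQ_Suc[OF lim_const_over_n[of C]] r] by (simp add: o_def)
  have inv: "(\<lambda>n. avg (A n) h (x + z) - avg (A n) h x) \<longlonglongrightarrow> 0"
    if h: "\<And>p. \<bar>h p\<bar> \<le> B" for h B x z
  proof -
    have "\<forall>x. (\<lambda>n. avg (A n) h (x + z) - avg (A n) h x) \<longlonglongrightarrow> 0"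
    proof (induction z rule: int_vec_induct)
      case (2 z w)
      have "(\<lambda>n. (avg (A n) h (x + z + w) - avg (A n) h (x + z)) + (avg (A n) h (x + z) - avg (A n) h x))
          \<longlonglongrightarrow> 0 + 0" for x
        using 2 by (intro tendsto_add) auto
      then show ?case by (simp add: add.assoc)
    next
      case (3 z)
      have "(\<lambda>n. - (avg (A n) h (x - z + z) - avg (A n) h (x - z))) \<longlonglongrightarrow> - 0" for x
        using 3 by (intro tendsto_minus) blast
      then show ?case by simp
    next
      case (4 i)
      have "\<bar>avg (A n) h (x + axis i 1) - avg (A n) h x\<bar> \<le> 2 * B / real (Suc (r n))" for n x
        by (rule avg_almost_invariant[OF h]) (use ix in \<open>auto simp: A_def L_def box_def\<close>)
      then have "\<forall>n. norm (avg (A n) h (x + axis i 1) - avg (A n) h x) \<le> 2 * B / real (Suc (r n))" for x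
        by (simp only: real_norm_def) blast
      from Lim_null_comparison[OF always_eventually[OF this] r_inf]
      show ?case by blast
    qed simp
    then show ?thesis by blast
  qed
  have lim: "\<forall>x. (\<lambda>n. avg (A n) (increment len y) x) \<longlonglongrightarrow> s \<bullet> of_int_vec y" for y
  proof (induction y rule: int_vec_induct)
    case 1
    have "increment len 0 = (\<lambda>_. 0)" by (auto simp: increment_def)
    then show ?case by (simp add: avg_zero)
  next
    case (2 z w)
    have eq: "increment len (z + w) = (\<lambda>p. increment len z p + increment len w (p + - z))"
      by (auto simp: increment_def algebra_simps)
    have "(\<lambda>n. avg (A n) (increment len z) x + avg (A n) (increment len w) (x + - z))
        \<longlonglongrightarrow> s \<bullet> of_int_vec z + s \<bullet> of_int_vec w" for x
      using 2 by (intro tendsto_add) auto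
    then show ?case unfolding eq avg_add avg_translate by (simp add: of_int_vec_add inner_add_right)
  next
    case (3 z)
    have eq: "increment len (- z) = (\<lambda>p. - increment len z (p + z))"
      by (auto simp: increment_def algebra_simps)
    have "(\<lambda>n. - avg (A n) (increment len z) (x + z)) \<longlonglongrightarrow> - (s \<bullet> of_int_vec z)" for x
      using 3 by (intro tendsto_minus) auto
    then show ?case unfolding eq avg_uminus avg_translate by (simp add: of_int_vec_uminus)
  next
    case (4 i)
    have "(\<lambda>n. (a \<circ> r) n $ i) \<longlonglongrightarrow> s $ i" using s by (rule tendsto_vec_nth)
    then have "(\<lambda>n. avg (A n) (increment len (axis i 1)) 0) \<longlonglongrightarrow> s $ i"
      by (simp add: a_def A_def o_def)
    from tendsto_add[OF inv[where h = "increment len (axis i 1)", OF increment_abs_le[OF len], of 0] this]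
    show ?case by (simp add: of_int_vec_axis inner_axis)
  qed
  have low: "\<kappa> * norm (of_int_vec u) - 2 * (\<Sum>i\<leftarrow>ix. len (axis i 1)) / real (Suc (r n))
      \<le> avg (A n) (increment len u) u" for n
  proof -
    let ?k = "Suc (r n)"
    have D: "(\<Sum>(y, l)\<leftarrow>box (r n). real l * len y) = real ?k * (\<Sum>i\<leftarrow>ix. len (axis i 1))"
      by (simp add: box_def o_def sum_list_const_mult del: of_nat_Suc)
    have "\<kappa> * norm (of_int_vec (int (?k * ?k) *s u)) \<le> len (int (?k * ?k) *s u)"
      by (rule \<kappa>)
    then have "real (?k * ?k) * (\<kappa> * norm (of_int_vec u)) \<le> len (int (?k * ?k) *s u)"
      by (simp add: of_int_vec_smult mult_ac del: of_nat_Suc of_nat_mult)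
    then have "(real (?k * ?k) * (\<kappa> * norm (of_int_vec u)) - 2 * (real ?k * (\<Sum>i\<leftarrow>ix. len (axis i 1)))) / real (?k * ?k)
        \<le> (len (int (?k * ?k) *s u) - 2 * (\<Sum>(y, l)\<leftarrow>box (r n). real l * len y)) / real (?k * ?k)"
      unfolding D by (intro divide_right_mono) auto
    also have "\<dots> \<le> avg (A n) (increment len u) u"
      unfolding A_def L_def o_def by (rule avg_increment_tube[OF len]) (auto simp: box_def)
    finally have "(real (?k * ?k) * (\<kappa> * norm (of_int_vec u)) - 2 * (real ?k * (\<Sum>i\<leftarrow>ix. len (axis i 1)))) / real (?k * ?k)
        \<le> avg (A n) (increment len u) u" .
    moreover have "(real (k * k) * b - 2 * (real k * d)) / real (k * k) = b - 2 * d / real k" if "k > 0" for k :: nat and b d :: real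
      using that by (simp add: field_simps)
    ultimately show ?thesis by (simp only: zero_less_Suc)
  qed
  have "\<kappa> * norm (of_int_vec u) - 0 \<le> s \<bullet> of_int_vec u"
  proof (rule LIMSEQ_le[OF tendsto_diff[OF tendsto_const r_inf]])
    show "(\<lambda>n. avg (A n) (increment len u) u) \<longlonglongrightarrow> s \<bullet> of_int_vec u" using lim by blast
  qed (use low in blast)
  moreover have "\<bar>s $ i\<bar> \<le> len (axis i 1)" for i
  proof (rule Lim_bounded)
    show "(\<lambda>n. \<bar>(a \<circ> r) n $ i\<bar>) \<longlonglongrightarrow> \<bar>s $ i\<bar>"
      by (intro tendsto_rabs tendsto_vec_nth s)
  qed (use bnd in auto)
  ultimately show ?thesis using lim that[of A s] by auto
qed

section \<open>The commutator dominates the derivation along a mean slope\<close>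

text \<open>
  In an abelian group the flipped cocycle defines a second family of shifts, which play the role of the
  right translations.
\<close>

lemma cocycle_flip:
  fixes c :: "'g::ab_group_add \<Rightarrow> 'g \<Rightarrow> complex"
  assumes "cocycle c"
  shows "cocycle (\<lambda>x y. c y x)"
proof -
  have "c x y * c (x + y) z = c y z * c x (y + z)" for x y z
    using assms unfolding cocycle_def by blast
  then have "c y x * c z (x + y) = c z y * c (y + z) x" for x y z
    by (metis add.commute)
  then show ?thesis using assms unfolding cocycle_def by blast
qed

lemma pi_op_flip_commute:
  fixes c :: "'g::ab_group_add \<Rightarrow> 'g \<Rightarrow> complex"
  assumes c: "cocycle c"
  shows "pi_op c y (pi_op (\<lambda>x y. c y x) p \<xi>) = pi_op (\<lambda>x y. c y x) p (pi_op c y \<xi>)"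
proof (rule ell2_eqI)
  fix x
  have "c y w * c (y + w) p = c w p * c y (w + p)" for w
    using c unfolding cocycle_def by blast
  from this[of "x - y - p"]
  have "c y (x - y - p) * c (x - p) p = c (x - y - p) p * c y (x - y)" by simp
  moreover have "- p + (- y + x) = x - y - p" "- y + (- p + x) = x - y - p" "- y + x = x - y" "- p + x = x - p"
    by (simp_all add: algebra_simps)
  moreover have "Rep_ell2 (pi_op c y (pi_op (\<lambda>x y. c y x) p \<xi>)) x
      = Rep_ell2 \<xi> (- p + (- y + x)) * (c (- p + (- y + x)) p * c y (- y + x))"
    by (simp only: Rep_pi_op[OF c] Rep_pi_op[OF cocycle_flip[OF c]] mult.assoc)
  moreover have "Rep_ell2 (pi_op (\<lambda>x y. c y x) p (pi_op c y \<xi>)) x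
      = Rep_ell2 \<xi> (- y + (- p + x)) * (c y (- y + (- p + x)) * c (- p + x) p)"
    by (simp only: Rep_pi_op[OF c] Rep_pi_op[OF cocycle_flip[OF c]] mult.assoc)
  ultimately show "Rep_ell2 (pi_op c y (pi_op (\<lambda>x y. c y x) p \<xi>)) x
      = Rep_ell2 (pi_op (\<lambda>x y. c y x) p (pi_op c y \<xi>)) x"
    by (simp only:)
qed

lemma finsupp_pi_op:
  assumes c: "cocycle c" and \<xi>: "\<xi> \<in> finsupp"
  shows "pi_op c y \<xi> \<in> finsupp"
proof -
  have "x \<in> (\<lambda>w. y + w) ` {x. Rep_ell2 \<xi> x \<noteq> 0}" if "Rep_ell2 (pi_op c y \<xi>) x \<noteq> 0" for x
    by (rule image_eqI[of _ _ "- y + x"]) (use that in \<open>auto simp: Rep_pi_op[OF c]\<close>)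
  then show ?thesis
    using \<xi> unfolding finsupp_def by (auto intro: finite_subset[of _ "(\<lambda>w. y + w) ` {x. Rep_ell2 \<xi> x \<noteq> 0}"])
qed

lemma finsupp_regular_rep:
  assumes c: "cocycle c" and f: "f \<in> Cc" and \<xi>: "\<xi> \<in> finsupp"
  shows "regular_rep c f \<xi> \<in> finsupp"
proof -
  have "{x. Rep_ell2 (regular_rep c f \<xi>) x \<noteq> 0}
      \<subseteq> (\<Union>y\<in>{y. f y \<noteq> 0}. {x. Rep_ell2 (pi_op c y \<xi>) x \<noteq> 0})"
    unfolding Rep_regular_rep[OF c] Rep_pi_op[OF c] by (fastforce elim: sum.not_neutral_contains_not_neutral)
  moreover have "finite \<dots>"
    using f finsupp_pi_op[OF c \<xi>] by (auto simp: Cc_def finsupp_def)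
  ultimately show ?thesis unfolding finsupp_def by (simp add: finite_subset)
qed

lemma finsupp_mult_dom: "\<xi> \<in> finsupp \<Longrightarrow> \<xi> \<in> mult_dom len"
  unfolding mult_dom_def finsupp_def
  by (auto intro!: finite_nonzero_values_imp_summable_on elim: rev_finite_subset)

lemma finsupp_scaleR: "\<xi> \<in> finsupp \<Longrightarrow> r *\<^sub>R \<xi> \<in> finsupp"
  unfolding finsupp_def by (auto simp: scaleR_ell2_def scaleC.rep_eq elim: rev_finite_subset)

lemma mult_op_scaleR:
  assumes "\<xi> \<in> finsupp"
  shows "mult_op len (r *\<^sub>R \<xi>) = r *\<^sub>R mult_op len \<xi>"
proof (rule ell2_eqI)
  fix x
  have "Rep_ell2 (mult_op len (r *\<^sub>R \<xi>)) x = of_real (len x) * Rep_ell2 (r *\<^sub>R \<xi>) x"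
    by (rule Rep_mult_op[OF finsupp_mult_dom[OF finsupp_scaleR[OF assms]]])
  then show "Rep_ell2 (mult_op len (r *\<^sub>R \<xi>)) x = Rep_ell2 (r *\<^sub>R mult_op len \<xi>) x"
    by (simp add: scaleR_ell2_def scaleC.rep_eq Rep_mult_op[OF finsupp_mult_dom[OF assms]])
qed

text \<open>
  The defining supremum over the unit ball, rescaled. The domain conditions hold on finitely supported
  vectors.
\<close>

lemma commutator_le:
  assumes c: "cocycle c" and len: "length_function len" and f: "f \<in> Cc" and \<xi>: "\<xi> \<in> finsupp"
  shows "norm (mult_op len (regular_rep c f \<xi>) - regular_rep c f (mult_op len \<xi>))
    \<le> commutator_norm len (regular_rep c f) * norm \<xi>"
proof (cases "\<xi> = 0")
  case True
  have "(0 :: 'a ell2) \<in> finsupp" by (simp add: finsupp_def zero_ell2.rep_eq)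
  from mult_op_scaleR[OF this, of len 0] show ?thesis by (simp add: True blinfun.zero_right)
next
  case False
  define a where "a = inverse (norm \<xi>)"
  have a: "a > 0" "a * norm \<xi> = 1" using False by (auto simp: a_def)
  let ?T = "regular_rep c f"
  have m: "a *\<^sub>R \<xi> \<in> finsupp" "?T \<xi> \<in> finsupp" "?T (a *\<^sub>R \<xi>) \<in> finsupp"
    using finsupp_scaleR[OF \<xi>] finsupp_regular_rep[OF c f] \<xi> by blast+
  have "norm (mult_op len (?T (a *\<^sub>R \<xi>)) - ?T (mult_op len (a *\<^sub>R \<xi>))) \<le> commutator_norm len ?T"
    unfolding commutator_norm_def
    by (rule cSUP_upper[OF _ bdd_above_commutator[OF c len]])
       (use m a in \<open>auto simp: finsupp_mult_dom\<close>)
  moreover have "mult_op len (?T (a *\<^sub>R \<xi>)) - ?T (mult_op len (a *\<^sub>R \<xi>))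
      = a *\<^sub>R (mult_op len (?T \<xi>) - ?T (mult_op len \<xi>))"
    by (simp add: blinfun.scaleR_right mult_op_scaleR \<xi> m scaleR_diff_right)
  ultimately have "a * norm (mult_op len (?T \<xi>) - ?T (mult_op len \<xi>)) * norm \<xi> \<le> commutator_norm len ?T * norm \<xi>"
    using a by (intro mult_right_mono) auto
  moreover have "a * n * norm \<xi> = n" for n using a by (simp add: mult.commute mult.left_commute)
  ultimately show ?thesis by simp
qed

lemma Rep_commutator:
  assumes c: "cocycle c" and f: "f \<in> Cc" and \<xi>: "\<xi> \<in> finsupp"
  shows "Rep_ell2 (mult_op len (regular_rep c f \<xi>) - regular_rep c f (mult_op len \<xi>)) x
    = (\<Sum>y | f y \<noteq> 0. of_real (len x - len (- y + x)) * (f y * Rep_ell2 (pi_op c y \<xi>) x))"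
proof -
  have "Rep_ell2 (mult_op len (regular_rep c f \<xi>)) x = of_real (len x) * Rep_ell2 (regular_rep c f \<xi>) x"
    by (rule Rep_mult_op[OF finsupp_mult_dom[OF finsupp_regular_rep[OF c f \<xi>]]])
  moreover have "Rep_ell2 (regular_rep c f (mult_op len \<xi>)) x
      = (\<Sum>y | f y \<noteq> 0. of_real (len (- y + x)) * (f y * Rep_ell2 (pi_op c y \<xi>) x))"
    unfolding Rep_regular_rep[OF c] Rep_pi_op[OF c] Rep_mult_op[OF finsupp_mult_dom[OF \<xi>]]
    by (simp add: mult_ac)
  ultimately show ?thesis
    unfolding Rep_ell2_minus
    by (simp add: Rep_regular_rep[OF c] Rep_pi_op[OF c] sum_distrib_left sum_subtractf algebra_simps)
qed

lemma Re_of_real_mult: "Re (of_real r * z) = Re z * r"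
  by simp

text \<open>
  The right translation by \<open>p\<close> is an isometry that commutes with \<open>\<pi>\<^sub>f\<close>, so translating both vectors shifts the
  argument of the increments by \<open>p\<close>. Pairing with a fixed vector turns the operator bound into a bound on a
  real linear functional of the increments, which is inherited by averages over \<open>p\<close>.
\<close>

lemma commutator_pairing:
  fixes c :: "int ^ 'd \<Rightarrow> int ^ 'd \<Rightarrow> complex"
  assumes c: "cocycle c" and len: "length_function len" and f: "f \<in> Cc"
    and \<eta>: "\<eta> \<in> finsupp" and \<zeta>: "finite E" "\<And>x. x \<notin> E \<Longrightarrow> Rep_ell2 \<zeta> x = 0"
  shows "\<bar>\<Sum>x\<in>E. \<Sum>y | f y \<noteq> 0. Re (f y * Rep_ell2 (pi_op c y \<eta>) x * cnj (Rep_ell2 \<zeta> x)) * increment len y (p + x)\<bar>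
    \<le> commutator_norm len (regular_rep c f) * norm \<eta> * norm \<zeta>"
proof -
  define c' where "c' = (\<lambda>x y. c y x)"
  have c': "cocycle c'" unfolding c'_def by (rule cocycle_flip[OF c])
  let ?T = "regular_rep c f" and ?R = "pi_op c' p"
  let ?C = "mult_op len (?T (?R \<eta>)) - ?T (mult_op len (?R \<eta>))"
  have R\<eta>: "?R \<eta> \<in> finsupp" by (rule finsupp_pi_op[OF c' \<eta>])
  have u: "c' p x * cnj (c' p x) = 1" for x
    using c' by (simp add: cocycle_def flip: complex_norm_square)
  have Rep: "Rep_ell2 (?R \<xi>) (p + x) = Rep_ell2 \<xi> x * c' p x" for \<xi> x
    by (simp add: Rep_pi_op[OF c'])
  have "Rep_ell2 ?C (p + x) * cnj (Rep_ell2 (?R \<zeta>) (p + x))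
      = (\<Sum>y | f y \<noteq> 0. of_real (increment len y (p + x)) * (f y * Rep_ell2 (pi_op c y \<eta>) x * cnj (Rep_ell2 \<zeta> x)))"
    (is "?l x = ?r x") for x
  proof -
    have "Rep_ell2 ?C (p + x) = (\<Sum>y | f y \<noteq> 0. of_real (increment len y (p + x)) * (f y * Rep_ell2 (pi_op c y \<eta>) x)) * c' p x"
      unfolding Rep_commutator[OF c f R\<eta>] sum_distrib_right
      by (rule sum.cong)
         (simp_all add: pi_op_flip_commute[OF c, folded c'_def] Rep increment_def mult_ac)
    then have "?l x = (\<Sum>y | f y \<noteq> 0. of_real (increment len y (p + x)) * (f y * Rep_ell2 (pi_op c y \<eta>) x))
        * cnj (Rep_ell2 \<zeta> x) * (c' p x * cnj (c' p x))"
      by (simp add: Rep mult_ac)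
    then show ?thesis unfolding u by (simp add: sum_distrib_left mult_ac)
  qed
  then have "Re (?l x) = (\<Sum>y | f y \<noteq> 0. Re (f y * Rep_ell2 (pi_op c y \<eta>) x * cnj (Rep_ell2 \<zeta> x)) * increment len y (p + x))" for x
    by (simp only: Re_sum Re_of_real_mult)
  moreover have "inner ?C (?R \<zeta>) = (\<Sum>x\<in>(+) p ` E. Re (Rep_ell2 ?C x * cnj (Rep_ell2 (?R \<zeta>) x)))"
  proof (rule inner_ell2_finite)
    fix x assume "x \<notin> (+) p ` E"
    then have "- p + x \<notin> E" by (metis add_minus_cancel image_eqI)
    then show "Rep_ell2 (?R \<zeta>) x = 0" using \<zeta> by (simp add: Rep_pi_op[OF c'])
  qed (use \<zeta> in simp)
  moreover have "\<dots> = (\<Sum>x\<in>E. Re (?l x))"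
    by (subst sum.reindex) auto
  ultimately have "(\<Sum>x\<in>E. \<Sum>y | f y \<noteq> 0. Re (f y * Rep_ell2 (pi_op c y \<eta>) x * cnj (Rep_ell2 \<zeta> x)) * increment len y (p + x))
      = inner ?C (?R \<zeta>)" by simp
  also have "\<bar>\<dots>\<bar> \<le> norm ?C * norm (?R \<zeta>)" by (rule Cauchy_Schwarz_ineq2)
  also have "\<dots> \<le> (commutator_norm len ?T * norm (?R \<eta>)) * norm (?R \<zeta>)"
    by (intro mult_right_mono commutator_le[OF c len f R\<eta>]) simp
  finally show ?thesis by (simp add: norm_pi_op[OF c'])
qed

text \<open>
  The bound of \<open>commutator_pairing\<close> is averaged over \<open>p\<close> and passes to the limit, where the increments have
  become the numbers \<open>s \<bullet> y\<close>. Pairing with the image \<open>\<zeta>\<close> of \<open>\<eta>\<close> under the derivation itself gives \<open>\<parallel>\<zeta>\<parallel>\<^sup>2\<close>.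
\<close>

lemma norm_derivation_le_commutator:
  fixes c :: "int ^ 'd \<Rightarrow> int ^ 'd \<Rightarrow> complex" and s :: "real ^ 'd"
  assumes c: "cocycle c" and len: "length_function len" and f: "f \<in> Cc"
    and A: "\<And>x y. (\<lambda>n. avg (A n) (increment len y) x) \<longlonglongrightarrow> s \<bullet> of_int_vec y"
    and L0: "commutator_norm len (regular_rep c f) \<ge> 0"
  shows "norm (regular_rep c (\<lambda>y. of_real (s \<bullet> of_int_vec y) * f y)) \<le> commutator_norm len (regular_rep c f)"
proof (rule norm_op_le_finsupp[OF _ L0])
  fix \<eta> :: "(int ^ 'd) ell2" assume \<eta>: "\<eta> \<in> finsupp"
  let ?g = "\<lambda>y. of_real (s \<bullet> of_int_vec y) * f y"
  define \<zeta> where "\<zeta> = regular_rep c ?g \<eta>"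
  let ?E = "{x. Rep_ell2 \<zeta> x \<noteq> 0}"
  let ?S = "{y. f y \<noteq> 0}"
  define w where "w x y = Re (f y * Rep_ell2 (pi_op c y \<eta>) x * cnj (Rep_ell2 \<zeta> x))" for x y
  let ?C = "commutator_norm len (regular_rep c f) * norm \<eta> * norm \<zeta>"
  have E: "finite ?E"
    using finsupp_regular_rep[OF c Cc_cmult[OF f] \<eta>] by (simp add: \<zeta>_def finsupp_def)
  have "\<bar>\<Sum>x\<in>?E. \<Sum>y\<in>?S. w x y * increment len y (p + x)\<bar> \<le> ?C" for p
    unfolding w_def by (rule commutator_pairing[OF c len f \<eta> E]) simp
  then have "\<bar>avg (A n) (\<lambda>p. \<Sum>x\<in>?E. \<Sum>y\<in>?S. w x y * increment len y (p + x)) 0\<bar> \<le> ?C" for n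
    by (rule avg_abs_le)
  then have "\<bar>\<Sum>x\<in>?E. \<Sum>y\<in>?S. w x y * avg (A n) (increment len y) x\<bar> \<le> ?C" for n
    by (simp add: avg_sum avg_cmult avg_translate)
  moreover have "(\<lambda>n. \<bar>\<Sum>x\<in>?E. \<Sum>y\<in>?S. w x y * avg (A n) (increment len y) x\<bar>)
      \<longlonglongrightarrow> \<bar>\<Sum>x\<in>?E. \<Sum>y\<in>?S. w x y * (s \<bullet> of_int_vec y)\<bar>"
    by (intro tendsto_intros A)
  ultimately have "\<bar>\<Sum>x\<in>?E. \<Sum>y\<in>?S. w x y * (s \<bullet> of_int_vec y)\<bar> \<le> ?C"
    by (intro Lim_bounded[where M = 0]) auto
  moreover have "(\<Sum>x\<in>?E. \<Sum>y\<in>?S. w x y * (s \<bullet> of_int_vec y)) = (norm \<zeta>)\<^sup>2"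
  proof -
    have "Rep_ell2 \<zeta> x = (\<Sum>y\<in>?S. ?g y * Rep_ell2 (pi_op c y \<eta>) x)" for x
    proof -
      have "regular_rep c ?g = (\<Sum>y\<in>?S. scaleC_op (?g y) (pi_op c y))"
        using f by (intro regular_rep_superset) (auto simp: Cc_def)
      then show ?thesis by (simp add: \<zeta>_def blinfun.sum_left Rep_ell2_sum scaleC.rep_eq)
    qed
    then have "Re (Rep_ell2 \<zeta> x * cnj (Rep_ell2 \<zeta> x)) = (\<Sum>y\<in>?S. w x y * (s \<bullet> of_int_vec y))" for x
    proof -
      assume *: "\<And>x. Rep_ell2 \<zeta> x = (\<Sum>y\<in>?S. ?g y * Rep_ell2 (pi_op c y \<eta>) x)"
      have "Rep_ell2 \<zeta> x * cnj (Rep_ell2 \<zeta> x)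
          = (\<Sum>y\<in>?S. of_real (s \<bullet> of_int_vec y) * (f y * Rep_ell2 (pi_op c y \<eta>) x * cnj (Rep_ell2 \<zeta> x)))"
        by (subst (1) *) (simp add: sum_distrib_left mult_ac)
      then show ?thesis by (simp only: Re_sum Re_of_real_mult w_def)
    qed
    then show ?thesis
      using inner_ell2_finite[OF E, of \<zeta> \<zeta>] by (simp add: power2_norm_eq_inner)
  qed
  ultimately have "norm \<zeta> * norm \<zeta> \<le> (commutator_norm len (regular_rep c f) * norm \<eta>) * norm \<zeta>"
    by (simp add: power2_eq_square)
  then show "norm (regular_rep c ?g \<eta>) \<le> commutator_norm len (regular_rep c f) * norm \<eta>"
    unfolding \<zeta>_def[symmetric]
    by (cases "norm \<zeta> = 0") (use L0 in \<open>auto dest: mult_right_le_imp_le\<close>)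
qed

section \<open>The commutator seminorm\<close>

lemma mult_dom_add:
  assumes "\<xi> \<in> mult_dom len" "\<eta> \<in> mult_dom len"
  shows "\<xi> + \<eta> \<in> mult_dom len"
  using ell2_summable_add[of "\<lambda>x. of_real (len x) * Rep_ell2 \<xi> x" "\<lambda>x. of_real (len x) * Rep_ell2 \<eta> x"] assms
  by (simp add: mult_dom_def plus_ell2.rep_eq distrib_left)

lemma mult_dom_scaleC:
  assumes "\<xi> \<in> mult_dom len"
  shows "scaleC z \<xi> \<in> mult_dom len"
  using ell2_summable_mult[of "\<lambda>x. of_real (len x) * Rep_ell2 \<xi> x" z] assms
  by (simp add: mult_dom_def scaleC.rep_eq mult_ac)

lemma zero_mult_dom: "0 \<in> mult_dom len"
  by (simp add: mult_dom_def zero_ell2.rep_eq)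

text \<open>
  The regular representation preserves the domain of \<open>M\<^sub>\<ell>\<close> because \<open>\<ell>(x) \<le> \<ell>(x - y) + \<ell>(y)\<close>. Without this the
  domain conditions in the supremum would depend on the operator and subadditivity of the seminorm
  would not be immediate.
\<close>

lemma mult_dom_pi_op:
  assumes c: "cocycle c" and len: "length_function len" and \<xi>: "\<xi> \<in> mult_dom len"
  shows "pi_op c y \<xi> \<in> mult_dom len"
proof -
  let ?a = "pi_op c y (mult_op len \<xi>)" and ?b = "scaleC (of_real (len y)) (pi_op c y \<xi>)"
  have "cmod (of_real (len x) * Rep_ell2 (pi_op c y \<xi>) x)
      \<le> cmod (of_real (cmod (Rep_ell2 ?a x)) + of_real (cmod (Rep_ell2 ?b x)))" for x
  proof -
    have nn: "len z \<ge> 0" for z using len by (simp add: length_function_def)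
    have u: "cmod (c y w) = 1" for w using c by (simp add: cocycle_def)
    have "cmod (of_real (len x) * Rep_ell2 (pi_op c y \<xi>) x) = len x * cmod (Rep_ell2 \<xi> (- y + x))"
      by (simp add: Rep_pi_op[OF c] norm_mult u nn)
    also have "\<dots> \<le> (len (- y + x) + len y) * cmod (Rep_ell2 \<xi> (- y + x))"
      using length_function_diff[OF len, of x y] by (intro mult_right_mono) auto
    also have "\<dots> = cmod (Rep_ell2 ?a x) + cmod (Rep_ell2 ?b x)"
      by (simp add: Rep_pi_op[OF c] scaleC.rep_eq Rep_mult_op[OF \<xi>] norm_mult u nn distrib_right)
    finally show ?thesis by (simp flip: of_real_add)
  qed
  moreover have "(\<lambda>x. (cmod (of_real (cmod (Rep_ell2 ?a x)) + of_real (cmod (Rep_ell2 ?b x)) :: complex))\<^sup>2) summable_on UNIV"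
    by (rule ell2_summable_add) (use summable_cmod_Rep_ell2 in auto)
  ultimately show ?thesis
    unfolding mult_dom_def by (auto intro: summable_on_comparison_test power_mono)
qed

lemma mult_dom_twisted_algebra:
  assumes c: "cocycle c" and len: "length_function len" and \<xi>: "\<xi> \<in> mult_dom len"
    and T: "T \<in> twisted_algebra c"
  shows "T \<xi> \<in> mult_dom len"
  using T
  by (induction T rule: twisted_algebra_induct)
     (simp_all add: zero_mult_dom mult_dom_scaleC mult_dom_pi_op[OF c len \<xi>] blinfun.add_left mult_dom_add)

lemma commutator_norm_upper:
  assumes c: "cocycle c" and len: "length_function len" and T: "T \<in> twisted_algebra c"
    and \<xi>: "\<xi> \<in> mult_dom len" "norm \<xi> \<le> 1"
  shows "norm (mult_op len (T \<xi>) - T (mult_op len \<xi>)) \<le> commutator_norm len T"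
proof -
  obtain f where f: "T = regular_rep c f" using T by (auto simp: twisted_algebra_def)
  show ?thesis
    using mult_dom_twisted_algebra[OF c len \<xi>(1) T] \<xi>
    unfolding commutator_norm_def f
    by (intro cSUP_upper[OF _ bdd_above_commutator[OF c len]]) auto
qed

lemma commutator_norm_least:
  fixes T :: "'a op"
  assumes "\<And>\<xi>. \<xi> \<in> mult_dom len \<Longrightarrow> norm \<xi> \<le> 1 \<Longrightarrow> norm (mult_op len (T \<xi>) - T (mult_op len \<xi>)) \<le> C"
  shows "commutator_norm len T \<le> C"
  unfolding commutator_norm_def
proof (rule cSUP_least)
  have "0 \<in> {\<xi>. \<xi> \<in> mult_dom len \<and> T \<xi> \<in> mult_dom len \<and> norm \<xi> \<le> 1}"
    by (simp add: zero_mult_dom blinfun.zero_right)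
  then show "{\<xi>. \<xi> \<in> mult_dom len \<and> T \<xi> \<in> mult_dom len \<and> norm \<xi> \<le> 1} \<noteq> {}" by blast
qed (use assms in auto)

lemma mult_op_add:
  assumes "\<xi> \<in> mult_dom len" "\<eta> \<in> mult_dom len"
  shows "mult_op len (\<xi> + \<eta>) = mult_op len \<xi> + mult_op len \<eta>"
  by (rule ell2_eqI)
     (simp add: Rep_mult_op[OF assms(1)] Rep_mult_op[OF assms(2)] Rep_mult_op[OF mult_dom_add[OF assms]]
       plus_ell2.rep_eq distrib_left)

lemma mult_op_scaleC:
  assumes "\<xi> \<in> mult_dom len"
  shows "mult_op len (scaleC z \<xi>) = scaleC z (mult_op len \<xi>)"
  by (rule ell2_eqI)
     (simp add: Rep_mult_op[OF assms(1)] Rep_mult_op[OF mult_dom_scaleC[OF assms]] scaleC.rep_eq)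

lemma scaleC_diff_right: "scaleC z (f - g) = scaleC z f - scaleC z g"
  by (rule ell2_eqI) (simp add: scaleC.rep_eq Rep_ell2_minus algebra_simps)

lemma commutator_norm_nonneg:
  assumes c: "cocycle c" and len: "length_function len" and T: "T \<in> twisted_algebra c"
  shows "commutator_norm len T \<ge> 0"
  by (rule order_trans[OF norm_ge_zero commutator_norm_upper[OF assms zero_mult_dom]]) simp

lemma commutator_norm_add:
  assumes c: "cocycle c" and len: "length_function len"
    and S: "S \<in> twisted_algebra c" and T: "T \<in> twisted_algebra c"
  shows "commutator_norm len (S + T) \<le> commutator_norm len S + commutator_norm len T"
proof (rule commutator_norm_least)
  fix \<xi> :: "'a ell2" assume \<xi>: "\<xi> \<in> mult_dom len" "norm \<xi> \<le> 1"
  have "mult_op len ((S + T) \<xi>) - (S + T) (mult_op len \<xi>)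
      = (mult_op len (S \<xi>) - S (mult_op len \<xi>)) + (mult_op len (T \<xi>) - T (mult_op len \<xi>))"
    using mult_dom_twisted_algebra[OF c len \<xi>(1)] S T by (simp add: blinfun.add_left mult_op_add)
  also have "norm \<dots> \<le> commutator_norm len S + commutator_norm len T"
    by (intro norm_triangle_mono commutator_norm_upper[OF c len] S T \<xi>)
  finally show "norm (mult_op len ((S + T) \<xi>) - (S + T) (mult_op len \<xi>))
      \<le> commutator_norm len S + commutator_norm len T" .
qed

lemma commutator_norm_scaleC_le:
  assumes c: "cocycle c" and len: "length_function len" and T: "T \<in> twisted_algebra c"
  shows "commutator_norm len (scaleC_op z T) \<le> cmod z * commutator_norm len T"
proof (rule commutator_norm_least)
  fix \<xi> :: "'a ell2" assume \<xi>: "\<xi> \<in> mult_dom len" "norm \<xi> \<le> 1"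
  have "mult_op len (scaleC_op z T \<xi>) - scaleC_op z T (mult_op len \<xi>)
      = scaleC z (mult_op len (T \<xi>) - T (mult_op len \<xi>))"
    using mult_dom_twisted_algebra[OF c len \<xi>(1) T] by (simp add: mult_op_scaleC scaleC_diff_right)
  then show "norm (mult_op len (scaleC_op z T \<xi>) - scaleC_op z T (mult_op len \<xi>)) \<le> cmod z * commutator_norm len T"
    using commutator_norm_upper[OF c len T \<xi>] by (simp add: norm_scaleC mult_left_mono)
qed

lemma commutator_norm_scaleC:
  assumes c: "cocycle c" and len: "length_function len" and T: "T \<in> twisted_algebra c"
  shows "commutator_norm len (scaleC_op z T) = cmod z * commutator_norm len T"
proof -
  note A = unital_star_algebra_twisted_algebra[OF c]
  have zT: "scaleC_op z T \<in> twisted_algebra c" by (rule unital_star_algebra_scaleC[OF A T])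
  have le: "commutator_norm len (scaleC_op z T) \<le> cmod z * commutator_norm len T"
    by (rule commutator_norm_scaleC_le[OF c len T])
  show ?thesis
  proof (cases "z = 0")
    case True
    then show ?thesis using le commutator_norm_nonneg[OF c len zT] by simp
  next
    case False
    then have "commutator_norm len T \<le> inverse (cmod z) * commutator_norm len (scaleC_op z T)"
      using commutator_norm_scaleC_le[OF c len zT, of "inverse z"] by (simp add: norm_inverse)
    then have "cmod z * commutator_norm len T \<le> cmod z * (inverse (cmod z) * commutator_norm len (scaleC_op z T))"
      by (rule mult_left_mono) simp
    then show ?thesis using le False by (simp add: mult.assoc[symmetric])
  qed
qed

lemma seminorm_on_commutator_norm:
  assumes "cocycle c" "length_function len"
  shows "seminorm_on (twisted_algebra c) (commutator_norm len)"
  unfolding seminorm_on_def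
  using commutator_norm_nonneg[OF assms] commutator_norm_add[OF assms] commutator_norm_scaleC[OF assms]
  by blast

lemma commutator_norm_id: "commutator_norm len id_blinfun = 0"
proof -
  have "commutator_norm len id_blinfun = (SUP \<xi>\<in>{\<xi>::'a ell2. \<xi> \<in> mult_dom len \<and> norm \<xi> \<le> 1}. 0)"
    unfolding commutator_norm_def by simp
  also have "\<dots> = 0"
    by (rule cSUP_const) (use zero_mult_dom in fastforce)
  finally show ?thesis .
qed

section \<open>All coordinate derivations are controlled\<close>

text \<open>
  The vectors \<open>s\<close> whose derivation is bounded by a multiple of the seminorm form a subspace, and it contains
  a slope \<open>s\<close> with \<open>s \<bullet> u \<ge> \<kappa> \<parallel>u\<parallel>\<close> for every lattice vector \<open>u\<close>, with \<open>\<parallel>s\<parallel>\<close> bounded independently of \<open>u\<close>. If \<open>v \<noteq> 0\<close>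
  were orthogonal to this subspace, let \<open>u\<close> be \<open>n v\<close> rounded down: \<open>s \<bullet> u\<close> only sees the rounding error and
  stays bounded, whereas \<open>\<kappa> \<parallel>u\<parallel>\<close> grows with \<open>n\<close>.
\<close>

lemma derivation_bounded:
  fixes c :: "int ^ 'd \<Rightarrow> int ^ 'd \<Rightarrow> complex" and s :: "real ^ 'd"
  assumes c: "cocycle c" and len: "length_function len"
    and \<kappa>: "\<kappa> > 0" "\<And>x. \<kappa> * norm (of_int_vec x) \<le> len x"
  shows "\<exists>C. \<forall>f\<in>Cc. norm (regular_rep c (\<lambda>y. of_real (s \<bullet> of_int_vec y) * f y))
    \<le> C * commutator_norm len (regular_rep c f)"
proof -
  let ?L = "\<lambda>f. commutator_norm len (regular_rep c f)"
  let ?\<delta> = "\<lambda>s f. regular_rep c (\<lambda>y. of_real (s \<bullet> of_int_vec y) * f y)"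
  define G where "G = {s. \<exists>C. \<forall>f\<in>Cc. norm (?\<delta> s f) \<le> C * ?L f}"
  have L0: "?L f \<ge> 0" if "f \<in> Cc" for f
    using commutator_norm_nonneg[OF c len, of "regular_rep c f"] that by (auto simp: twisted_algebra_def)
  have "subspace G"
  proof (rule subspaceI)
    have "regular_rep c (\<lambda>y. 0) = 0" by (simp add: regular_rep_def)
    then show "0 \<in> G" unfolding G_def by (auto intro!: exI[of _ 0])
  next
    fix s t assume "s \<in> G" "t \<in> G"
    then obtain C D where CD: "\<And>f. f \<in> Cc \<Longrightarrow> norm (?\<delta> s f) \<le> C * ?L f" "\<And>f. f \<in> Cc \<Longrightarrow> norm (?\<delta> t f) \<le> D * ?L f"
      unfolding G_def by blast
    have "norm (?\<delta> (s + t) f) \<le> (C + D) * ?L f" if f: "f \<in> Cc" for f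
    proof -
      have "?\<delta> (s + t) f = ?\<delta> s f + ?\<delta> t f"
        using regular_rep_add[OF Cc_cmult[OF f, of "\<lambda>y. of_real (s \<bullet> of_int_vec y)"]
            Cc_cmult[OF f, of "\<lambda>y. of_real (t \<bullet> of_int_vec y)"], of c]
        by (simp add: inner_add_left distrib_right)
      then show ?thesis
        using norm_triangle_ineq[of "?\<delta> s f" "?\<delta> t f"] CD[OF f] by (simp add: distrib_right)
    qed
    then show "s + t \<in> G" unfolding G_def by blast
  next
    fix r and s assume "s \<in> G"
    then obtain C where C: "\<And>f. f \<in> Cc \<Longrightarrow> norm (?\<delta> s f) \<le> C * ?L f"
      unfolding G_def by blast
    have "norm (?\<delta> (r *\<^sub>R s) f) \<le> (\<bar>r\<bar> * C) * ?L f" if f: "f \<in> Cc" for f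
    proof -
      have "?\<delta> (r *\<^sub>R s) f = scaleC_op (of_real r) (?\<delta> s f)"
        using regular_rep_scaleC[OF Cc_cmult[OF f, of "\<lambda>y. of_real (s \<bullet> of_int_vec y)"], of c "of_real r"]
        by (simp add: mult.assoc)
      then show ?thesis
        using C[OF f] by (simp add: norm_scaleC_op mult.assoc mult_left_mono)
    qed
    then show "r *\<^sub>R s \<in> G" unfolding G_def by blast
  qed
  have slope: "\<exists>s\<in>G. \<kappa> * norm (of_int_vec u) \<le> s \<bullet> of_int_vec u \<and> (\<forall>i. \<bar>s $ i\<bar> \<le> len (axis i 1))" for u
  proof -
    obtain A s where sA: "\<And>x y. (\<lambda>n. avg (A n) (increment len y) x) \<longlonglongrightarrow> s \<bullet> of_int_vec y"
      "\<kappa> * norm (of_int_vec u) \<le> s \<bullet> of_int_vec u" "\<And>i. \<bar>s $ i\<bar> \<le> len (axis i 1)"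
      by (rule exists_mean_slope[OF len \<kappa>(2), where u = u]) (rule that)
    have "norm (?\<delta> s f) \<le> 1 * ?L f" if "f \<in> Cc" for f
      using norm_derivation_le_commutator[OF c len that sA(1) L0[OF that]] by simp
    then have "s \<in> G" unfolding G_def by blast
    with sA show ?thesis by blast
  qed
  have "G = UNIV"
  proof (rule ccontr)
    assume "G \<noteq> UNIV"
    then have "dim G < DIM(real ^ 'd)"
      using \<open>subspace G\<close> by (metis dim_eq_full dim_subset_UNIV le_neq_implies_less span_eq_iff)
    then obtain v where v: "v \<noteq> 0" "\<And>s. s \<in> span G \<Longrightarrow> orthogonal v s"
      using orthogonal_to_subspace_exists by blast
    define S where "S = (\<Sum>i\<in>UNIV. len (axis i 1 :: int ^ 'd))"
    define d where "d = real CARD('d)"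
    have bound: "\<kappa> * (real n * norm v - d) \<le> S * d" for n
    proof -
      define u :: "int ^ 'd" where "u = (\<chi> i. \<lfloor>real n * v $ i\<rfloor>)"
      obtain s where s: "s \<in> G" "\<kappa> * norm (of_int_vec u) \<le> s \<bullet> of_int_vec u" "\<And>i. \<bar>s $ i\<bar> \<le> len (axis i 1)"
        using slope[of u] by blast
      define w where "w = of_int_vec u - real n *\<^sub>R v"
      have "norm w \<le> (\<Sum>i\<in>UNIV. \<bar>w $ i\<bar>)" by (rule norm_le_l1_cart)
      also have "\<dots> \<le> (\<Sum>i\<in>(UNIV :: 'd set). 1)"
        by (rule sum_mono) (simp add: w_def u_def of_int_vec_def, linarith)
      finally have w: "norm w \<le> d" by (simp add: d_def)
      have "norm s \<le> S"
        unfolding S_def by (rule order_trans[OF norm_le_l1_cart sum_mono]) (rule s)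
      have "s \<bullet> of_int_vec u = s \<bullet> w + real n * (v \<bullet> s)"
        by (simp add: w_def inner_diff_right inner_commute)
      also have "v \<bullet> s = 0" using v(2)[OF span_base[OF s(1)]] by (simp add: orthogonal_def)
      finally have "s \<bullet> of_int_vec u \<le> norm s * norm w"
        using norm_cauchy_schwarz[of s w] by simp
      also have "\<dots> \<le> S * d" using w \<open>norm s \<le> S\<close>
        by (intro mult_mono) (auto intro: order_trans[OF norm_ge_zero])
      finally have 1: "\<kappa> * norm (of_int_vec u) \<le> S * d" using s(2) by linarith
      have "norm (real n *\<^sub>R v) \<le> norm (of_int_vec u) + norm w"
        unfolding w_def by (metis norm_minus_commute norm_triangle_sub)
      then have "real n * norm v - d \<le> norm (of_int_vec u)" using w by simp
      then have "\<kappa> * (real n * norm v - d) \<le> \<kappa> * norm (of_int_vec u)"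
        using \<kappa>(1) by (intro mult_left_mono) auto
      with 1 show ?thesis by linarith
    qed
    \<comment> \<open>the bound just obtained is linear in \<open>n\<close> on one side only\<close>
  obtain n where "real n * norm v > S * d / \<kappa> + d"
      using reals_Archimedean3[of "norm v"] v(1) by auto
    then have "\<kappa> * (S * d / \<kappa>) < \<kappa> * (real n * norm v - d)"
      using \<kappa>(1) by (intro mult_strict_left_mono) auto
    with bound[of n] \<kappa>(1) show False by simp
  qed
  then show ?thesis unfolding G_def by blast
qed

lemma coordinate_derivations_bounded:
  fixes c :: "int ^ 'd \<Rightarrow> int ^ 'd \<Rightarrow> complex"
  assumes c: "cocycle c" and len: "length_function len"
    and \<kappa>: "\<kappa> > 0" "\<And>x. \<kappa> * norm (of_int_vec x) \<le> len x"
  obtains R where "R > 0"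
    and "\<And>f i. f \<in> Cc \<Longrightarrow> commutator_norm len (regular_rep c f) \<le> 1 \<Longrightarrow>
      norm (regular_rep c (\<lambda>y. of_int (y $ i) * f y)) \<le> R"
proof -
  have "\<exists>C. \<forall>f\<in>Cc. norm (regular_rep c (\<lambda>y. of_int (y $ i) * f y)) \<le> C * commutator_norm len (regular_rep c f)" for i
  proof -
    have "axis i 1 \<bullet> of_int_vec y = of_int (y $ i)" for y :: "int ^ 'd"
      by (simp add: inner_axis' of_int_vec_def)
    with derivation_bounded[OF assms, of "axis i 1"] show ?thesis by simp
  qed
  then obtain C where C: "\<And>i f. f \<in> Cc \<Longrightarrow>
      norm (regular_rep c (\<lambda>y. of_int (y $ i) * f y)) \<le> C i * commutator_norm len (regular_rep c f)"
    by metis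
  show thesis
  proof
    show "(\<Sum>i\<in>UNIV. \<bar>C i\<bar>) + 1 > 0" by (simp add: add_nonneg_pos sum_nonneg)
    fix f :: "int ^ 'd \<Rightarrow> complex" and i
    assume f: "f \<in> Cc" and L: "commutator_norm len (regular_rep c f) \<le> 1"
    have "commutator_norm len (regular_rep c f) \<ge> 0"
      using commutator_norm_nonneg[OF c len, of "regular_rep c f"] f by (auto simp: twisted_algebra_def)
    then have "C i * commutator_norm len (regular_rep c f) \<le> \<bar>C i\<bar> * 1"
      using L by (intro mult_mono) auto
    moreover have "\<bar>C i\<bar> \<le> (\<Sum>i\<in>UNIV. \<bar>C i\<bar>)" by (rule member_le_sum) auto
    ultimately show "norm (regular_rep c (\<lambda>y. of_int (y $ i) * f y)) \<le> (\<Sum>i\<in>UNIV. \<bar>C i\<bar>) + 1"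
      using C[OF f, of i] by linarith
  qed
qed

section \<open>Comparison of the two topologies\<close>

lemma states_sum:
  assumes B: "unital_star_algebra B" and \<mu>: "\<mu> \<in> states B" and T: "\<And>i. i \<in> I \<Longrightarrow> T i \<in> B"
  shows "\<mu> (\<Sum>i\<in>I. T i) = (\<Sum>i\<in>I. \<mu> (T i)) \<and> (\<Sum>i\<in>I. T i) \<in> B"
proof -
  have 0: "0 \<in> B" using unital_star_algebra_scaleC[OF B unital_star_algebra_id[OF B], of 0] by simp
  then have "\<mu> 0 = 0" using states_scaleC[OF \<mu> 0, of 0] by simp
  with 0 T show ?thesis
    by (induction I rule: infinite_finite_induct)
       (auto simp: states_add[OF \<mu>] intro: unital_star_algebra_add[OF B])
qed

lemma topspace_rho_topology: "topspace (rho_topology B A L) = states B"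
proof -
  have "openin (rho_topology B A L) (states B)"
    unfolding openin_rho_topology by (auto intro!: exI[of _ 1])
  then show ?thesis
    by (metis openin_rho_topology openin_subset openin_topspace subset_antisym)
qed

text \<open>
  The value at an element \<open>a\<close> of the dense subalgebra moves by at most \<open>L(a)\<close> times the distance; an
  arbitrary \<open>b\<close> is approximated by such an \<open>a\<close>, uniformly over all states because they are contractive.
\<close>

lemma rho_topology_evaluation_continuous:
  assumes B: "unital_cstar_algebra B" and A: "unital_star_algebra A" "A \<subseteq> B" "B \<subseteq> closure A"
    and L: "seminorm_on A L" and b: "b \<in> B"
  shows "continuous_map (rho_topology B A L) euclidean (\<lambda>\<mu>. \<mu> b)"
proof -
  have Bs: "unital_star_algebra B" using B by (simp add: unital_cstar_algebra_def)
  have "openin (rho_topology B A L) {\<mu> \<in> states B. \<mu> b \<in> V}" if V: "open V" for V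
    unfolding openin_rho_topology
  proof (intro conjI ballI)
    fix \<mu> assume "\<mu> \<in> {\<mu> \<in> states B. \<mu> b \<in> V}"
    then have \<mu>: "\<mu> \<in> states B" "\<mu> b \<in> V" by auto
    obtain e where e: "e > 0" "\<And>z. dist z (\<mu> b) < e \<Longrightarrow> z \<in> V"
      using V \<mu>(2) by (auto simp: open_dist)
    obtain a where a: "a \<in> A" "dist a b < e / 4"
      using b A(3) e(1) by (metis closure_approachable subsetD zero_less_divide_iff zero_less_numeral)
    \<comment> \<open>\<open>L a\<close> may vanish, so \<open>a\<close> is rescaled by the slightly larger \<open>k\<close>\<close>
    define k where "k = L a + 1"
    have k: "k > 0" "L a \<le> k" using L a(1) by (auto simp: k_def seminorm_on_def add_nonneg_pos)
    define a' where "a' = scaleC_op (of_real (inverse k)) a"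
    have a': "a' \<in> A" "L a' \<le> 1" "a = scaleC_op (of_real k) a'"
    proof -
      show "a' \<in> A" unfolding a'_def by (rule unital_star_algebra_scaleC[OF A(1) a(1)])
      have "L a' = cmod (of_real (inverse k)) * L a"
        using L a(1) unfolding seminorm_on_def a'_def by blast
      then have "L a' = inverse k * L a" using k by (simp add: norm_inverse norm_divide field_simps)
      also have "\<dots> \<le> inverse k * k" using k by (intro mult_left_mono) auto
      finally show "L a' \<le> 1" using k by simp
      show "a = scaleC_op (of_real k) a'" using k by (simp add: a'_def)
    qed
    have "\<nu> \<in> {\<mu> \<in> states B. \<mu> b \<in> V}" if \<nu>: "\<nu> \<in> states B" "rho A L \<mu> \<nu> < ennreal (e / (4 * k))" for \<nu>
    proof -
      have "ennreal (cmod (\<mu> a' - \<nu> a')) \<le> rho A L \<mu> \<nu>"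
        unfolding rho_def by (rule SUP_upper) (use a' in auto)
      then have "ennreal (cmod (\<mu> a' - \<nu> a')) < ennreal (e / (4 * k))"
        using \<nu>(2) by (rule le_less_trans)
      then have "cmod (\<mu> a' - \<nu> a') < e / (4 * k)"
        by (simp add: ennreal_less_iff)
      then have "k * cmod (\<mu> a' - \<nu> a') < e / 4"
        using k by (simp add: field_simps)
      moreover have "\<mu> a - \<nu> a = of_real k * (\<mu> a' - \<nu> a')"
        using a'(1) A(2) states_scaleC[OF \<mu>(1), of a' "of_real k"] states_scaleC[OF \<nu>(1), of a' "of_real k"]
        by (simp add: a'(3)[symmetric] subset_iff right_diff_distrib)
      ultimately have 1: "cmod (\<mu> a - \<nu> a) < e / 4" using k by (simp add: norm_mult)
      have 2: "cmod (\<sigma> a - \<sigma> b) < e / 4" if \<sigma>: "\<sigma> \<in> states B" for \<sigma>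
      proof -
        have aB: "a \<in> B" using a A by blast
        have "cmod (\<sigma> (a - b)) \<le> norm (a - b)"
          by (rule states_contractive[OF B \<sigma> unital_star_algebra_diff[OF Bs aB b]])
        then show ?thesis using a(2) states_diff[OF Bs \<sigma> aB b] by (simp add: dist_norm)
      qed
      have "\<nu> b - \<mu> b = - (\<nu> a - \<nu> b) - (\<mu> a - \<nu> a) + (\<mu> a - \<mu> b)" by simp
      also have "cmod \<dots> \<le> cmod (\<nu> a - \<nu> b) + cmod (\<mu> a - \<nu> a) + cmod (\<mu> a - \<mu> b)"
        by (metis norm_minus_cancel norm_triangle_ineq norm_triangle_ineq4 norm_triangle_mono order_refl)
      finally have "dist (\<nu> b) (\<mu> b) < e"
        using 1 2[OF \<mu>(1)] 2[OF \<nu>(1)] e(1) by (simp add: dist_norm)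
      with e(2) \<nu>(1) show ?thesis by blast
    qed
    moreover have "ennreal (e / (4 * k)) > 0" using e k by (simp add: ennreal_less_zero_iff)
    ultimately show "\<exists>\<epsilon>>0. \<forall>\<nu>\<in>states B. rho A L \<mu> \<nu> < \<epsilon> \<longrightarrow> \<nu> \<in> {\<mu> \<in> states B. \<mu> b \<in> V}"
      by blast
  qed blast
  then show ?thesis by (simp add: continuous_map_def topspace_rho_topology)
qed

text \<open>
  The weak topology is the coarsest one for which all evaluations are continuous, which gives one
  inclusion. For the other, the uniformity hypothesis says that every ball for \<open>\<rho>\<^sub>L\<close> around a state
  contains a basic weak neighbourhood of it.
\<close>

lemma rho_topology_eq_weak_star:
  assumes B: "unital_cstar_algebra B" and A: "unital_star_algebra A" "A \<subseteq> B" "B \<subseteq> closure A"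
    and L: "seminorm_on A L"
    and uniform: "\<And>e. e > 0 \<Longrightarrow> \<exists>Y \<delta>. finite Y \<and> Y \<subseteq> B \<and> \<delta> > 0 \<and>
      (\<forall>\<mu>\<in>states B. \<forall>\<nu>\<in>states B. (\<forall>y\<in>Y. cmod (\<mu> y - \<nu> y) < \<delta>) \<longrightarrow>
        (\<forall>a\<in>A. L a \<le> 1 \<longrightarrow> cmod (\<mu> a - \<nu> a) \<le> e))"
  shows "rho_topology B A L = weak_star_topology B"
proof (rule topology_eq[THEN iffD2], intro allI iffI)
  let ?P = "product_topology (\<lambda>_. euclidean) B :: ('a op \<Rightarrow> complex) topology"
  fix U
  have ext: "states B \<subseteq> extensional B" by (auto simp: states_def)
  {
    assume U: "openin (weak_star_topology B) U"
    then obtain V where V: "openin ?P V" "U = V \<inter> states B"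
      by (auto simp: weak_star_topology_def openin_subtopology)
    have "continuous_map (rho_topology B A L) ?P (\<lambda>\<mu>. \<mu>)"
      using rho_topology_evaluation_continuous[OF B A L] ext
      by (simp add: continuous_map_componentwise topspace_rho_topology)
    then have "openin (rho_topology B A L) {\<mu> \<in> topspace (rho_topology B A L). \<mu> \<in> V}"
      using V(1) openin_continuous_map_preimage by blast
    moreover have "{\<mu> \<in> topspace (rho_topology B A L). \<mu> \<in> V} = U"
      using V(2) by (auto simp: topspace_rho_topology)
    ultimately show "openin (rho_topology B A L) U" by simp
  }
  {
    assume U: "openin (rho_topology B A L) U"
    show "openin (weak_star_topology B) U"
    proof (subst openin_subopen, intro ballI)
      fix \<mu> assume "\<mu> \<in> U"
      with U obtain \<epsilon> where \<epsilon>: "\<epsilon> > 0" "\<And>\<nu>. \<nu> \<in> states B \<Longrightarrow> rho A L \<mu> \<nu> < \<epsilon> \<Longrightarrow> \<nu> \<in> U"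
        and \<mu>: "\<mu> \<in> states B"
        unfolding openin_rho_topology by blast
      \<comment> \<open>the radius may be \<open>\<infinity>\<close>, so a finite one is inserted below it\<close>
      obtain q where q: "0 < q" "q < \<epsilon>" using \<epsilon>(1) dense by blast
      then have "q \<noteq> top" by auto
      then have "enn2real q > 0" "ennreal (enn2real q) = q"
        using q(1) by (simp_all add: enn2real_positive_iff less_top)
      then obtain Y \<delta> where Y: "finite Y" "Y \<subseteq> B" "\<delta> > 0"
        "\<And>\<nu> a. \<nu> \<in> states B \<Longrightarrow> \<forall>y\<in>Y. cmod (\<mu> y - \<nu> y) < \<delta> \<Longrightarrow> a \<in> A \<Longrightarrow> L a \<le> 1 \<Longrightarrow>
          cmod (\<mu> a - \<nu> a) \<le> enn2real q"
        using uniform[of "enn2real q"] \<mu> by blast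
      define W where "W = {\<nu> \<in> states B. \<forall>y\<in>Y. cmod (\<mu> y - \<nu> y) < \<delta>}"
      have "W \<subseteq> U"
      proof
        fix \<nu> assume \<nu>: "\<nu> \<in> W"
        have "rho A L \<mu> \<nu> \<le> ennreal (enn2real q)"
          unfolding rho_def using Y(4) \<nu> by (intro SUP_least) (auto simp: W_def intro: ennreal_leI)
        then have "rho A L \<mu> \<nu> < \<epsilon>"
          using q(2) \<open>ennreal (enn2real q) = q\<close> by simp
        with \<epsilon>(2) \<nu> show "\<nu> \<in> U" by (auto simp: W_def)
      qed
      moreover have "\<mu> \<in> W" using \<mu> Y(3) by (simp add: W_def)
      moreover have "openin (weak_star_topology B) W"
      proof -
        have ts: "topspace (weak_star_topology B) = states B"
          using ext by (auto simp: weak_star_topology_def PiE_def)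
        have "openin (weak_star_topology B) {\<nu> \<in> topspace (weak_star_topology B). \<nu> y \<in> ball (\<mu> y) \<delta>}"
          if "y \<in> Y" for y
        proof (rule openin_continuous_map_preimage)
          show "continuous_map (weak_star_topology B) euclidean (\<lambda>\<nu>. \<nu> y)"
            unfolding weak_star_topology_def
            using that Y(2) by (intro continuous_map_from_subtopology continuous_map_product_projection) auto
        qed simp
        then have "openin (weak_star_topology B)
            (topspace (weak_star_topology B) \<inter> (\<Inter>y\<in>Y. {\<nu> \<in> topspace (weak_star_topology B). \<nu> y \<in> ball (\<mu> y) \<delta>}))"
          using Y(1) by (cases "Y = {}") (auto intro!: openin_Int openin_INT2)
        also have "topspace (weak_star_topology B) \<inter> (\<Inter>y\<in>Y. {\<nu> \<in> topspace (weak_star_topology B). \<nu> y \<in> ball (\<mu> y) \<delta>}) = W"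
          unfolding ts W_def by (auto simp: dist_norm)
        finally show ?thesis .
      qed
      ultimately show "\<exists>W. openin (weak_star_topology B) W \<and> \<mu> \<in> W \<and> W \<subseteq> U" by blast
    qed
  }
qed

lemma finite_int_box: "finite {y :: int ^ 'd. \<forall>i. \<bar>y $ i\<bar> \<le> N i}"
proof -
  have "{y :: int ^ 'd. \<forall>i. \<bar>y $ i\<bar> \<le> N i} \<subseteq> vec_lambda ` (\<Pi>\<^sub>E i\<in>UNIV. {- N i..N i})"
  proof
    fix y :: "int ^ 'd" assume "y \<in> {y. \<forall>i. \<bar>y $ i\<bar> \<le> N i}"
    then have "vec_nth y \<in> (\<Pi>\<^sub>E i\<in>UNIV. {- N i..N i})" by (auto simp: abs_le_iff minus_le_iff)
    then show "y \<in> vec_lambda ` (\<Pi>\<^sub>E i\<in>UNIV. {- N i..N i})"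
      by (metis image_eqI vec_nth_inverse)
  qed
  then show ?thesis by (rule finite_subset) (intro finite_imageI finite_PiE, auto)
qed

text \<open>
  Up to a small error an element with \<open>L(a) \<le> 1\<close> is supported in a fixed box, by \<open>truncate_box_approx\<close>. Its
  coefficient at \<open>y \<noteq> 0\<close> is bounded by some coordinate derivation, since some \<open>\<bar>y\<^sub>i\<bar> \<ge> 1\<close>; at \<open>y = 0\<close> two states
  agree because \<open>\<pi>\<^sub>0\<close> is the identity.
\<close>

lemma states_uniformly_close:
  fixes c :: "int ^ 'd \<Rightarrow> int ^ 'd \<Rightarrow> complex"
  assumes c: "cocycle c" and len: "length_function len"
    and \<kappa>: "\<kappa> > 0" "\<And>x. \<kappa> * norm (of_int_vec x) \<le> len x" and e: "e > 0"
  shows "\<exists>Y \<delta>. finite Y \<and> Y \<subseteq> twisted_cstar c \<and> \<delta> > 0 \<and>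
      (\<forall>\<mu>\<in>states (twisted_cstar c). \<forall>\<nu>\<in>states (twisted_cstar c). (\<forall>T\<in>Y. cmod (\<mu> T - \<nu> T) < \<delta>) \<longrightarrow>
        (\<forall>a\<in>twisted_algebra c. commutator_norm len a \<le> 1 \<longrightarrow> cmod (\<mu> a - \<nu> a) \<le> e))"
proof -
  let ?B = "twisted_cstar c"
  let ?h = "\<lambda>i (y :: int ^ 'd). y $ i"
  have A: "unital_star_algebra (twisted_algebra c)" by (rule unital_star_algebra_twisted_algebra[OF c])
  have B: "unital_cstar_algebra ?B"
    unfolding twisted_cstar_def by (rule unital_cstar_algebra_closure[OF A])
  then have Bs: "unital_star_algebra ?B" by (simp add: unital_cstar_algebra_def)
  have AB: "twisted_algebra c \<subseteq> ?B" unfolding twisted_cstar_def by (rule closure_subset)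
  have piB: "pi_op c y \<in> ?B" for y using pi_op_in_twisted_algebra[of 1 c y] AB by auto
  obtain R where R: "R > 0" "\<And>f i. f \<in> Cc \<Longrightarrow> commutator_norm len (regular_rep c f) \<le> 1 \<Longrightarrow>
      norm (regular_rep c (\<lambda>y. of_int (y $ i) * f y)) \<le> R"
    using coordinate_derivations_bounded[OF c len \<kappa>] by blast
  obtain N where N: "\<And>f. f \<in> Cc \<Longrightarrow> (\<forall>i. norm (regular_rep c (\<lambda>y. of_int (y $ i) * f y)) \<le> R) \<Longrightarrow>
    norm (regular_rep c f - regular_rep c (truncate_box UNIV ?h N f)) \<le> e / 4"
    using truncate_box_approx[OF c finite_class.finite_UNIV, of ?h "e / 4" R] e by auto
  define Y where "Y = {y :: int ^ 'd. \<forall>i. \<bar>y $ i\<bar> \<le> int (N i)}"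
  have Y: "finite Y" unfolding Y_def by (rule finite_int_box)
  define \<delta> where "\<delta> = e / (2 * (real (card Y) + 1) * R)"
  have \<delta>: "\<delta> > 0" using e R(1) by (simp add: \<delta>_def add_nonneg_pos)
  have main: "cmod (\<mu> a - \<nu> a) \<le> e"
    if \<mu>: "\<mu> \<in> states ?B" and \<nu>: "\<nu> \<in> states ?B"
      and close: "\<forall>T\<in>pi_op c ` Y. cmod (\<mu> T - \<nu> T) < \<delta>"
      and a: "a \<in> twisted_algebra c" "commutator_norm len a \<le> 1" for \<mu> \<nu> a
  proof -
    obtain f where f: "f \<in> Cc" "a = regular_rep c f" using a(1) by (auto simp: twisted_algebra_def)
    have Df: "norm (regular_rep c (\<lambda>y. of_int (y $ i) * f y)) \<le> R" for i
      using R(2)[OF f(1)] a(2) f(2) by simp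
    define g where "g = truncate_box UNIV ?h N f"
    have gC: "g \<in> Cc" unfolding g_def by (rule truncate_box_Cc[OF f(1)])
    define b where "b = regular_rep c g"
    have ab: "norm (a - b) \<le> e / 4" unfolding b_def g_def f(2) using N[OF f(1)] Df by blast
    have bA: "b \<in> ?B" using gC AB by (auto simp: b_def twisted_algebra_def)
    have aB: "a \<in> ?B" using a(1) AB by blast
    \<comment> \<open>the truncation costs \<open>e / 4\<close> for each of the two states, the box itself \<open>e / 2\<close>\<close>
    have near: "cmod (\<sigma> a - \<sigma> b) \<le> e / 4" if \<sigma>: "\<sigma> \<in> states ?B" for \<sigma>
      using states_contractive[OF B \<sigma> unital_star_algebra_diff[OF Bs aB bA]] states_diff[OF Bs \<sigma> aB bA] ab
      by simp
    have b_sum: "b = (\<Sum>y\<in>Y. scaleC_op (g y) (pi_op c y))"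
      unfolding b_def by (rule regular_rep_superset[OF Y]) (auto simp: g_def truncate_box_def Y_def split: if_splits)
    have \<sigma>b: "\<sigma> b = (\<Sum>y\<in>Y. g y * \<sigma> (pi_op c y))" if \<sigma>: "\<sigma> \<in> states ?B" for \<sigma>
      unfolding b_sum using states_sum[OF Bs \<sigma>, of Y "\<lambda>y. scaleC_op (g y) (pi_op c y)"]
      by (simp add: unital_star_algebra_scaleC[OF Bs piB] states_scaleC[OF \<sigma> piB])
    have summand: "cmod (g y * (\<mu> (pi_op c y) - \<nu> (pi_op c y))) \<le> R * \<delta>" if y: "y \<in> Y" for y
    proof (cases "y = 0")
      case True
      then show ?thesis
        using R(1) \<delta> by (simp add: pi_op_0[OF c] states_id[OF \<mu>] states_id[OF \<nu>])
    next
      case False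
      then obtain i where i: "y $ i \<noteq> 0" by (auto simp: vec_eq_iff)
      have "cmod (g y) \<le> cmod (f y)" by (simp add: g_def truncate_box_def)
      also have "\<dots> \<le> cmod (of_int (y $ i) * f y)"
      proof -
        have "1 * cmod (f y) \<le> \<bar>real_of_int (y $ i)\<bar> * cmod (f y)"
          using i by (intro mult_right_mono) auto
        then show ?thesis by (simp add: norm_mult)
      qed
      also have "\<dots> \<le> norm (regular_rep c (\<lambda>y. of_int (y $ i) * f y))"
        by (rule cmod_coeff_le_norm_regular_rep[OF c Cc_cmult[OF f(1)]])
      also have "\<dots> \<le> R" by (rule Df)
      finally show ?thesis
        using close y \<delta> R(1) unfolding norm_mult by (intro mult_mono) (auto intro: less_imp_le)
    qed
    have "\<mu> b - \<nu> b = (\<Sum>y\<in>Y. g y * (\<mu> (pi_op c y) - \<nu> (pi_op c y)))"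
      by (simp add: \<sigma>b[OF \<mu>] \<sigma>b[OF \<nu>] sum_subtractf right_diff_distrib)
    then have "cmod (\<mu> b - \<nu> b) \<le> (\<Sum>y\<in>Y. R * \<delta>)"
      by (simp only:) (rule sum_norm_le[OF summand])
    also have "\<dots> \<le> (real (card Y) + 1) * (R * \<delta>)"
      using R(1) \<delta> by (simp add: mult_right_mono)
    also have "\<dots> = e / 2" using R(1) by (simp add: \<delta>_def field_simps add_nonneg_eq_0_iff)
    finally have mid: "cmod (\<mu> b - \<nu> b) \<le> e / 2" .
    have "\<mu> a - \<nu> a = (\<mu> a - \<mu> b) + (\<mu> b - \<nu> b) - (\<nu> a - \<nu> b)" by simp
    also have "cmod \<dots> \<le> cmod (\<mu> a - \<mu> b) + cmod (\<mu> b - \<nu> b) + cmod (\<nu> a - \<nu> b)"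
      using norm_triangle_ineq4[of "(\<mu> a - \<mu> b) + (\<mu> b - \<nu> b)" "\<nu> a - \<nu> b"]
        norm_triangle_ineq[of "\<mu> a - \<mu> b" "\<mu> b - \<nu> b"] by linarith
    finally show ?thesis using near[OF \<mu>] near[OF \<nu>] mid by linarith
  qed
  show ?thesis
  proof (intro exI[of _ "pi_op c ` Y"] exI[of _ \<delta>] conjI ballI impI)
    show "finite (pi_op c ` Y)" using Y by simp
    show "pi_op c ` Y \<subseteq> ?B" using piB by blast
    show "\<delta> > 0" by (rule \<delta>)
  qed (rule main)
qed

section \<open>Length functions dominate the Euclidean norm\<close>

text \<open>
  All norms on a finite-dimensional space are equivalent: a norm is convex, hence continuous, and attains
  a positive minimum on the Euclidean unit sphere.
\<close>

lemma norm_lower_bound: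
  fixes N :: "real ^ 'd \<Rightarrow> real"
  assumes N: "is_norm N"
  shows "\<exists>\<kappa>>0. \<forall>v. \<kappa> * norm v \<le> N v"
proof -
  have scale: "N (r *\<^sub>R v) = \<bar>r\<bar> * N v" for r v using N unfolding is_norm_def by blast
  have "convex_on UNIV N"
  proof (rule convex_onI)
    fix t :: real and x y :: "real ^ 'd" assume t: "0 < t" "t < 1"
    have "N ((1 - t) *\<^sub>R x + t *\<^sub>R y) \<le> N ((1 - t) *\<^sub>R x) + N (t *\<^sub>R y)"
      using N unfolding is_norm_def by blast
    then show "N ((1 - t) *\<^sub>R x + t *\<^sub>R y) \<le> (1 - t) * N x + t * N y"
      using t by (simp add: scale)
  qed simp
  then have "continuous_on UNIV N" by (rule convex_on_continuous[OF open_UNIV])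
  then have cont: "continuous_on (sphere 0 1) N" by (rule continuous_on_subset) simp
  have "(axis undefined 1 :: real ^ 'd) \<in> sphere 0 1" by (simp add: norm_axis_1)
  then have "sphere (0 :: real ^ 'd) 1 \<noteq> {}" by blast
  then obtain w where w: "w \<in> sphere 0 1" "\<And>v. v \<in> sphere 0 1 \<Longrightarrow> N w \<le> N v"
    using continuous_attains_inf[OF compact_sphere _ cont] by blast
  have "w \<noteq> 0" using w(1) by auto
  then have "N w > 0" using N unfolding is_norm_def by (metis less_eq_real_def)
  moreover have "N w * norm v \<le> N v" for v
  proof (cases "v = 0")
    case True
    then show ?thesis using N by (simp add: is_norm_def)
  next
    case False
    then have "N w \<le> N ((1 / norm v) *\<^sub>R v)" by (intro w(2)) simp
    then show ?thesis using False by (simp add: scale field_simps)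
  qed
  ultimately show ?thesis by blast
qed

text \<open>
  A word of \<open>n\<close> letters has Euclidean norm at most \<open>n\<close> times the largest norm of a letter.
\<close>

lemma word_length_lower_bound:
  fixes S :: "(int ^ 'd) set"
  assumes S: "finite S" "generating S"
  shows "\<exists>\<kappa>>0. \<forall>x. \<kappa> * norm (of_int_vec x) \<le> word_length S x"
proof -
  let ?S = "S \<union> uminus ` S"
  define M where "M = (\<Sum>y\<in>?S. norm (of_int_vec y)) + 1"
  have M: "M > 0" unfolding M_def by (intro add_nonneg_pos sum_nonneg) auto
  have le_M: "norm (of_int_vec y) \<le> M" if "y \<in> ?S" for y
    using member_le_sum[OF that, of "\<lambda>y. norm (of_int_vec y)"] S(1) unfolding M_def by fastforce
  have word: "norm (of_int_vec (sum_list w)) \<le> M * real (length w)" if "set w \<subseteq> ?S" for w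
    using that
  proof (induction w)
    case (Cons y w)
    have "norm (of_int_vec (y + sum_list w)) \<le> norm (of_int_vec y) + norm (of_int_vec (sum_list w))"
      unfolding of_int_vec_add by (rule norm_triangle_ineq)
    also have "\<dots> \<le> M + M * real (length w)"
      using Cons by (intro add_mono le_M) auto
    finally show ?case by (simp add: algebra_simps)
  qed simp
  have "norm (of_int_vec x) \<le> M * word_length S x" for x
  proof -
    let ?P = "\<lambda>n. \<exists>w. word_for S w x \<and> length w = n"
    have "\<exists>n. ?P n" using S(2) unfolding generating_def by blast
    then have "?P (LEAST n. ?P n)" by (rule LeastI_ex)
    then obtain w where w: "word_for S w x" "length w = (LEAST n. ?P n)" by blast
    then have "word_length S x = real (length w)" by (simp add: word_length_def)
    then show ?thesis using word[of w] w(1) by (simp add: word_for_def)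
  qed
  then have "inverse M * norm (of_int_vec x) \<le> word_length S x" for x
    using M by (simp add: field_simps)
  then show ?thesis using M by (intro exI[of _ "inverse M"]) auto
qed

theorem theorem0p1:
  fixes len :: "int ^ 'd \<Rightarrow> real" and c :: "int ^ 'd \<Rightarrow> int ^ 'd \<Rightarrow> complex"
  assumes "length_function len"
    and "(\<exists>S. finite S \<and> generating S \<and> len = word_length S) \<or>
         (\<exists>N :: real ^ 'd \<Rightarrow> real. is_norm N \<and> (\<forall>x. len x = N (of_int_vec x)))"
    and "cocycle c"
  shows "lip_norm (twisted_cstar c) (twisted_algebra c) (commutator_norm len)"
proof -
  note len = assms(1) and c = assms(3)
  obtain \<kappa> where \<kappa>: "\<kappa> > 0" "\<And>x. \<kappa> * norm (of_int_vec x) \<le> len x"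
    using assms(2) word_length_lower_bound norm_lower_bound by metis
  have A: "unital_star_algebra (twisted_algebra c)" by (rule unital_star_algebra_twisted_algebra[OF c])
  have B: "unital_cstar_algebra (twisted_cstar c)"
    unfolding twisted_cstar_def by (rule unital_cstar_algebra_closure[OF A])
  have AB: "twisted_algebra c \<subseteq> twisted_cstar c" "twisted_cstar c \<subseteq> closure (twisted_algebra c)"
    by (simp_all add: twisted_cstar_def closure_subset)
  have L: "seminorm_on (twisted_algebra c) (commutator_norm len)"
    by (rule seminorm_on_commutator_norm[OF c len])
  show ?thesis
    unfolding lip_norm_def
    using A B AB L commutator_norm_id[of len]
      rho_topology_eq_weak_star[OF B A AB L states_uniformly_close[OF c len \<kappa>]]
    by simp
qed

end
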